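(* Let $\Phi$ be an indecomposable root system of rank $>1$ and $G_\pi(\Phi,\mathbb R)$ the corresponding Chevalley group over the field of real numbers $\mathbb R$. If an element $g\in E_\pi(\Phi,\mathbb R)$ is not computable, then the Diophantine problem for equations with coefficients in $\{x_\alpha(1)\mid\alpha\in\Phi\}\cup\{g\}$ is undecidable in any large subgroup of $G_\pi(\Phi,\mathbb R)$.
   Context: A real number $a$ is computable if its standard decimal expansion is a computable sequence, equivalently if it can be effectively approximated by rationals with any precision. Elements of $G_\pi(\Phi,\mathbb R)$ are represented by matrices in $\mathrm{SL}_n(\mathbb R)$; an element is computable if all entries of its matrix are computable reals. Root systems are reduced. Let $\mathcal L$ be the complex semisimple Lie algebra with root system $\Phi$, with Chevalley basis $\{h_i;x_\alpha\}$, and let $\pi$ be a faithful finite-dimensional representation of $\mathcal L$ with weight lattice $\Lambda_\pi$. $G_\pi(\Phi,R)$ denotes the Chevalley group of type $(\Phi,\Lambda_\pi)$ over a commutative ring $R$ with $1$, i.e. the group of $R$-points of the Chevalley--Demazure group scheme, realized as the subgroup of $\mathrm{SL}_n(R)$, $n=\dim\pi$, given by polynomial equations with integer coefficients in the matrix entries. $x_\alpha(t)=\exp(t\pi(x_\alpha))$ ($\alpha\in\Phi$, $t\in R$) are the elementary root unipotents, $E_\pi(\Phi,R)$ is the subgroup generated by all of them, and a subgroup of $G_\pi(\Phi,R)$ is large if it contains $E_\pi(\Phi,R)$. The Diophantine problem in a group $G$ for equations with coefficients in a finite set $C\subseteq G$ is decidable if there is an algorithm which, given a finite system of group equations with coefficients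 in $C$, decides whether the system has a solution in $G$; otherwise it is undecidable. *)

theory Defs
  imports
    "HOL-Analysis.Analysis"
    "HOL-Algebra.Generated_Groups"
    "HOL-Library.Poly_Mapping"
    "HOL-Library.Nat_Bijection"
begin

section \<open>Computability\<close>

text \<open>Partial recursive functions on tuples of natural numbers, as Kleene's closure under
  composition, primitive recursion (on the first argument) and unbounded minimization.
  \<open>rec_eval f xs y\<close> says that \<open>f\<close> is defined at \<open>xs\<close> with value \<open>y\<close>.\<close>

datatype recf =
    RZero
  | RSuc
  | RProj nat
  | RComp recf "recf list"
  | RPrim recf recf
  | RMin recf

inductive rec_eval :: "recf \<Rightarrow> nat list \<Rightarrow> nat \<Rightarrow> bool" where
  zero: "rec_eval RZero xs 0"
| suc: "rec_eval RSuc [x] (Suc x)"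
| proj: "i < length xs \<Longrightarrow> rec_eval (RProj i) xs (xs ! i)"
| comp: "list_all2 (\<lambda>g y. rec_eval g xs y) gs ys \<Longrightarrow> rec_eval f ys z
    \<Longrightarrow> rec_eval (RComp f gs) xs z"
| prim_0: "rec_eval f xs y \<Longrightarrow> rec_eval (RPrim f g) (0 # xs) y"
| prim_Suc: "rec_eval (RPrim f g) (n # xs) y \<Longrightarrow> rec_eval g (n # y # xs) z
    \<Longrightarrow> rec_eval (RPrim f g) (Suc n # xs) z"
| min: "rec_eval f (n # xs) 0 \<Longrightarrow> \<forall>m<n. \<exists>y. rec_eval f (m # xs) (Suc y)
    \<Longrightarrow> rec_eval (RMin f) xs n"
monos list_all2_mono

definition computable_seq :: "(nat \<Rightarrow> nat) \<Rightarrow> bool" where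
  "computable_seq f \<longleftrightarrow> (\<exists>r. \<forall>n. rec_eval r [n] (f n))"

text \<open>The expansion of \<open>\<bar>a\<bar>\<close>: entry \<open>0\<close> is the integer part, entry \<open>n \<ge> 1\<close> the \<open>n\<close>-th digit after
  the decimal point (never ending in all nines). The sign is one bit and plays no role for
  computability.\<close>

definition decimal_expansion :: "real \<Rightarrow> nat \<Rightarrow> nat" where
  "decimal_expansion a n =
    (if n = 0 then nat \<lfloor>\<bar>a\<bar>\<rfloor> else nat (\<lfloor>\<bar>a\<bar> * 10 ^ n\<rfloor> mod 10))"

definition computable_real :: "real \<Rightarrow> bool" where
  "computable_real a \<longleftrightarrow> computable_seq (decimal_expansion a)"

definition computable_matrix :: "real^'n^'n \<Rightarrow> bool" where
  "computable_matrix A \<longleftrightarrow> (\<forall>i j. computable_real (A $ i $ j))"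


section \<open>The Diophantine problem in a group\<close>

text \<open>Equations have the form \<open>w = 1\<close> for a word \<open>w\<close> in the variables, the coefficients and their
  inverses. Coefficients are referred to by their position in a list enumerating the finite set
  of coefficients.\<close>

datatype letter = Var nat | VarInv nat | Coeff nat | CoeffInv nat

type_synonym eqn_word = "letter list"
type_synonym eqn_system = "eqn_word list"

fun letter_val :: "('a, 'b) monoid_scheme \<Rightarrow> 'a list \<Rightarrow> (nat \<Rightarrow> 'a) \<Rightarrow> letter \<Rightarrow> 'a" where
  "letter_val G cs \<sigma> (Var i) = \<sigma> i"
| "letter_val G cs \<sigma> (VarInv i) = inv\<^bsub>G\<^esub> (\<sigma> i)"
| "letter_val G cs \<sigma> (Coeff i) = cs ! i"
| "letter_val G cs \<sigma> (CoeffInv i) = inv\<^bsub>G\<^esub> (cs ! i)"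

definition word_val :: "('a, 'b) monoid_scheme \<Rightarrow> 'a list \<Rightarrow> (nat \<Rightarrow> 'a) \<Rightarrow> eqn_word \<Rightarrow> 'a" where
  "word_val G cs \<sigma> w = foldr (\<lambda>l y. letter_val G cs \<sigma> l \<otimes>\<^bsub>G\<^esub> y) w \<one>\<^bsub>G\<^esub>"

definition system_solvable :: "('a, 'b) monoid_scheme \<Rightarrow> 'a list \<Rightarrow> eqn_system \<Rightarrow> bool" where
  "system_solvable G cs S \<longleftrightarrow>
    (\<exists>\<sigma>. (\<forall>i. \<sigma> i \<in> carrier G) \<and> (\<forall>w\<in>set S. word_val G cs \<sigma> w = \<one>\<^bsub>G\<^esub>))"

fun letter_wf :: "nat \<Rightarrow> letter \<Rightarrow> bool" where
  "letter_wf k (Var i) \<longleftrightarrow> True"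
| "letter_wf k (VarInv i) \<longleftrightarrow> True"
| "letter_wf k (Coeff i) \<longleftrightarrow> i < k"
| "letter_wf k (CoeffInv i) \<longleftrightarrow> i < k"

definition system_wf :: "nat \<Rightarrow> eqn_system \<Rightarrow> bool" where
  "system_wf k S \<longleftrightarrow> (\<forall>w\<in>set S. \<forall>l\<in>set w. letter_wf k l)"

fun letter_code :: "letter \<Rightarrow> nat" where
  "letter_code (Var i) = 4 * i"
| "letter_code (VarInv i) = 4 * i + 1"
| "letter_code (Coeff i) = 4 * i + 2"
| "letter_code (CoeffInv i) = 4 * i + 3"

definition system_code :: "eqn_system \<Rightarrow> nat" where
  "system_code S = list_encode (map (\<lambda>w. list_encode (map letter_code w)) S)"

text \<open>Decidability does not depend on the enumeration \<open>cs\<close>, as passing from one enumeration of a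
  finite set to another is a computable relabelling.\<close>

definition diophantine_decidable :: "('a, 'b) monoid_scheme \<Rightarrow> 'a set \<Rightarrow> bool" where
  "diophantine_decidable G C \<longleftrightarrow>
    (\<exists>cs r. set cs = C \<and>
      (\<forall>S. system_wf (length cs) S \<longrightarrow>
        rec_eval r [system_code S] (if system_solvable G cs S then 1 else 0)))"


section \<open>Root systems\<close>

definition coroot :: "'e::euclidean_space \<Rightarrow> 'e" where
  "coroot a = (2 / (a \<bullet> a)) *\<^sub>R a"

definition root_system :: "'e::euclidean_space set \<Rightarrow> bool" where
  "root_system Phi \<longleftrightarrow>
    finite Phi \<and> span Phi = UNIV \<and> 0 \<notin> Phi \<and>
    (\<forall>a\<in>Phi. \<forall>b\<in>Phi. b - (b \<bullet> coroot a) *\<^sub>R a \<in> Phi) \<and>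
    (\<forall>a\<in>Phi. \<forall>b\<in>Phi. b \<bullet> coroot a \<in> \<int>) \<and>
    (\<forall>a\<in>Phi. \<forall>c. c *\<^sub>R a \<in> Phi \<longrightarrow> c = 1 \<or> c = -1)"

definition indecomposable :: "'e::euclidean_space set \<Rightarrow> bool" where
  "indecomposable Phi \<longleftrightarrow>
    Phi \<noteq> {} \<and>
    \<not> (\<exists>A B. A \<noteq> {} \<and> B \<noteq> {} \<and> A \<union> B = Phi \<and> A \<inter> B = {} \<and> (\<forall>a\<in>A. \<forall>b\<in>B. a \<bullet> b = 0))"

definition root_base :: "'e::euclidean_space set \<Rightarrow> 'e set \<Rightarrow> bool" where
  "root_base Phi Delta \<longleftrightarrow>
    Delta \<subseteq> Phi \<and> independent Delta \<and> span Delta = UNIV \<and>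
    (\<forall>a\<in>Phi. \<exists>c :: 'e \<Rightarrow> int. a = (\<Sum>d\<in>Delta. of_int (c d) *\<^sub>R d) \<and>
      ((\<forall>d\<in>Delta. 0 \<le> c d) \<or> (\<forall>d\<in>Delta. c d \<le> 0)))"


section \<open>Semisimple Lie algebras, Chevalley bases and representations\<close>

locale complex_lie_algebra = vector_space smul
  for smul :: "complex \<Rightarrow> 'l::ab_group_add \<Rightarrow> 'l" +
  fixes bracket :: "'l \<Rightarrow> 'l \<Rightarrow> 'l"
  assumes bracket_add_left: "bracket (u + v) w = bracket u w + bracket v w"
    and bracket_add_right: "bracket u (v + w) = bracket u v + bracket u w"
    and bracket_scale_left: "bracket (smul c u) v = smul c (bracket u v)"
    and bracket_scale_right: "bracket u (smul c v) = smul c (bracket u v)"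
    and bracket_self: "bracket u u = 0"
    and jacobi: "bracket u (bracket v w) + bracket v (bracket w u) + bracket w (bracket u v) = 0"

definition lie_ideal ::
  "(complex \<Rightarrow> 'l::ab_group_add \<Rightarrow> 'l) \<Rightarrow> ('l \<Rightarrow> 'l \<Rightarrow> 'l) \<Rightarrow> 'l set \<Rightarrow> bool" where
  "lie_ideal smul bracket I \<longleftrightarrow>
    module.subspace smul I \<and> (\<forall>u. \<forall>v\<in>I. bracket u v \<in> I)"

definition lie_derived ::
  "(complex \<Rightarrow> 'l::ab_group_add \<Rightarrow> 'l) \<Rightarrow> ('l \<Rightarrow> 'l \<Rightarrow> 'l) \<Rightarrow> 'l set \<Rightarrow> 'l set" where
  "lie_derived smul bracket I = module.span smul {bracket u v |u v. u \<in> I \<and> v \<in> I}"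

definition lie_solvable ::
  "(complex \<Rightarrow> 'l::ab_group_add \<Rightarrow> 'l) \<Rightarrow> ('l \<Rightarrow> 'l \<Rightarrow> 'l) \<Rightarrow> 'l set \<Rightarrow> bool" where
  "lie_solvable smul bracket I \<longleftrightarrow> (\<exists>k. (lie_derived smul bracket ^^ k) I = {0})"

definition semisimple_lie_algebra ::
  "(complex \<Rightarrow> 'l::ab_group_add \<Rightarrow> 'l) \<Rightarrow> ('l \<Rightarrow> 'l \<Rightarrow> 'l) \<Rightarrow> bool" where
  "semisimple_lie_algebra smul bracket \<longleftrightarrow>
    complex_lie_algebra smul bracket \<and>
    (\<exists>B. finite B \<and> module.span smul B = UNIV) \<and>
    (\<forall>I. lie_ideal smul bracket I \<and> lie_solvable smul bracket I \<longrightarrow> I = {0})"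

text \<open>Chevalley basis \<open>{h\<^sub>d, x\<^sub>a}\<close> indexed by the simple roots \<open>d\<close> and the roots \<open>a\<close>. The relations
  say that the \<open>h\<^sub>d\<close> span a Cartan subalgebra whose root system is \<open>Phi\<close> and that \<open>h\<^sub>d\<close> is the
  coroot of \<open>d\<close>; in particular they express that the Lie algebra has root system \<open>Phi\<close>. The bracket
  \<open>[x\<^sub>a, x\<^bsub>-a\<^esub>]\<close> is the coroot of \<open>a\<close>, written as an integral combination of the \<open>h\<^sub>d\<close>.\<close>

definition chevalley_basis ::
  "(complex \<Rightarrow> 'l::ab_group_add \<Rightarrow> 'l) \<Rightarrow> ('l \<Rightarrow> 'l \<Rightarrow> 'l) \<Rightarrow>
    'e::euclidean_space set \<Rightarrow> 'e set \<Rightarrow> ('e \<Rightarrow> 'l) \<Rightarrow> ('e \<Rightarrow> 'l) \<Rightarrow> bool" where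
  "chevalley_basis smul bracket Phi Delta h x \<longleftrightarrow>
    inj_on (case_sum h x) (Delta <+> Phi) \<and>
    \<not> module.dependent smul (case_sum h x ` (Delta <+> Phi)) \<and>
    module.span smul (case_sum h x ` (Delta <+> Phi)) = UNIV \<and>
    (\<forall>d\<in>Delta. \<forall>e\<in>Delta. bracket (h d) (h e) = 0) \<and>
    (\<forall>d\<in>Delta. \<forall>b\<in>Phi. bracket (h d) (x b) = smul (of_real (b \<bullet> coroot d)) (x b)) \<and>
    (\<forall>a\<in>Phi. \<exists>c :: 'e \<Rightarrow> int.
      coroot a = (\<Sum>d\<in>Delta. of_int (c d) *\<^sub>R coroot d) \<and>
      bracket (x a) (x (- a)) = (\<Sum>d\<in>Delta. smul (of_int (c d)) (h d))) \<and>
    (\<forall>a\<in>Phi. \<forall>b\<in>Phi. a + b \<noteq> 0 \<and> a + b \<notin> Phi \<longrightarrow> bracket (x a) (x b) = 0) \<and>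
    (\<forall>a\<in>Phi. \<forall>b\<in>Phi. a + b \<in> Phi \<longrightarrow>
      (let r = (GREATEST r::nat. b - of_nat r *\<^sub>R a \<in> Phi) in
        bracket (x a) (x b) = smul (of_nat (r + 1)) (x (a + b)) \<or>
        bracket (x a) (x b) = smul (- of_nat (r + 1)) (x (a + b))))"

definition faithful_rep ::
  "(complex \<Rightarrow> 'l::ab_group_add \<Rightarrow> 'l) \<Rightarrow> ('l \<Rightarrow> 'l \<Rightarrow> 'l) \<Rightarrow> ('l \<Rightarrow> complex^'n^'n) \<Rightarrow> bool" where
  "faithful_rep smul bracket rep \<longleftrightarrow>
    inj rep \<and>
    (\<forall>u v. rep (u + v) = rep u + rep v) \<and>
    (\<forall>c u. rep (smul c u) = (\<chi> i j. c * rep u $ i $ j)) \<and>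
    (\<forall>u v. rep (bracket u v) = rep u ** rep v - rep v ** rep u)"

primrec matpow :: "'k::semiring_1^'n^'n \<Rightarrow> nat \<Rightarrow> 'k^'n^'n" where
  "matpow A 0 = mat 1"
| "matpow A (Suc k) = A ** matpow A k"

text \<open>The matrices are taken with respect to a basis of an admissible lattice, i.e. one in which
  all \<open>rep (x\<^sub>a)^k / k!\<close> are integral; this is the choice of coordinates that realizes the Chevalley
  group over every ring inside \<open>SL\<^sub>n\<close>.\<close>

definition integral_coordinates ::
  "('l \<Rightarrow> complex^'n^'n) \<Rightarrow> 'e set \<Rightarrow> ('e \<Rightarrow> 'l) \<Rightarrow> bool" where
  "integral_coordinates rep Phi x \<longleftrightarrow>
    (\<forall>a\<in>Phi. \<forall>k i j. matpow (rep (x a)) k $ i $ j / fact k \<in> \<int>)"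


section \<open>Chevalley groups\<close>

definition SL_group :: "('k::field^'n^'n) monoid" where
  "SL_group = \<lparr>carrier = {A. det A = 1}, mult = (**), one = mat 1\<rparr>"

definition mat_exp :: "'k::{real_normed_field,banach}^'n^'n \<Rightarrow> 'k^'n^'n" where
  "mat_exp A = (\<chi> i j. suminf (\<lambda>k. matpow A k $ i $ j / fact k))"

text \<open>\<open>x\<^sub>a(t) = exp(t rep(x\<^sub>a))\<close> over the real or complex numbers. The entries of \<open>rep (x\<^sub>a)\<close> are integers,
  and \<open>of_int \<lfloor>Re _\<rfloor>\<close> merely transports them from the complex numbers to the field \<open>'k\<close>.\<close>

definition root_unipotent ::
  "('l \<Rightarrow> complex^'n^'n) \<Rightarrow> ('e \<Rightarrow> 'l) \<Rightarrow> 'e \<Rightarrow> 'k::{real_normed_field,banach} \<Rightarrow> 'k^'n^'n" where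
  "root_unipotent rep x a t = mat_exp (\<chi> i j. t * of_int \<lfloor>Re (rep (x a) $ i $ j)\<rfloor>)"

definition elementary_group ::
  "('l \<Rightarrow> complex^'n^'n) \<Rightarrow> 'e set \<Rightarrow> ('e \<Rightarrow> 'l) \<Rightarrow> ('k::{real_normed_field,banach}^'n^'n) set" where
  "elementary_group rep Phi x = generate SL_group {root_unipotent rep x a t |a t. a \<in> Phi}"

text \<open>Integer polynomials in the \<open>n\<^sup>2\<close> matrix entries: finitely supported maps from monomials
  (exponent vectors) to coefficients.\<close>

type_synonym 'n entry_poly = "(('n \<times> 'n) \<Rightarrow>\<^sub>0 nat) \<Rightarrow>\<^sub>0 int"

definition eval_entry_poly :: "'n entry_poly \<Rightarrow> 'k::comm_ring_1^'n^'n \<Rightarrow> 'k" where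
  "eval_entry_poly p A =
    (\<Sum>m\<in>Poly_Mapping.keys p. of_int (Poly_Mapping.lookup p m) *
      (\<Prod>(i, j)\<in>UNIV. (A $ i $ j) ^ Poly_Mapping.lookup m (i, j)))"

text \<open>The equations of the Chevalley--Demazure scheme in \<open>SL\<^sub>n\<close> are the integer polynomials vanishing
  on the complex group, which is \<open>E\<^sub>\<pi>(\<Phi>, \<complex>)\<close> (over an algebraically closed field the elementary
  subgroup is the whole Chevalley group).\<close>

definition chevalley_equations ::
  "('l \<Rightarrow> complex^'n^'n) \<Rightarrow> 'e set \<Rightarrow> ('e \<Rightarrow> 'l) \<Rightarrow> 'n entry_poly set" where
  "chevalley_equations rep Phi x =
    {p. \<forall>B \<in> elementary_group rep Phi x. eval_entry_poly p (B :: complex^'n^'n) = 0}"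

definition chevalley_group ::
  "('l \<Rightarrow> complex^'n^'n) \<Rightarrow> 'e set \<Rightarrow> ('e \<Rightarrow> 'l) \<Rightarrow> ('k::field^'n^'n) monoid" where
  "chevalley_group rep Phi x =
    SL_group\<lparr>carrier :=
      {A \<in> carrier SL_group. \<forall>p \<in> chevalley_equations rep Phi x. eval_entry_poly p A = 0}\<rparr>"

definition large_subgroup ::
  "('l \<Rightarrow> complex^'n^'n) \<Rightarrow> 'e set \<Rightarrow> ('e \<Rightarrow> 'l) \<Rightarrow>
    ('k::{real_normed_field,banach}^'n^'n) set \<Rightarrow> bool" where
  "large_subgroup rep Phi x H \<longleftrightarrow>
    subgroup H (chevalley_group rep Phi x) \<and> elementary_group rep Phi x \<subseteq> H"

end

theory Submission
  imports Defs
begin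

text \<open>For a root \<open>c\<close> let \<open>x\<^sub>c(t) = exp(t M\<^sub>c)\<close> and let \<open>h\<^sub>c(s)\<close> be the torus elements. Inside any
    large
  subgroup \<open>H\<close> the elements that act on all root vectors by given powers of \<open>2\<close> are described by
  equations with coefficients \<open>x\<^sub>d(1)\<close>, since \<open>exp\<close> is injective on nilpotent matrices. If \<open>A \<in> H\<close>
  commutes with \<open>x\<^sub>c(1)\<close> and with such elements whose weights jointly vanish only on \<open>\<plusminus>c\<close>, then
  \<open>Ad(A)\<close> maps \<open>h\<^sub>c\<close> to \<open>h\<^sub>c + p M\<^sub>c\<close>, and the commutator of \<open>A\<close> with \<open>h\<^sub>c(2)\<close> lies in the root
      subgroup;
  all of the root subgroup arises in this way, so it is Diophantine. Here two consequences of the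
  integral equations of the Chevalley group are used: \<open>Ad(A)\<close> preserves the Lie algebra, and \<open>A\<close>
  commutes with everything that commutes with all \<open>M\<^sub>d\<close>.

  An element conjugating \<open>x\<^sub>c(1)\<close> to \<open>x\<^sub>c(u)\<close> multiplies the parameter by \<open>u\<close>, which makes
  \<open>x\<^sub>c(\<real>)\<close> a Diophantine copy of the field \<open>\<real>\<close>. If \<open>\<langle>d, c\<^sup>\<or>\<rangle> = m \<noteq> 0\<close>, then \<open>h\<^sub>c(s)\<close> conjugates
      \<open>x\<^sub>d(1)\<close> to
  \<open>x\<^sub>d(s\<^sup>m)\<close>; hence the copies for non-orthogonal roots, and by indecomposability for all roots,
      can be
  identified by equations. As the entries of a product of root unipotents are integral polynomials
      in the
  parameters, \<open>x\<^sub>r(g\<^sub>i\<^sub>j)\<close> is definable from \<open>g\<close>, and \<open>N \<bar>g\<^sub>i\<^sub>j\<bar> \<ge> m\<close> says that \<open>N \<bar>g\<^sub>i\<^sub>j\<bar> - m\<close> is a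
  square. Deciding these systems computes the decimal expansion of \<open>g\<^sub>i\<^sub>j\<close>.\<close>

section \<open>Computable functions\<close>

text \<open>The obstacle is that \<open>H\<close> may contain elements outside the elementary
  subgroup, about which only integer polynomial equations are known. What is needed about them must
  therefore be phrased as integer polynomial identities and checked on the complex elementary group.
  This works because the root vectors are integral matrices: the spans in question are cut out by
  integral linear forms, and inverses are polynomial in the entries because the determinant is 1.
  The base 2 keeps torus weights expressible: being scaled by a power of 2 says that one integral
  power of \<open>x_d(1)\<close> is conjugate to another, which is an equation over the given
  coefficients. Such equations fix a torus element only up to elements commuting with all root
  vectors, and the conditions on A leave the same freedom. A commutator cancels both, which is why
  the root subgroup is described by commutators and not by A itself. Torus elements arise as
  exponentials and so produce only positive parameters; a general real number is handled as a
  difference of two positive ones. Squares serve twice: to single out positive parameters and to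
  express the order of the reals.\<close>

definition computable_fun :: "nat \<Rightarrow> (nat list \<Rightarrow> nat) \<Rightarrow> bool" where
  "computable_fun k f \<longleftrightarrow> (\<exists>r. \<forall>xs. length xs = k \<longrightarrow> rec_eval r xs (f xs))"

lemma computable_funI:
  "(\<And>xs. length xs = k \<Longrightarrow> rec_eval r xs (f xs)) \<Longrightarrow> computable_fun k f"
  unfolding computable_fun_def by blast

lemma computable_fun_nth: "i < k \<Longrightarrow> computable_fun k (\<lambda>xs. xs ! i)"
  by (rule computable_funI[where r = "RProj i"]) (simp add: rec_eval.proj)

lemma computable_fun_compose:
  assumes "computable_fun (length gs) f" and "\<forall>g\<in>set gs. computable_fun k g"
  shows "computable_fun k (\<lambda>xs. f (map (\<lambda>g. g xs) gs))"
proof -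
  obtain rf where rf: "\<And>ys. length ys = length gs \<Longrightarrow> rec_eval rf ys (f ys)"
    using assms(1) unfolding computable_fun_def by blast
  define R where "R g = (SOME r. \<forall>xs. length xs = k \<longrightarrow> rec_eval r xs (g xs))" for g
  have R: "rec_eval (R g) xs (g xs)" if "g \<in> set gs" "length xs = k" for g xs
    using assms(2) that someI_ex[of "\<lambda>r. \<forall>xs. length xs = k \<longrightarrow> rec_eval r xs (g xs)"]
    unfolding R_def computable_fun_def by blast
  show ?thesis
  proof (rule computable_funI)
    fix xs :: "nat list" assume xs: "length xs = k"
    have "list_all2 (\<lambda>g y. rec_eval g xs y) (map R gs) (map (\<lambda>g. g xs) gs)"
      using R xs by (simp add: list_all2_conv_all_nth)
    then show "rec_eval (RComp rf (map R gs)) xs (f (map (\<lambda>g. g xs) gs))"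
      by (rule rec_eval.comp) (simp add: rf)
  qed
qed

lemma computable_fun_compose1:
  "computable_fun 1 (\<lambda>xs. f (xs ! 0)) \<Longrightarrow> computable_fun k g \<Longrightarrow> computable_fun k (\<lambda>xs. f (g xs))"
  using computable_fun_compose[of "[g]" "\<lambda>xs. f (xs ! 0)" k] by simp

lemma computable_fun_compose2:
  "computable_fun 2 (\<lambda>xs. f (xs ! 0) (xs ! 1)) \<Longrightarrow> computable_fun k g \<Longrightarrow> computable_fun k h
    \<Longrightarrow> computable_fun k (\<lambda>xs. f (g xs) (h xs))"
  using computable_fun_compose[of "[g, h]" "\<lambda>xs. f (xs ! 0) (xs ! 1)" k]
  by (simp add: numeral_2_eq_2)

lemma computable_fun_Suc:
  assumes "computable_fun k f"
  shows "computable_fun k (\<lambda>xs. Suc (f xs))"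
proof (rule computable_fun_compose1[OF _ assms])
  show "computable_fun 1 (\<lambda>xs. Suc (xs ! 0))"
    by (rule computable_funI[where r = RSuc]) (auto simp: length_Suc_conv intro: rec_eval.suc)
qed

lemma computable_fun_const: "computable_fun k (\<lambda>xs. c)"
proof (induction c)
  case 0
  show ?case by (rule computable_funI[where r = RZero]) (rule rec_eval.zero)
qed (rule computable_fun_Suc)

lemma computable_fun_prim:
  assumes f: "computable_fun k f" and g: "computable_fun (Suc (Suc k)) g"
    and zero: "\<And>xs. length xs = k \<Longrightarrow> F (0 # xs) = f xs"
    and Suc: "\<And>n xs. length xs = k \<Longrightarrow> F (Suc n # xs) = g (n # F (n # xs) # xs)"
  shows "computable_fun (Suc k) F"
proof -
  obtain rf rg where rf: "\<And>xs. length xs = k \<Longrightarrow> rec_eval rf xs (f xs)"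
    and rg: "\<And>xs. length xs = Suc (Suc k) \<Longrightarrow> rec_eval rg xs (g xs)"
    using f g unfolding computable_fun_def by blast
  have eval: "rec_eval (RPrim rf rg) (n # xs) (F (n # xs))" if xs: "length xs = k" for n xs
  proof (induction n)
    case 0
    show ?case using xs by (simp add: zero rf rec_eval.prim_0)
  next
    case (Suc n)
    then show ?case using xs by (auto simp: assms(4) intro!: rec_eval.prim_Suc rg)
  qed
  then show ?thesis
    by (intro computable_funI[where r = "RPrim rf rg"]) (auto simp: length_Suc_conv)
qed

lemma computable_fun_add:
  assumes "computable_fun k f" "computable_fun k g"
  shows "computable_fun k (\<lambda>xs. f xs + g xs)"
proof (rule computable_fun_compose2[OF _ assms])
  show "computable_fun 2 (\<lambda>xs. xs ! 0 + xs ! 1)"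
    unfolding numeral_2_eq_2
    by (rule computable_fun_prim[where f = "\<lambda>xs. xs ! 0" and g = "\<lambda>xs. Suc (xs ! 1)"])
      (auto intro!: computable_fun_Suc computable_fun_nth)
qed

lemma computable_fun_mult:
  assumes "computable_fun k f" "computable_fun k g"
  shows "computable_fun k (\<lambda>xs. f xs * g xs)"
proof (rule computable_fun_compose2[OF _ assms])
  show "computable_fun 2 (\<lambda>xs. xs ! 0 * xs ! 1)"
    unfolding numeral_2_eq_2
    by (rule computable_fun_prim[where f = "\<lambda>xs. 0" and g = "\<lambda>xs. xs ! 2 + xs ! 1"])
      (auto intro!: computable_fun_add computable_fun_nth computable_fun_const)
qed

lemma computable_fun_power: "computable_fun 1 (\<lambda>xs. c ^ (xs ! 0))"
  unfolding One_nat_def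
  by (rule computable_fun_prim[where f = "\<lambda>xs. 1" and g = "\<lambda>xs. c * xs ! 1"])
    (auto intro!: computable_fun_mult computable_fun_nth computable_fun_const)

section \<open>Codes of words and systems as computable functions\<close>

lemma computable_fun_prod_encode:
  assumes "computable_fun k f" "computable_fun k g"
  shows "computable_fun k (\<lambda>xs. prod_encode (f xs, g xs))"
proof -
  have "computable_fun 1 (\<lambda>xs. triangle (xs ! 0))"
    unfolding One_nat_def
  proof (rule computable_fun_prim[where f = "\<lambda>xs. 0" and g = "\<lambda>xs. xs ! 1 + Suc (xs ! 0)"])
    show "computable_fun (Suc (Suc 0)) (\<lambda>xs. xs ! 1 + Suc (xs ! 0))"
      by (intro computable_fun_add computable_fun_Suc computable_fun_nth; simp)
  qed (simp_all add: computable_fun_const)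
  then have "computable_fun k (\<lambda>xs. triangle (f xs + g xs))"
    by (rule computable_fun_compose1) (intro computable_fun_add assms)
  then show ?thesis
    by (simp add: prod_encode_def computable_fun_add assms)
qed

text \<open>Prepending one code is an arithmetic step, so prepending a block is primitive recursion
  on its length.\<close>

lemma computable_fun_list_encode_replicate:
  assumes "computable_fun k f" and "computable_fun k (\<lambda>xs. list_encode (ys xs))"
  shows "computable_fun k (\<lambda>xs. list_encode (replicate (f xs) c @ ys xs))"
proof -
  define F where "F n e = ((\<lambda>y. Suc (prod_encode (c, y))) ^^ n) e" for n e
  have F: "list_encode (replicate n c @ zs) = F n (list_encode zs)" for n zs
    by (induction n) (simp_all add: F_def)
  have "computable_fun 2 (\<lambda>xs. F (xs ! 0) (xs ! 1))"
    unfolding numeral_2_eq_2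
    by (rule computable_fun_prim[where f = "\<lambda>xs. xs ! 0"
          and g = "\<lambda>xs. Suc (prod_encode (c, xs ! 1))"])
      (auto simp: F_def intro!: computable_fun_Suc computable_fun_nth computable_fun_const
        computable_fun_prod_encode)
  from computable_fun_compose2[where f = F, OF this assms] show ?thesis by (simp only: F)
qed

text \<open>This is the shape that the final reduction produces: two block lengths in the first word
  vary and all other equations stay fixed.\<close>

lemma computable_fun_system_code:
  "computable_fun 2 (\<lambda>xs. system_code ((replicate (xs ! 0) l @ replicate (xs ! 1) l' @ w) # S))"
proof -
  have "computable_fun 2 (\<lambda>xs. list_encode (replicate (xs ! 0) (letter_code l) @
      replicate (xs ! 1) (letter_code l') @ map letter_code w))"
    by (intro computable_fun_list_encode_replicate computable_fun_const) (simp_all add: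
        computable_fun_nth)
  then have "computable_fun 2 (\<lambda>xs. Suc (prod_encode (list_encode (replicate (xs ! 0) (letter_code
      l) @
      replicate (xs ! 1) (letter_code l') @ map letter_code w), system_code S)))"
    by (intro computable_fun_Suc computable_fun_prod_encode computable_fun_const)
  then show ?thesis by (simp add: system_code_def)
qed

section \<open>Decimal digits from comparisons with rationals\<close>

lemma least_search:
  assumes q: "computable_fun (Suc k) q"
    and below: "\<And>xs m. length xs = k \<Longrightarrow> m < F xs \<Longrightarrow> q (m # xs) > 0"
    and at: "\<And>xs. length xs = k \<Longrightarrow> q (F xs # xs) = 0"
  shows "computable_fun k F"
proof -
  obtain r where r: "\<And>xs. length xs = Suc k \<Longrightarrow> rec_eval r xs (q xs)"
    using q unfolding computable_fun_def by blast
  show ?thesis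
  proof (rule computable_funI[where r = "RMin r"], rule rec_eval.min)
    fix xs :: "nat list" assume xs: "length xs = k"
    show "rec_eval r (F xs # xs) 0" using r[of "F xs # xs"] at xs by simp
    show "\<forall>m<F xs. \<exists>y. rec_eval r (m # xs) (Suc y)"
      by (metis below gr0_conv_Suc length_Cons r xs)
  qed
qed

text \<open>The \<open>n\<close>-th digit is found by searching for the largest \<open>m\<close> below \<open>10\<^sup>n \<bar>a\<bar>\<close>.\<close>

lemma computable_real_if_comparisons_computable:
  assumes "computable_fun 2 (\<lambda>xs. if real (xs ! 1) \<le> real (xs ! 0) * \<bar>a\<bar> then 1 else 0)"
  shows "computable_real a"
proof -
  define q where "q N m = (if real m \<le> real N * \<bar>a\<bar> then 1 else 0 :: nat)" for N m
  define F where "F N = nat \<lfloor>real N * \<bar>a\<bar>\<rfloor>" for N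
  note intros = computable_fun_nth computable_fun_const computable_fun_Suc computable_fun_add
    computable_fun_mult
  have q: "computable_fun 2 (\<lambda>xs. q (xs ! 0) (xs ! 1))"
    using assms by (simp add: q_def)
  have q_iff: "q N m > 0 \<longleftrightarrow> m \<le> F N" for N m
    by (simp add: q_def F_def le_nat_floor le_nat_iff le_floor_iff)
  have q_zero: "q N m = 0 \<longleftrightarrow> F N < m" for N m
    using q_iff[of N m] by auto
  \<comment> \<open>The largest \<open>m\<close> that passes the test is the least \<open>m\<close>
    whose successor fails it, hence the \<open>Suc\<close>.\<close>
  have F: "computable_fun 1 (\<lambda>xs. F (xs ! 0))"
    by (rule least_search[where q = "\<lambda>xs. q (xs ! 1) (Suc (xs ! 0))"],
        rule computable_fun_compose2[where f = q, OF q]) (auto intro!: intros simp: q_iff q_zero)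
  have F10: "computable_fun k (\<lambda>xs. F (10 ^ f xs))" if "computable_fun k f" for k f
    by (rule computable_fun_compose1[where f = F, OF F
          computable_fun_compose1[where f = "\<lambda>n. 10 ^ n", OF computable_fun_power that]])
  have power_Suc: "computable_fun 1 (\<lambda>xs. 10 ^ Suc (xs ! 0))"
    by (rule computable_fun_compose1[where f = "\<lambda>n. 10 ^ n", OF computable_fun_power])
      (intro intros; simp)
  have digit: "F (10 ^ Suc n) = 10 * F (10 ^ n) + F (10 ^ Suc n) mod 10" for n
  proof -
    have "\<lfloor>real (10 ^ Suc n) * \<bar>a\<bar>\<rfloor> div 10 = \<lfloor>real (10 ^ Suc n) * \<bar>a\<bar> / real 10\<rfloor>"
      using floor_divide_real_eq_div[of 10 "real (10 ^ Suc n) * \<bar>a\<bar>"] by simp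
    then have "F (10 ^ Suc n) div 10 = F (10 ^ n)"
      by (simp add: F_def nat_div_distrib flip: nat_div_distrib)
    then show ?thesis by (metis mult_div_mod_eq)
  qed
  have dec0: "decimal_expansion a 0 = F (10 ^ 0)" by (simp add: decimal_expansion_def F_def)
  have dec: "decimal_expansion a (Suc n) = F (10 ^ Suc n) mod 10" for n
    by (simp add: decimal_expansion_def F_def nat_mod_distrib mult.commute)
  \<comment> \<open>The next digit is the least \<open>d\<close> with \<open>F (10 ^ Suc n)\<close>
    \<le> \<open>10 * F (10 ^ n) + d\<close>, again found through a failing successor. The second
    argument is the previous value that primitive recursion passes on.\<close>
  have step: "computable_fun 2 (\<lambda>xs. decimal_expansion a (Suc (xs ! 0)))"
  proof (rule least_search[where q = "\<lambda>xs. q (10 ^ Suc (xs ! 1)) (Suc (10 * F (10 ^ (xs ! 1)) + xs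
      ! 0))"])
    show "computable_fun (Suc 2)
        (\<lambda>xs. q (10 ^ Suc (xs ! 1)) (Suc (10 * F (10 ^ (xs ! 1)) + xs ! 0)))"
      by (intro computable_fun_compose2[where f = q, OF q]
          computable_fun_compose1[where f = "\<lambda>n. 10 ^ Suc n", OF power_Suc] intros F10; simp)
  next
    fix xs :: "nat list" and m
    assume "m < decimal_expansion a (Suc (xs ! 0))"
    then show "0 < q (10 ^ Suc ((m # xs) ! 1))
        (Suc (10 * F (10 ^ ((m # xs) ! 1)) + (m # xs) ! 0))"
      using digit[of "xs ! 0"] unfolding q_iff dec by simp
  next
    fix xs :: "nat list"
    show "q (10 ^ Suc ((decimal_expansion a (Suc (xs ! 0)) # xs) ! 1))
        (Suc (10 * F (10 ^ ((decimal_expansion a (Suc (xs ! 0)) # xs) ! 1)) +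
         (decimal_expansion a (Suc (xs ! 0)) # xs) ! 0)) = 0"
      using digit[of "xs ! 0"] unfolding q_zero dec by simp
  qed
  have "computable_fun 1 (\<lambda>xs. decimal_expansion a (xs ! 0))"
    unfolding One_nat_def
    by (rule computable_fun_prim[where f = "\<lambda>xs. F (10 ^ 0)"
          and g = "\<lambda>xs. decimal_expansion a (Suc (xs ! 0))"])
      (use step[unfolded numeral_2_eq_2] in \<open>auto intro!: intros simp: dec0 simp del: power_0\<close>)
  then show ?thesis
    unfolding computable_real_def computable_seq_def computable_fun_def
    by (metis One_nat_def length_Cons list.size(3) nth_Cons_0)
qed

section \<open>Diophantine relations in a group\<close>

fun inv_letter :: "letter \<Rightarrow> letter" where
  "inv_letter (Var i) = VarInv i"
| "inv_letter (VarInv i) = Var i"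
| "inv_letter (Coeff i) = CoeffInv i"
| "inv_letter (CoeffInv i) = Coeff i"

definition inv_word :: "eqn_word \<Rightarrow> eqn_word" where
  "inv_word w = rev (map inv_letter w)"

fun subst_letter :: "(nat \<Rightarrow> eqn_word) \<Rightarrow> letter \<Rightarrow> eqn_word" where
  "subst_letter \<theta> (Var i) = \<theta> i"
| "subst_letter \<theta> (VarInv i) = inv_word (\<theta> i)"
| "subst_letter \<theta> (Coeff i) = [Coeff i]"
| "subst_letter \<theta> (CoeffInv i) = [CoeffInv i]"

definition subst_word :: "(nat \<Rightarrow> eqn_word) \<Rightarrow> eqn_word \<Rightarrow> eqn_word" where
  "subst_word \<theta> w = concat (map (subst_letter \<theta>) w)"

abbreviation word_wf :: "nat \<Rightarrow> eqn_word \<Rightarrow> bool" where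
  "word_wf k w \<equiv> \<forall>l\<in>set w. letter_wf k l"

lemma letter_wf_inv_letter [simp]: "letter_wf k (inv_letter l) \<longleftrightarrow> letter_wf k l"
  by (cases l) auto

lemma word_wf_inv_word [simp]: "word_wf k (inv_word w) \<longleftrightarrow> word_wf k w"
  by (simp add: inv_word_def)

lemma word_wf_subst_word:
  assumes "word_wf k w" "\<And>i. word_wf k (\<theta> i)"
  shows "word_wf k (subst_word \<theta> w)"
proof -
  have "word_wf k (subst_letter \<theta> l)" if "letter_wf k l" for l
    using that assms(2) by (cases l) auto
  with assms(1) show ?thesis by (auto simp: subst_word_def)
qed

locale group_with_coefficients = group G for G (structure) +
  fixes cs :: "'a list"
  assumes cs_carrier: "set cs \<subseteq> carrier G"
begin

abbreviation wf_word :: "eqn_word \<Rightarrow> bool" where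
  "wf_word \<equiv> word_wf (length cs)"

abbreviation env :: "(nat \<Rightarrow> 'a) \<Rightarrow> bool" where
  "env \<sigma> \<equiv> \<forall>i. \<sigma> i \<in> carrier G"

lemma nth_coeff_closed [simp, intro]: "i < length cs \<Longrightarrow> cs ! i \<in> carrier G"
  using cs_carrier nth_mem by blast

lemma letter_val_closed:
  "env \<sigma> \<Longrightarrow> letter_wf (length cs) l \<Longrightarrow> letter_val G cs \<sigma> l \<in> carrier G"
  by (cases l) auto

lemma word_val_Nil [simp]: "word_val G cs \<sigma> [] = \<one>"
  by (simp add: word_val_def)

lemma word_val_Cons [simp]: "word_val G cs \<sigma> (l # w) = letter_val G cs \<sigma> l \<otimes> word_val G cs \<sigma> w"
  by (simp add: word_val_def)

lemma word_val_closed: "env \<sigma> \<Longrightarrow> wf_word w \<Longrightarrow> word_val G cs \<sigma> w \<in> carrier G"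
  by (induction w) (auto intro: letter_val_closed)

lemma word_val_append:
  "env \<sigma> \<Longrightarrow> wf_word v \<Longrightarrow> wf_word w \<Longrightarrow>
    word_val G cs \<sigma> (v @ w) = word_val G cs \<sigma> v \<otimes> word_val G cs \<sigma> w"
  by (induction v) (auto simp: m_assoc letter_val_closed word_val_closed)

lemma word_val_inv_word:
  assumes "env \<sigma>" "wf_word w"
  shows "word_val G cs \<sigma> (inv_word w) = inv (word_val G cs \<sigma> w)"
  using assms(2)
proof (induction w)
  case (Cons l w)
  have l: "letter_val G cs \<sigma> (inv_letter l) = inv (letter_val G cs \<sigma> l)"
    using assms(1) cs_carrier Cons.prems by (cases l) auto
  have "word_val G cs \<sigma> (inv_word w @ [inv_letter l]) =
      word_val G cs \<sigma> (inv_word w) \<otimes> word_val G cs \<sigma> [inv_letter l]"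
    using Cons.prems by (intro word_val_append assms(1)) (auto simp: inv_word_def)
  then show ?case
    using Cons l assms(1) letter_val_closed[OF assms(1), of l] word_val_closed[OF assms(1), of w]
    by (simp add: inv_word_def inv_mult_group)
qed (simp add: inv_word_def)

lemma word_val_subst_word:
  assumes "env \<sigma>" "\<And>i. wf_word (\<theta> i)" "wf_word w"
  shows "word_val G cs \<sigma> (subst_word \<theta> w) = word_val G cs (\<lambda>i. word_val G cs \<sigma> (\<theta> i)) w"
  using assms(3)
proof (induction w)
  case (Cons l w)
  have l: "wf_word (subst_letter \<theta> l)"
    using Cons.prems assms(2) by (cases l) auto
  have "word_val G cs \<sigma> (subst_letter \<theta> l) = letter_val G cs (\<lambda>i. word_val G cs \<sigma> (\<theta> i)) l"
    using assms Cons.prems cs_carrier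
    by (cases l) (auto simp: word_val_inv_word)
  moreover have "wf_word (concat (map (subst_letter \<theta>) w))"
    using word_wf_subst_word[where w = w and k = "length cs" and \<theta> = \<theta>] assms(2) Cons.prems by
        (simp add: subst_word_def)
  ultimately show ?case
    using Cons l assms(1) by (simp add: subst_word_def word_val_append)
qed (simp add: subst_word_def)

definition solves :: "(nat \<Rightarrow> 'a) \<Rightarrow> eqn_system \<Rightarrow> bool" where
  "solves \<sigma> S \<longleftrightarrow> (\<forall>w\<in>set S. word_val G cs \<sigma> w = \<one>)"

lemma solves_subst_word:
  assumes "env \<sigma>" "\<And>i. wf_word (\<theta> i)" "system_wf (length cs) S"
  shows "solves \<sigma> (map (subst_word \<theta>) S) \<longleftrightarrow> solves (\<lambda>i. word_val G cs \<sigma> (\<theta> i)) S"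
  using assms by (auto simp: solves_def system_wf_def word_val_subst_word)

lemma system_wf_subst_word:
  assumes "system_wf (length cs) S" "\<And>i. wf_word (\<theta> i)"
  shows "system_wf (length cs) (map (subst_word \<theta>) S)"
  unfolding system_wf_def set_map ball_simps
proof
  fix w assume "w \<in> set S"
  then show "wf_word (subst_word \<theta> w)"
    using assms by (intro word_wf_subst_word) (auto simp: system_wf_def)
qed

text \<open>Even variables are the arguments of a relation, odd variables are existentially quantified.\<close>

definition interleave :: "(nat \<Rightarrow> 'a) \<Rightarrow> (nat \<Rightarrow> 'a) \<Rightarrow> nat \<Rightarrow> 'a" where
  "interleave \<sigma> \<tau> n = (if even n then \<sigma> (n div 2) else \<tau> (n div 2))"

lemma interleave_simps [simp]:
  "interleave \<sigma> \<tau> (2 * i) = \<sigma> i" "interleave \<sigma> \<tau> (Suc (2 * i)) = \<tau> i"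
  by (simp_all add: interleave_def)

lemma interleave_in_carrier: "env \<sigma> \<Longrightarrow> env \<tau> \<Longrightarrow> env (interleave \<sigma> \<tau>)"
  by (simp add: interleave_def)

lemma interleave_eqI:
  "(\<And>i. \<upsilon> (2 * i) = \<sigma> i) \<Longrightarrow> (\<And>i. \<upsilon> (Suc (2 * i)) = \<tau> i) \<Longrightarrow> \<upsilon> = interleave \<sigma> \<tau>"
  unfolding interleave_def fun_eq_iff by (metis odd_two_times_div_two_succ even_two_times_div_two
      Suc_eq_plus1)

text \<open>Relations are predicates on whole assignments, so no arity has to be tracked; a system
  mentions only finitely many of the arguments and witnesses.\<close>

definition represents :: "eqn_system \<Rightarrow> ((nat \<Rightarrow> 'a) \<Rightarrow> bool) \<Rightarrow> bool" where
  "represents S P \<longleftrightarrow> system_wf (length cs) S \<and>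
    (\<forall>\<sigma>. env \<sigma> \<longrightarrow> P \<sigma> \<longleftrightarrow> (\<exists>\<tau>. env \<tau> \<and> solves (interleave \<sigma> \<tau>) S))"

lemma represents_iff:
  "represents S P \<Longrightarrow> env \<sigma> \<Longrightarrow> P \<sigma> \<longleftrightarrow> (\<exists>\<tau>. env \<tau> \<and> solves (interleave \<sigma> \<tau>) S)"
  unfolding represents_def by blast

definition diophantine :: "((nat \<Rightarrow> 'a) \<Rightarrow> bool) \<Rightarrow> bool" where
  "diophantine P \<longleftrightarrow> (\<exists>S. represents S P)"

definition argument_word :: "eqn_word \<Rightarrow> eqn_word" where
  "argument_word = subst_word (\<lambda>i. [Var (2 * i)])"

lemma wf_argument_word: "wf_word w \<Longrightarrow> wf_word (argument_word w)"
  unfolding argument_word_def by (rule word_wf_subst_word) simp_all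

lemma word_val_argument_word:
  assumes "env \<sigma>" "env \<tau>" "wf_word w"
  shows "word_val G cs (interleave \<sigma> \<tau>) (argument_word w) = word_val G cs \<sigma> w"
  unfolding argument_word_def using assms interleave_in_carrier[OF assms(1,2)]
  by (simp add: word_val_subst_word)

section \<open>Terms and closure properties of Diophantine relations\<close>

definition group_term :: "((nat \<Rightarrow> 'a) \<Rightarrow> 'a) \<Rightarrow> bool" where
  "group_term T \<longleftrightarrow> (\<exists>w. wf_word w \<and> (\<forall>\<sigma>. env \<sigma> \<longrightarrow> T \<sigma> = word_val G cs \<sigma> w))"

lemma group_term_closed: "group_term T \<Longrightarrow> env \<sigma> \<Longrightarrow> T \<sigma> \<in> carrier G"
  unfolding group_term_def using word_val_closed by auto

lemma group_term_var: "group_term (\<lambda>\<sigma>. \<sigma> i)"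
  unfolding group_term_def by (rule exI[of _ "[Var i]"]) auto

lemma group_term_coeff:
  assumes "c \<in> set cs" shows "group_term (\<lambda>\<sigma>. c)"
proof -
  obtain i where "i < length cs" "cs ! i = c" using assms by (auto simp: in_set_conv_nth)
  then show ?thesis
    unfolding group_term_def using cs_carrier assms by (intro exI[of _ "[Coeff i]"]) auto
qed

lemma group_term_one: "group_term (\<lambda>\<sigma>. \<one>)"
  unfolding group_term_def by (rule exI[of _ "[]"]) auto

lemma group_term_mult:
  assumes "group_term T" "group_term U" shows "group_term (\<lambda>\<sigma>. T \<sigma> \<otimes> U \<sigma>)"
proof -
  obtain v w where "wf_word v" "\<forall>\<sigma>. env \<sigma> \<longrightarrow> T \<sigma> = word_val G cs \<sigma> v"
    "wf_word w" "\<forall>\<sigma>. env \<sigma> \<longrightarrow> U \<sigma> = word_val G cs \<sigma> w"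
    using assms unfolding group_term_def by blast
  then show ?thesis
    unfolding group_term_def by (intro exI[of _ "v @ w"]) (auto simp: word_val_append)
qed

lemma group_term_inv:
  assumes "group_term T" shows "group_term (\<lambda>\<sigma>. inv (T \<sigma>))"
proof -
  obtain v where "wf_word v" "\<forall>\<sigma>. env \<sigma> \<longrightarrow> T \<sigma> = word_val G cs \<sigma> v"
    using assms unfolding group_term_def by blast
  then show ?thesis
    unfolding group_term_def by (intro exI[of _ "inv_word v"]) (auto simp: word_val_inv_word)
qed

lemma group_term_pow: "group_term T \<Longrightarrow> group_term (\<lambda>\<sigma>. T \<sigma> [^] (n::nat))"
  by (induction n) (auto intro: group_term_one group_term_mult)

lemma diophantine_cong:
  assumes "diophantine P" "\<And>\<sigma>. env \<sigma> \<Longrightarrow> P \<sigma> \<longleftrightarrow> Q \<sigma>"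
  shows "diophantine Q"
  using assms unfolding diophantine_def represents_def by (metis (no_types, lifting))

lemma diophantine_eq:
  assumes "group_term T" "group_term U"
  shows "diophantine (\<lambda>\<sigma>. T \<sigma> = U \<sigma>)"
proof -
  obtain w where w: "wf_word w" "\<And>\<sigma>. env \<sigma> \<Longrightarrow> T \<sigma> \<otimes> inv (U \<sigma>) = word_val G cs \<sigma> w"
    using group_term_mult[OF assms(1) group_term_inv[OF assms(2)]] unfolding group_term_def by blast
  have "T \<sigma> = U \<sigma> \<longleftrightarrow> (\<exists>\<tau>. env \<tau> \<and> solves (interleave \<sigma> \<tau>) [argument_word w])" if \<sigma>: "env \<sigma>" for \<sigma>
  proof -
    have "T \<sigma> = U \<sigma> \<longleftrightarrow> word_val G cs \<sigma> w = \<one>"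
      using assms[THEN group_term_closed, OF \<sigma>] w(2)[OF \<sigma>]
      by (metis inv_closed inv_equality inv_inv r_inv)
    moreover have "solves (interleave \<sigma> \<tau>) [argument_word w] \<longleftrightarrow> word_val G cs \<sigma> w = \<one>" if "env \<tau>" for \<tau>
      by (simp add: solves_def word_val_argument_word \<sigma> that w(1))
    ultimately show ?thesis using \<sigma> by blast
  qed
  then show ?thesis
    unfolding diophantine_def represents_def using wf_argument_word[OF w(1)]
    by (intro exI[of _ "[argument_word w]"]) (auto simp: system_wf_def)
qed

lemma diophantine_conj:
  assumes "diophantine P" "diophantine Q"
  shows "diophantine (\<lambda>\<sigma>. P \<sigma> \<and> Q \<sigma>)"
proof -
  obtain S U where S: "represents S P" and U: "represents U Q"
    using assms unfolding diophantine_def by blast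
  \<comment> \<open>The arguments are shared and the witnesses must be kept apart: witness
    \<open>2i+1\<close> of the first system moves to \<open>4i+1\<close>, that of the second to
    \<open>4i+3\<close>.\<close>
  define \<theta> where "\<theta> n = [Var (if even n then n else 2 * n - 1)]" for n
  define \<eta> where "\<eta> n = [Var (if even n then n else 2 * n + 1)]" for n
  let ?V = "map (subst_word \<theta>) S @ map (subst_word \<eta>) U"
  have wf: "wf_word (\<theta> i)" "wf_word (\<eta> i)" for i by (auto simp: \<theta>_def \<eta>_def)
  have sys: "system_wf (length cs) S" "system_wf (length cs) U"
    using S U by (auto simp: represents_def)
  have solves_V: "solves (interleave \<sigma> (interleave \<tau> \<rho>)) ?V \<longleftrightarrow>
      solves (interleave \<sigma> \<tau>) S \<and> solves (interleave \<sigma> \<rho>) U" if "env \<sigma>" "env \<tau>" "env \<rho>" for \<sigma> \<tau> \<rho>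
  proof -
    let ?\<upsilon> = "interleave \<sigma> (interleave \<tau> \<rho>)"
    have \<upsilon>: "env ?\<upsilon>" using that interleave_in_carrier by blast
    have "?\<upsilon> (Suc (4 * i)) = \<tau> i" "?\<upsilon> (Suc (Suc (Suc (4 * i)))) = \<rho> i" for i
      using interleave_simps(2)[of \<sigma> "interleave \<tau> \<rho>" "2 * i"]
        interleave_simps(2)[of \<sigma> "interleave \<tau> \<rho>" "Suc (2 * i)"] by simp_all
    then have "(\<lambda>n. word_val G cs ?\<upsilon> (\<theta> n)) = interleave \<sigma> \<tau>" "(\<lambda>n. word_val G cs ?\<upsilon> (\<eta> n)) =
        interleave \<sigma> \<rho>"
      using that by (auto simp: \<theta>_def \<eta>_def intro!: interleave_eqI)
    then show ?thesis
      using solves_subst_word[where \<theta> = \<theta>, OF \<upsilon> wf(1) sys(1)] solves_subst_word[where \<theta> = \<eta>, OF \<upsilon>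
          wf(2) sys(2)]
      by (simp add: solves_def ball_Un)
  qed
  have "P \<sigma> \<and> Q \<sigma> \<longleftrightarrow> (\<exists>\<tau>. env \<tau> \<and> solves (interleave \<sigma> \<tau>) ?V)" (is "?L \<longleftrightarrow> ?R") if \<sigma>: "env \<sigma>" for \<sigma>
  proof
    assume ?L
    then show ?R
      using represents_iff[OF S \<sigma>] represents_iff[OF U \<sigma>] solves_V[OF \<sigma>] interleave_in_carrier by
          meson
  next
    assume ?R
    then obtain \<upsilon> where \<upsilon>: "env \<upsilon>" "solves (interleave \<sigma> \<upsilon>) ?V" by blast
    define \<tau> \<rho> where "\<tau> i = \<upsilon> (2 * i)" and "\<rho> i = \<upsilon> (Suc (2 * i))" for i
    have *: "env \<tau>" "env \<rho>" "\<upsilon> = interleave \<tau> \<rho>"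
      using \<upsilon>(1) by (auto simp: \<tau>_def \<rho>_def intro: interleave_eqI)
    then have "solves (interleave \<sigma> \<tau>) S" "solves (interleave \<sigma> \<rho>) U"
      using solves_V[OF \<sigma>] \<upsilon>(2) by blast+
    with * show ?L
      unfolding represents_iff[OF S \<sigma>] represents_iff[OF U \<sigma>] by blast
  qed
  moreover have "system_wf (length cs) ?V"
    using system_wf_subst_word[OF sys(1) wf(1)] system_wf_subst_word[OF sys(2) wf(2)]
    by (auto simp: system_wf_def)
  ultimately show ?thesis unfolding diophantine_def represents_def by blast
qed

lemma diophantine_True: "diophantine (\<lambda>\<sigma>. True)"
  using diophantine_eq[OF group_term_one group_term_one] by simp

lemma diophantine_ball:
  assumes "finite A" "\<And>a. a \<in> A \<Longrightarrow> diophantine (P a)"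
  shows "diophantine (\<lambda>\<sigma>. \<forall>a\<in>A. P a \<sigma>)"
  using assms
proof (induction A rule: finite_induct)
  case empty
  then show ?case using diophantine_True by simp
next
  case (insert a A)
  then show ?case using diophantine_conj[of "P a" "\<lambda>\<sigma>. \<forall>a\<in>A. P a \<sigma>"] by simp
qed

lemma diophantine_ex:
  assumes "diophantine (\<lambda>\<sigma>. R (\<sigma> 0) (\<lambda>i. \<sigma> (Suc i)))"
  shows "diophantine (\<lambda>\<sigma>. \<exists>b\<in>carrier G. R b \<sigma>)"
proof -
  obtain S where S: "represents S (\<lambda>\<sigma>. R (\<sigma> 0) (\<lambda>i. \<sigma> (Suc i)))"
    using assms unfolding diophantine_def by blast
  \<comment> \<open>The bound argument 0 becomes the first witness, variable 1. The other arguments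
    move down by one place and the old witnesses up by one place to make room.\<close>
  define \<theta> where "\<theta> n = [Var (if n = 0 then 1 else if even n then n - 2 else n + 2)]" for n
  have wf: "wf_word (\<theta> i)" for i by (simp add: \<theta>_def)
  have sys: "system_wf (length cs) S" using S by (simp add: represents_def)
  have solves: "solves (interleave \<sigma> (case_nat b \<tau>)) (map (subst_word \<theta>) S) \<longleftrightarrow>
      solves (interleave (case_nat b \<sigma>) \<tau>) S" if "env \<sigma>" "env \<tau>" "b \<in> carrier G" for \<sigma> \<tau> b
  proof -
    have \<upsilon>: "env (interleave \<sigma> (case_nat b \<tau>))"
      using that by (intro interleave_in_carrier) (simp_all split: nat.split)
    have "(\<lambda>n. word_val G cs (interleave \<sigma> (case_nat b \<tau>)) (\<theta> n)) = interleave (case_nat b \<sigma>) \<tau>"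
      using that interleave_simps(2)[of \<sigma> "case_nat b \<tau>" 0] interleave_simps(2)[of \<sigma> "case_nat b
          \<tau>" "Suc _"]
      by (intro interleave_eqI) (auto simp: \<theta>_def right_diff_distrib' split: nat.split)
    then show ?thesis using solves_subst_word[where \<theta> = \<theta>, OF \<upsilon> wf sys] by simp
  qed
  have "(\<exists>b\<in>carrier G. R b \<sigma>) \<longleftrightarrow> (\<exists>\<tau>. env \<tau> \<and> solves (interleave \<sigma> \<tau>) (map (subst_word \<theta>) S))"
    (is "?L \<longleftrightarrow> ?R") if \<sigma>: "env \<sigma>" for \<sigma>
  proof -
    have R_iff: "R b \<sigma> \<longleftrightarrow> (\<exists>\<tau>. env \<tau> \<and> solves (interleave (case_nat b \<sigma>) \<tau>) S)" if "b \<in> carrier G"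
        for b
      using represents_iff[OF S, of "case_nat b \<sigma>"] \<sigma> that by (simp split: nat.split)
    show ?thesis
    proof
      assume ?L
      then obtain b \<tau> where b: "b \<in> carrier G" and \<tau>: "env \<tau>" "solves (interleave (case_nat b \<sigma>) \<tau>) S"
        using R_iff by blast
      moreover have "env (case_nat b \<tau>)" using b \<tau> by (simp split: nat.split)
      ultimately show ?R using solves[OF \<sigma> \<tau>(1) b] by blast
    next
      assume ?R
      then obtain \<tau> where \<tau>: "env \<tau>" "solves (interleave \<sigma> \<tau>) (map (subst_word \<theta>) S)" by blast
      define \<rho> where "\<rho> i = \<tau> (Suc i)" for i
      have *: "env \<rho>" "\<tau> 0 \<in> carrier G" "\<tau> = case_nat (\<tau> 0) \<rho>"
        using \<tau>(1) by (simp_all add: \<rho>_def fun_eq_iff split: nat.split)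
      then have "solves (interleave (case_nat (\<tau> 0) \<sigma>) \<rho>) S"
        using solves[OF \<sigma>, of \<rho> "\<tau> 0"] \<tau>(2) by simp
      then show ?L using R_iff[of "\<tau> 0"] * by blast
    qed
  qed
  then show ?thesis
    unfolding diophantine_def represents_def
    by (intro exI[of _ "map (subst_word \<theta>) S"] conjI system_wf_subst_word[OF sys wf] allI impI)
qed

lemma diophantine_subst:
  assumes "diophantine P" "\<And>i. group_term (T i)"
  shows "diophantine (\<lambda>\<sigma>. P (\<lambda>i. T i \<sigma>))"
proof -
  obtain S where S: "represents S P"
    using assms(1) unfolding diophantine_def by blast
  obtain w where w: "\<And>i. wf_word (w i)" "\<And>i \<sigma>. env \<sigma> \<Longrightarrow> T i \<sigma> = word_val G cs \<sigma> (w i)"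
    using assms(2) unfolding group_term_def by metis
  define \<theta> where "\<theta> n = (if even n then argument_word (w (n div 2)) else [Var n])" for n
  have wf: "wf_word (\<theta> n)" for n using wf_argument_word[OF w(1)] by (simp add: \<theta>_def)
  have sys: "system_wf (length cs) S" using S by (simp add: represents_def)
  have "P (\<lambda>i. T i \<sigma>) \<longleftrightarrow> (\<exists>\<tau>. env \<tau> \<and> solves (interleave \<sigma> \<tau>) (map (subst_word \<theta>) S))"
    if \<sigma>: "env \<sigma>" for \<sigma>
  proof -
    have "solves (interleave \<sigma> \<tau>) (map (subst_word \<theta>) S) \<longleftrightarrow> solves (interleave (\<lambda>i. T i \<sigma>) \<tau>) S"
      if \<tau>: "env \<tau>" for \<tau>
    proof -
      have "(\<lambda>n. word_val G cs (interleave \<sigma> \<tau>) (\<theta> n)) = interleave (\<lambda>i. T i \<sigma>) \<tau>"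
        using \<sigma> \<tau> w by (intro interleave_eqI) (simp_all add: \<theta>_def word_val_argument_word)
      then show ?thesis
        using solves_subst_word[where \<theta> = \<theta>, OF interleave_in_carrier[OF \<sigma> \<tau>] wf sys] by simp
    qed
    moreover have "env (\<lambda>i. T i \<sigma>)" using group_term_closed[OF assms(2) \<sigma>] by blast
    ultimately show ?thesis using represents_iff[OF S, of "\<lambda>i. T i \<sigma>"] by blast
  qed
  then show ?thesis
    unfolding diophantine_def represents_def
    by (intro exI[of _ "map (subst_word \<theta>) S"] conjI system_wf_subst_word[OF sys wf] allI impI)
qed

lemma diophantine_subst1:
  "diophantine (\<lambda>\<sigma>. P (\<sigma> 0)) \<Longrightarrow> group_term T \<Longrightarrow> diophantine (\<lambda>\<sigma>. P (T \<sigma>))"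
  using diophantine_subst[of "\<lambda>\<sigma>. P (\<sigma> 0)" "\<lambda>i. T"] by simp

lemma diophantine_subst2:
  "diophantine (\<lambda>\<sigma>. P (\<sigma> 0) (\<sigma> 1)) \<Longrightarrow> group_term T \<Longrightarrow> group_term U
    \<Longrightarrow> diophantine (\<lambda>\<sigma>. P (T \<sigma>) (U \<sigma>))"
  using diophantine_subst[of "\<lambda>\<sigma>. P (\<sigma> 0) (\<sigma> 1)" "\<lambda>i. if i = 0 then T else U"] by simp

lemma diophantine_subst3:
  "diophantine (\<lambda>\<sigma>. P (\<sigma> 0) (\<sigma> 1) (\<sigma> 2)) \<Longrightarrow> group_term T \<Longrightarrow> group_term U \<Longrightarrow> group_term V
    \<Longrightarrow> diophantine (\<lambda>\<sigma>. P (T \<sigma>) (U \<sigma>) (V \<sigma>))"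
  using diophantine_subst[of "\<lambda>\<sigma>. P (\<sigma> 0) (\<sigma> 1) (\<sigma> 2)"
      "\<lambda>i. if i = 0 then T else if i = 1 then U else V"] by simp

text \<open>One system \<open>S\<close> serves for all additional equations \<open>w\<close>. This
  uniformity is what makes the code of a family of systems a computable function of the varying
  word.\<close>

lemma diophantine_solvable:
  assumes "diophantine P"
  obtains S where "system_wf (length cs) S"
    "\<And>w. wf_word w \<Longrightarrow> system_solvable G cs (argument_word w # S) \<longleftrightarrow>
      (\<exists>\<sigma>. env \<sigma> \<and> P \<sigma> \<and> word_val G cs \<sigma> w = \<one>)"
proof -
  obtain S where S: "represents S P" using assms unfolding diophantine_def by blast
  show thesis
  proof (rule that)
    show "system_wf (length cs) S" using S by (simp add: represents_def)
    fix w assume w: "wf_word w"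
    show "system_solvable G cs (argument_word w # S) \<longleftrightarrow> (\<exists>\<sigma>. env \<sigma> \<and> P \<sigma> \<and> word_val G cs \<sigma> w = \<one>)"
      (is "?L \<longleftrightarrow> ?R")
    proof
      assume ?L
      then obtain \<upsilon> where \<upsilon>: "env \<upsilon>" "solves \<upsilon> S" "word_val G cs \<upsilon> (argument_word w) = \<one>"
        unfolding system_solvable_def solves_def by auto
      define \<sigma> \<tau> where "\<sigma> i = \<upsilon> (2 * i)" and "\<tau> i = \<upsilon> (Suc (2 * i))" for i
      have st: "env \<sigma>" "env \<tau>" "\<upsilon> = interleave \<sigma> \<tau>"
        using \<upsilon>(1) by (auto simp: \<sigma>_def \<tau>_def intro: interleave_eqI)
      then have "P \<sigma>" "word_val G cs \<sigma> w = \<one>"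
        using \<upsilon> represents_iff[OF S st(1)] word_val_argument_word[OF st(1,2) w] by auto
      with st(1) show ?R by blast
    next
      assume ?R
      then obtain \<sigma> \<tau> where *: "env \<sigma>" "env \<tau>" "word_val G cs \<sigma> w = \<one>" "solves (interleave \<sigma> \<tau>) S"
        using represents_iff[OF S] by blast
      then show ?L
        unfolding system_solvable_def
        using word_val_argument_word[OF *(1,2) w] interleave_in_carrier[OF *(1,2)]
        by (intro exI[of _ "interleave \<sigma> \<tau>"]) (auto simp: solves_def)
    qed
  qed
qed

end

section \<open>Exponentials in Banach algebras\<close>

text \<open>Moving \<open>x\<close> through \<open>y\<close> one factor at a time turns
  \<open>x ^ n\<close> into \<open>z ^ n\<close>, and the exponential series inherits this termwise.
  For invertible \<open>y\<close> this is conjugation; for an eigenvector \<open>y\<close> of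
  \<open>commutator x\<close>, \<open>z\<close> is \<open>x\<close> shifted by a scalar.\<close>

lemma exp_intertwine:
  fixes x y z :: "'a::{real_normed_algebra_1,banach}"
  assumes "x * y = y * z"
  shows "exp x * y = y * exp z"
proof -
  have pow: "x ^ n * y = y * z ^ n" for n
  proof (induction n)
    case (Suc n)
    have "x ^ Suc n * y = x * (x ^ n * y)" by (simp add: mult.assoc)
    also have "\<dots> = x * y * z ^ n" by (simp add: Suc mult.assoc)
    also have "\<dots> = y * z ^ Suc n" by (simp add: assms mult.assoc)
    finally show ?case .
  qed simp
  have "exp x * y = suminf (\<lambda>n. x ^ n /\<^sub>R fact n * y)"
    unfolding exp_def by (rule suminf_mult2[OF summable_exp_generic])
  also have "\<dots> = suminf (\<lambda>n. y * (z ^ n /\<^sub>R fact n))"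
    by (simp add: pow)
  also have "\<dots> = y * exp z"
    unfolding exp_def by (rule suminf_mult[OF summable_exp_generic])
  finally show ?thesis .
qed

lemma exp_conjugate:
  fixes x u v :: "'a::{real_normed_algebra_1,banach}"
  assumes "v * u = 1" "u * v = 1"
  shows "u * exp x * v = exp (u * x * v)"
proof -
  have "(u * x * v) * u = u * x" by (simp add: assms mult.assoc)
  then have "exp (u * x * v) * u = u * exp x" by (rule exp_intertwine)
  then have "u * exp x * v = exp (u * x * v) * u * v" by simp
  then show ?thesis by (simp add: assms(2) mult.assoc)
qed

section \<open>The adjoint action and its exponential\<close>

definition commutator :: "'a::ring \<Rightarrow> 'a \<Rightarrow> 'a" where
  "commutator x y = x * y - y * x"

lemma commutator_add_left: "commutator (x + y) z = commutator x z + commutator y z"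
  and commutator_add_right: "commutator x (y + z) = commutator x y + commutator x z"
  and commutator_minus_left: "commutator (- x) z = - commutator x z"
  and commutator_minus_right: "commutator x (- z) = - commutator x z"
  and commutator_swap: "commutator y x = - commutator x y"
  and commutator_self: "commutator x x = 0"
  by (simp_all add: commutator_def algebra_simps)

lemma commutator_scaleR:
  fixes x y :: "'a::real_algebra"
  shows "commutator (c *\<^sub>R x) y = c *\<^sub>R commutator x y"
    and "commutator x (c *\<^sub>R y) = c *\<^sub>R commutator x y"
  by (simp_all add: commutator_def scaleR_diff_right)

lemma commutator_conjugate:
  fixes u v x y :: "'a::ring_1"
  assumes "v * u = 1"
  shows "u * commutator x y * v = commutator (u * x * v) (u * y * v)"
proof -
  have "u * x * v * (u * y * v) = u * x * (v * u) * y * v"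
    "u * y * v * (u * x * v) = u * y * (v * u) * x * v"
    by (simp_all add: mult.assoc)
  then show ?thesis by (simp add: commutator_def assms algebra_simps)
qed

text \<open>The hypothesis reads \<open>x * y = y * (x + c)\<close>, and the central summand
  \<open>c\<close> splits off from the exponential as the factor \<open>exp c\<close>.\<close>

lemma exp_conjugate_eigenvector:
  fixes x y :: "'a::{real_normed_algebra_1,banach}"
  assumes "commutator x y = c *\<^sub>R y"
  shows "exp x * y * exp (- x) = exp c *\<^sub>R y"
proof -
  have "x * y = y * (x + of_real c)"
    using assms by (simp add: commutator_def algebra_simps of_real_def)
  then have "exp x * y = y * exp (x + of_real c)" by (rule exp_intertwine)
  also have "exp (x + of_real c) = exp c *\<^sub>R exp x"
    by (subst exp_add_commuting) (simp_all add: of_real_def exp_of_real[unfolded of_real_def])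
  finally show ?thesis
    by (simp add: mult.assoc exp_minus_inverse)
qed

text \<open>Conjugation by \<open>exp x\<close> is the exponential of \<open>ad x\<close>; the derivative of
  \<open>exp(-t x) (\<Sum>k. t\<^sup>k/k! ad(x)\<^sup>k y) exp(t x)\<close> telescopes to \<open>0\<close>.\<close>

lemma exp_conjugate_nilpotent:
  fixes x y :: "'a::{real_normed_algebra_1,banach}"
  assumes "(commutator x ^^ m) y = 0"
  shows "exp x * y * exp (- x) = (\<Sum>k<m. (commutator x ^^ k) y /\<^sub>R fact k)"
proof -
  define Y where "Y k = (commutator x ^^ k) y" for k
  have YS: "x * Y k - Y k * x = Y (Suc k)" for k by (simp add: Y_def commutator_def)
  define p where "p t = (\<Sum>k<m. (t ^ k / fact k) *\<^sub>R Y k)" for t :: real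
  define q where "q t = exp (t *\<^sub>R (- x)) * p t * exp (t *\<^sub>R x)" for t :: real
  have dp: "(p has_vector_derivative x * p t - p t * x) (at t within {0..1})" for t
  proof -
    have der: "((\<lambda>t. (t ^ k / fact k) *\<^sub>R Y k) has_vector_derivative
        (if k = 0 then 0 else t ^ (k - 1) / fact (k - 1)) *\<^sub>R Y k) (at t within {0..1})" for k
    proof (cases k)
      case (Suc j)
      have "((\<lambda>t. t ^ Suc j / fact (Suc j)) has_vector_derivative t ^ j / fact j) (at t within
          {0..1})"
        unfolding has_real_derivative_iff_has_vector_derivative[symmetric]
        by (rule derivative_eq_intros refl | simp)+
      then have "((\<lambda>t. (t ^ Suc j / fact (Suc j)) *\<^sub>R Y k) has_vector_derivative (t ^ j / fact j)
          *\<^sub>R Y k)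
          (at t within {0..1})"
        by (rule bounded_linear.has_vector_derivative[OF bounded_linear_scaleR_left])
      then show ?thesis by (simp add: Suc)
    qed auto
    have "(p has_vector_derivative (\<Sum>k<m. (if k = 0 then 0 else t ^ (k - 1) / fact (k - 1)) *\<^sub>R Y k))
        (at t within {0..1})"
      unfolding p_def by (intro has_vector_derivative_sum der)
    moreover have "(\<Sum>k<m. (if k = 0 then 0 else t ^ (k - 1) / fact (k - 1)) *\<^sub>R Y k) =
        (\<Sum>k<m. (t ^ k / fact k) *\<^sub>R Y (Suc k))"
    proof (cases m)
      case (Suc j)
      \<comment> \<open>This closes the telescoping: differentiation shifts the sum by one index,
        and the term that would be missing at the top vanishes.\<close>
      have "Y (Suc j) = 0" using assms by (simp add: Y_def Suc)
      then show ?thesis unfolding Suc by (subst sum.lessThan_Suc_shift) simp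
    qed simp
    moreover have "(\<Sum>k<m. (t ^ k / fact k) *\<^sub>R Y (Suc k)) = x * p t - p t * x"
      by (simp add: p_def sum_distrib_left sum_distrib_right YS[symmetric] scaleR_diff_right
          sum_subtractf)
    ultimately show ?thesis by simp
  qed
  have E: "((\<lambda>t. exp (t *\<^sub>R z)) has_vector_derivative z * exp (t *\<^sub>R z)) (at t within {0..1})" for t z
    by (rule has_vector_derivative_at_within[OF exp_scaleR_has_vector_derivative_left])
  have dq: "(q has_vector_derivative 0) (at t within {0..1})" for t
  proof -
    have comm: "x * exp (t *\<^sub>R - x) = exp (t *\<^sub>R - x) * x"
      using exp_times_scaleR_commute[of t "- x"] by simp
    have "(q has_vector_derivative exp (t *\<^sub>R - x) * p t * (x * exp (t *\<^sub>R x)) +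
        (exp (t *\<^sub>R - x) * (x * p t - p t * x) + - x * exp (t *\<^sub>R - x) * p t) * exp (t *\<^sub>R x))
        (at t within {0..1})"
      unfolding q_def by (intro has_vector_derivative_mult E dp)
    moreover have "exp (t *\<^sub>R - x) * p t * (x * exp (t *\<^sub>R x)) +
        (exp (t *\<^sub>R - x) * (x * p t - p t * x) + - x * exp (t *\<^sub>R - x) * p t) * exp (t *\<^sub>R x) = 0"
      unfolding mult_minus_left comm by (simp add: algebra_simps)
    ultimately show ?thesis by simp
  qed
  obtain c where c: "\<And>t. t \<in> {0..1} \<Longrightarrow> q t = c"
    using has_vector_derivative_zero_constant[of "{0..1}" q] dq by auto
  have p0: "p 0 = y"
  proof (cases m)
    case 0
    then show ?thesis using assms by (simp add: p_def)
  next
    case (Suc j)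
    then show ?thesis unfolding p_def Suc by (subst sum.lessThan_Suc_shift) (simp add: Y_def)
  qed
  have "q 1 = q 0" using c[of 0] c[of 1] by simp
  then have "exp (- x) * p 1 * exp x = y" by (simp add: q_def p0)
  then have "exp x * y * exp (- x) = (exp x * exp (- x)) * p 1 * (exp x * exp (- x))"
    by (auto simp: mult.assoc)
  then show ?thesis by (simp add: exp_minus_inverse p_def Y_def divide_inverse)
qed

section \<open>Exponentials of nilpotent elements\<close>

lemma exp_nilpotent:
  fixes x :: "'a::{real_normed_algebra_1,banach}"
  assumes "x ^ m = 0"
  shows "exp x = (\<Sum>k<m. x ^ k /\<^sub>R fact k)"
  unfolding exp_def
proof (rule suminf_finite)
  fix n assume "n \<notin> {..<m}"
  then have "x ^ n = x ^ m * x ^ (n - m)" by (simp flip: power_add)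
  then show "x ^ n /\<^sub>R fact n = 0" by (simp add: assms)
qed simp

text \<open>Divide by \<open>n ^ K\<close> and let \<open>n\<close> tend to infinity: only the top
  coefficient survives.\<close>

lemma polynomial_zero_on_nat_imp_top_zero:
  fixes c :: "nat \<Rightarrow> 'a::real_normed_vector"
  assumes "\<And>n. (\<Sum>k\<le>K. real n ^ k *\<^sub>R c k) = 0"
  shows "c K = 0"
proof -
  define d where "d n k = (inverse (real n) ^ (K - k)) *\<^sub>R c k" for n k
  have "(\<lambda>n. d n k) \<longlonglongrightarrow> (if k = K then c k else 0)" if "k \<le> K" for k
  proof (cases "k = K")
    case False
    then have "(0::real) ^ (K - k) = 0" using that by (simp add: zero_power)
    then have "(\<lambda>n. inverse (real n) ^ (K - k)) \<longlonglongrightarrow> 0"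
      using tendsto_power[OF lim_inverse_n[where 'a = real], of "K - k"] by (simp only:)
    from tendsto_scaleR[OF this tendsto_const] show ?thesis using False by (simp add: d_def)
  qed (simp add: d_def)
  then have "(\<lambda>n. \<Sum>k\<le>K. d n k) \<longlonglongrightarrow> (\<Sum>k\<le>K. if k = K then c k else 0)"
    by (intro tendsto_sum) auto
  moreover have "(\<Sum>k\<le>K. if k = K then c k else 0) = c K" by simp
  moreover have "(\<Sum>k\<le>K. d n k) = 0" if "n > 0" for n
  proof -
    have "inverse (real n) ^ K * real n ^ k = inverse (real n) ^ (K - k)" if "k \<le> K" for k
      using that \<open>n > 0\<close> by (simp add: power_inverse power_diff field_simps)
    then have "(\<Sum>k\<le>K. d n k) = inverse (real n) ^ K *\<^sub>R (\<Sum>k\<le>K. real n ^ k *\<^sub>R c k)"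
      by (simp add: d_def scaleR_sum_right)
    then show ?thesis by (simp add: assms)
  qed
  then have "(\<lambda>n. \<Sum>k\<le>K. d n k) \<longlonglongrightarrow> 0"
    by (intro tendsto_eventually eventually_sequentiallyI[of 1]) auto
  ultimately show ?thesis using LIMSEQ_unique by metis
qed

lemma polynomial_zero_on_nat_imp_zero:
  fixes c :: "nat \<Rightarrow> 'a::real_normed_vector"
  assumes "\<And>n. (\<Sum>k\<le>K. real n ^ k *\<^sub>R c k) = 0" and "k \<le> K"
  shows "c k = 0"
  using assms
proof (induction K)
  case 0
  have "c 0 = 0" by (rule polynomial_zero_on_nat_imp_top_zero[OF "0.prems"(1)])
  then show ?case using "0.prems"(2) by simp
next
  case (Suc K)
  have top: "c (Suc K) = 0" by (rule polynomial_zero_on_nat_imp_top_zero[OF Suc.prems(1)])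
  have "(\<Sum>k\<le>K. real n ^ k *\<^sub>R c k) = 0" for n
    using Suc.prems(1)[of n] by (simp add: top)
  from Suc.IH[OF this] Suc.prems(2) top show ?case by (cases "k = Suc K") simp_all
qed

text \<open>Equal exponentials have equal \<open>j\<close>-th powers, so \<open>exp (j x)\<close>
  and \<open>exp (j y)\<close> agree for all natural \<open>j\<close>. For nilpotent elements both
  are polynomials in \<open>j\<close>, and comparing the linear coefficients gives the
  claim.\<close>

lemma exp_nilpotent_inj:
  fixes x y :: "'a::{real_normed_algebra_1,banach}"
  assumes "x ^ m = 0" "y ^ n = 0" "exp x = exp y"
  shows "x = y"
proof -
  \<comment> \<open>A common degree bound; the \<open>Suc\<close> guarantees that the linear
    coefficient is among those compared.\<close>
  define K where "K = Suc (m + n)"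
  have K: "x ^ Suc K = 0" "y ^ Suc K = 0"
    using assms(1,2) by (simp_all add: K_def power_add)
  have pow: "exp (real j *\<^sub>R z) = exp z ^ j" for j and z :: 'a
  proof (induction j)
    case (Suc j)
    have "exp (real (Suc j) *\<^sub>R z) = exp (z + real j *\<^sub>R z)" by (simp add: algebra_simps)
    also have "\<dots> = exp z * exp (real j *\<^sub>R z)" by (rule exp_add_commuting) simp
    finally show ?case by (simp add: Suc)
  qed simp
  have exp_eq: "exp (real j *\<^sub>R z) = (\<Sum>k\<le>K. real j ^ k *\<^sub>R (z ^ k /\<^sub>R fact k))" if "z ^ Suc K = 0"
      for j and z :: 'a
    using exp_nilpotent[of "real j *\<^sub>R z" "Suc K"] that
    by (simp only: scaleR_power lessThan_Suc_atMost) (simp add: scaleR_left_commute mult.commute)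
  have "(\<Sum>k\<le>K. real j ^ k *\<^sub>R (x ^ k /\<^sub>R fact k - y ^ k /\<^sub>R fact k)) = 0" for j
    using exp_eq[OF K(1), of j] exp_eq[OF K(2), of j] pow[of j x] pow[of j y] assms(3)
    by (simp add: scaleR_diff_right sum_subtractf)
  from polynomial_zero_on_nat_imp_zero[OF this, of 1] show ?thesis by (simp add: K_def)
qed

section \<open>Square matrices as a Banach algebra\<close>

text \<open>A copy of the square matrices on which matrix multiplication is the ring multiplication, so
  that the exponential of Banach algebras applies.\<close>

typedef ('k, 'n) sqmat = "UNIV :: ('k ^ 'n ^ 'n) set"
  morphisms mat_of sq by simp

lemma mat_of_inject_iff: "A = B \<longleftrightarrow> mat_of A = mat_of B"
  by (simp add: mat_of_inject)

lemma mat_of_sq [simp]: "mat_of (sq A) = A"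
  by (simp add: sq_inverse)

lemma sq_mat_of [simp]: "sq (mat_of A) = A"
  by (simp add: mat_of_inverse)

lemma sq_eq_iff [simp]: "sq A = sq B \<longleftrightarrow> A = B"
  by (simp add: sq_inject)

instantiation sqmat :: (ring_1, finite) ring_1
begin
definition "0 = sq 0"
definition "1 = sq (mat 1)"
definition "A + B = sq (mat_of A + mat_of B)"
definition "A - B = sq (mat_of A - mat_of B)"
definition "- A = sq (- mat_of A)"
definition "A * B = sq (mat_of A ** mat_of B)"
instance
proof
  show "(0 :: ('a, 'b) sqmat) \<noteq> 1"
  proof
    assume "(0 :: ('a, 'b) sqmat) = 1"
    then have "(mat 1 :: 'a ^ 'b ^ 'b) = 0"
      by (simp add: zero_sqmat_def one_sqmat_def)
    from arg_cong[OF this, of "\<lambda>A. A $ undefined $ undefined"] show False by (simp add: mat_def)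
  qed
  fix A B C :: "('a, 'b) sqmat"
  show "(A + B) * C = A * C + B * C"
    by (simp add: plus_sqmat_def times_sqmat_def matrix_matrix_mult_def vec_eq_iff distrib_right
        sum.distrib)
qed (simp_all add: zero_sqmat_def one_sqmat_def plus_sqmat_def minus_sqmat_def uminus_sqmat_def
    times_sqmat_def matrix_mul_assoc matrix_add_ldistrib)
end

lemma mat_of_simps [simp]:
  "mat_of 0 = 0" "mat_of 1 = mat 1" "mat_of (A + B) = mat_of A + mat_of B"
  "mat_of (A - B) = mat_of A - mat_of B" "mat_of (- A) = - mat_of A"
  "mat_of (A * B) = mat_of A ** mat_of B"
  by (simp_all add: zero_sqmat_def one_sqmat_def plus_sqmat_def minus_sqmat_def uminus_sqmat_def
      times_sqmat_def)

lemma sq_mult: "sq (A ** B) = sq A * sq B"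
  by (simp add: times_sqmat_def)

definition entry :: "'n \<Rightarrow> 'n \<Rightarrow> ('k, 'n::finite) sqmat \<Rightarrow> 'k" where
  "entry i j A = mat_of A $ i $ j"

lemma sqmat_eqI: "(\<And>i j. entry i j A = entry i j B) \<Longrightarrow> A = B"
  by (simp add: entry_def mat_of_inject_iff vec_eq_iff)

lemma entry_sq [simp]: "entry i j (sq A) = A $ i $ j"
  by (simp add: entry_def)

lemma entry_simps [simp]:
  "entry i j 0 = 0" "entry i j (A + B) = entry i j A + entry i j B"
  "entry i j (A - B) = entry i j A - entry i j B" "entry i j (- A) = - entry i j A"
  by (simp_all add: entry_def)

lemma entry_one: "entry i j 1 = (if i = j then 1 else 0)"
  by (simp add: entry_def mat_def)

lemma entry_mult: "entry i j (A * B) = (\<Sum>k\<in>UNIV. entry i k A * entry k j B)"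
  by (simp add: entry_def matrix_matrix_mult_def)

lemma entry_sum: "entry i j (sum f S) = (\<Sum>s\<in>S. entry i j (f s))"
  by (induction S rule: infinite_finite_induct) simp_all

instantiation sqmat :: (real_algebra_1, finite) real_algebra_1
begin
definition "scaleR c A = sq (scaleR c (mat_of A))" for A :: "('a, 'b) sqmat"

lemma entry_scaleR [simp]: "entry i j (c *\<^sub>R A) = c *\<^sub>R entry i j (A :: ('a, 'b) sqmat)"
  by (simp add: entry_def scaleR_sqmat_def)

instance
proof
  fix A B :: "('a, 'b) sqmat" and r s :: real
  show "r *\<^sub>R (A + B) = r *\<^sub>R A + r *\<^sub>R B" "(r + s) *\<^sub>R A = r *\<^sub>R A + s *\<^sub>R A"
    "r *\<^sub>R s *\<^sub>R A = (r * s) *\<^sub>R A" "1 *\<^sub>R A = A"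
    by (rule sqmat_eqI; simp add: scaleR_add_right scaleR_add_left)+
  show "(r *\<^sub>R A) * B = r *\<^sub>R (A * B)" "A * (r *\<^sub>R B) = r *\<^sub>R (A * B)"
    by (rule sqmat_eqI; simp add: entry_mult scaleR_sum_right)+
qed
end

instantiation sqmat :: (real_normed_field, finite) real_normed_algebra_1
begin
text \<open>The largest row sum is the operator norm for the maximum norm on vectors. Unlike the
  Euclidean norm of the entries it gives the identity matrix norm 1, as the class demands.\<close>

definition "norm A = Max (range (\<lambda>i. \<Sum>j\<in>UNIV. norm (entry i j A)))" for A :: "('a, 'b) sqmat"
definition "dist A B = norm (A - B)" for A :: "('a, 'b) sqmat"
definition "sgn A = A /\<^sub>R norm A" for A :: "('a, 'b) sqmat"
definition [code del]: "(uniformity :: (('a, 'b) sqmat \<times> ('a, 'b) sqmat) filter) =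
  (INF e\<in>{0<..}. principal {(x, y). dist x y < e})"
definition [code del]: "open (U :: ('a, 'b) sqmat set) \<longleftrightarrow>
  (\<forall>x\<in>U. eventually (\<lambda>(x', y). x' = x \<longrightarrow> y \<in> U) uniformity)"

lemma row_sum_le_norm: "(\<Sum>j\<in>UNIV. norm (entry i j A)) \<le> norm (A :: ('a, 'b) sqmat)"
  unfolding norm_sqmat_def by (rule Max_ge) auto

lemma norm_sqmat_le: "norm (A :: ('a, 'b) sqmat) \<le> c \<longleftrightarrow> (\<forall>i. (\<Sum>j\<in>UNIV. norm (entry i j A)) \<le> c)"
  unfolding norm_sqmat_def by (subst Max_le_iff) auto

lemma norm_entry_le_norm: "norm (entry i j A) \<le> norm (A :: ('a, 'b) sqmat)"
  by (rule order_trans[OF member_le_sum row_sum_le_norm]) auto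

lemma norm_sqmat_cases: "\<exists>i. norm (A :: ('a, 'b) sqmat) = (\<Sum>j\<in>UNIV. norm (entry i j A))"
proof -
  have "norm A \<in> range (\<lambda>i. \<Sum>j\<in>UNIV. norm (entry i j A))"
    unfolding norm_sqmat_def by (rule Max_in) auto
  then show ?thesis by blast
qed

instance
proof
  fix A B :: "('a, 'b) sqmat" and r :: real
  show "dist A B = norm (A - B)" by (rule dist_sqmat_def)
  show "sgn A = A /\<^sub>R norm A" by (rule sgn_sqmat_def)
  show "norm A = 0 \<longleftrightarrow> A = 0"
  proof
    assume "norm A = 0"
    then show "A = 0" using norm_entry_le_norm[of _ _ A] by (intro sqmat_eqI) simp
  qed (use norm_sqmat_cases[of A] in simp)
  show "norm (A + B) \<le> norm A + norm B"
    unfolding norm_sqmat_le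
  proof
    fix i
    have "(\<Sum>j\<in>UNIV. norm (entry i j (A + B))) \<le> (\<Sum>j\<in>UNIV. norm (entry i j A) + norm (entry i j B))"
      by (intro sum_mono) (simp add: norm_triangle_ineq)
    also have "\<dots> \<le> norm A + norm B"
      by (simp add: sum.distrib add_mono row_sum_le_norm)
    finally show "(\<Sum>j\<in>UNIV. norm (entry i j (A + B))) \<le> norm A + norm B" .
  qed
  show "norm (r *\<^sub>R A) = \<bar>r\<bar> * norm A"
  proof (rule antisym)
    show "norm (r *\<^sub>R A) \<le> \<bar>r\<bar> * norm A"
      unfolding norm_sqmat_le
      by (simp add: sum_distrib_left[symmetric] mult_left_mono row_sum_le_norm)
    obtain i where "norm A = (\<Sum>j\<in>UNIV. norm (entry i j A))" using norm_sqmat_cases by blast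
    then show "\<bar>r\<bar> * norm A \<le> norm (r *\<^sub>R A)"
      using row_sum_le_norm[of i "r *\<^sub>R A"] by (simp add: sum_distrib_left)
  qed
  show "norm (A * B) \<le> norm A * norm B"
    unfolding norm_sqmat_le
  proof
    fix i
    have "(\<Sum>j\<in>UNIV. norm (entry i j (A * B))) \<le>
        (\<Sum>j\<in>UNIV. \<Sum>k\<in>UNIV. norm (entry i k A) * norm (entry k j B))"
      unfolding entry_mult by (intro sum_mono order_trans[OF norm_sum]) (simp add: norm_mult)
    also have "\<dots> = (\<Sum>k\<in>UNIV. norm (entry i k A) * (\<Sum>j\<in>UNIV. norm (entry k j B)))"
      by (subst sum.swap) (simp add: sum_distrib_left)
    also have "\<dots> \<le> (\<Sum>k\<in>UNIV. norm (entry i k A) * norm B)"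
      by (intro sum_mono mult_left_mono row_sum_le_norm) simp
    also have "\<dots> \<le> norm A * norm B"
      unfolding sum_distrib_right[symmetric]
      using norm_sqmat_cases[of B]
      by (intro mult_right_mono row_sum_le_norm) (auto simp: sum_nonneg)
    finally show "(\<Sum>j\<in>UNIV. norm (entry i j (A * B))) \<le> norm A * norm B" .
  qed
  show "norm (1 :: ('a, 'b) sqmat) = 1"
  proof -
    have "(\<Sum>j\<in>UNIV. norm (entry i j (1 :: ('a, 'b) sqmat))) = 1" for i
    proof -
      have "(\<Sum>j\<in>UNIV. norm (entry i j (1 :: ('a, 'b) sqmat))) = (\<Sum>j\<in>UNIV. if i = j then 1 else 0)"
        by (rule sum.cong) (auto simp: entry_one)
      then show ?thesis by simp
    qed
    then show ?thesis using norm_sqmat_cases[of "1 :: ('a, 'b) sqmat"] by auto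
  qed
qed (rule uniformity_sqmat_def open_sqmat_def)+
end

lemma bounded_linear_entry: "bounded_linear (entry i j :: ('k::real_normed_field, 'n::finite)
    sqmat \<Rightarrow> 'k)"
  by (rule bounded_linear_intro[where K = 1]) (simp_all add: norm_entry_le_norm)

instance sqmat :: ("{real_normed_field, banach}", finite) banach
proof
  fix X :: "nat \<Rightarrow> ('a, 'b) sqmat"
  assume X: "Cauchy X"
  have "Cauchy (\<lambda>n. entry i j (X n))" for i j
    by (rule bounded_linear.Cauchy[OF bounded_linear_entry X])
  then have "\<exists>l. (\<lambda>n. entry i j (X n)) \<longlonglongrightarrow> l" for i j
    using Cauchy_convergent convergentD by blast
  then obtain L where L: "\<And>i j. (\<lambda>n. entry i j (X n)) \<longlonglongrightarrow> L i j"
    by metis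
  define Y where "Y = sq (\<chi> i j. L i j)"
  have "(\<lambda>n. norm (entry i j (X n) - L i j)) \<longlonglongrightarrow> 0" for i j
    using L[of i j] by (simp add: LIM_zero tendsto_norm_zero)
  then have lim: "(\<lambda>n. \<Sum>i\<in>UNIV. \<Sum>j\<in>UNIV. norm (entry i j (X n) - L i j)) \<longlonglongrightarrow> 0"
    by (intro tendsto_null_sum)
  \<comment> \<open>Entrywise convergence suffices, because each row sum is bounded by the sum over
    all entries.\<close>
  have "norm (X n - Y) \<le> (\<Sum>i\<in>UNIV. \<Sum>j\<in>UNIV. norm (entry i j (X n) - L i j))" for n
    unfolding norm_sqmat_le
  proof
    fix i
    have "(\<Sum>j\<in>UNIV. norm (entry i j (X n) - L i j)) \<le>
        (\<Sum>i\<in>UNIV. \<Sum>j\<in>UNIV. norm (entry i j (X n) - L i j))"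
      by (rule member_le_sum) (auto intro: sum_nonneg)
    then show "(\<Sum>j\<in>UNIV. norm (entry i j (X n - Y))) \<le>
        (\<Sum>i\<in>UNIV. \<Sum>j\<in>UNIV. norm (entry i j (X n) - L i j))"
      by (simp add: Y_def)
  qed
  then have "(\<lambda>n. X n - Y) \<longlonglongrightarrow> 0"
    by (intro Lim_null_comparison[OF _ lim]) simp
  then show "convergent X" unfolding convergent_def by (metis LIM_zero_cancel)
qed

lemma matpow_eq: "matpow A k = mat_of (sq A ^ k)"
  by (induction k) simp_all

lemma mat_exp_eq: "mat_exp A = mat_of (exp (sq A))"
  for A :: "'k::{real_normed_field,banach}^'n^'n"
proof -
  have "suminf (\<lambda>k. matpow A k $ i $ j / fact k) = entry i j (exp (sq A))" for i j
  proof -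
    have "entry i j (exp (sq A)) = suminf (\<lambda>k. entry i j (sq A ^ k /\<^sub>R fact k))"
      unfolding exp_def by (rule bounded_linear.suminf[OF bounded_linear_entry summable_exp_generic])
    moreover have "entry i j (sq A ^ k /\<^sub>R fact k) = matpow A k $ i $ j / fact k" for k
      by (simp only: entry_scaleR)
        (simp add: matpow_eq entry_def scaleR_conv_of_real divide_inverse mult.commute)
    ultimately show ?thesis by simp
  qed
  then show ?thesis
    by (simp add: mat_exp_def vec_eq_iff entry_def)
qed

section \<open>Root unipotents and torus elements\<close>

text \<open>The floor only changes the type to \<open>int\<close>; on roots the inner product is
  already an integer.\<close>

definition cartan_integer :: "'e::euclidean_space \<Rightarrow> 'e \<Rightarrow> int" where
  "cartan_integer b a = \<lfloor>b \<bullet> coroot a\<rfloor>"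

section \<open>Pairings between roots and coroots\<close>

locale roots =
  fixes Phi :: "'e::euclidean_space set"
  assumes root_system: "root_system Phi"
begin

lemma finite_roots: "finite Phi"
  and span_roots: "span Phi = UNIV"
  and zero_not_root: "0 \<notin> Phi"
  and reflection_root: "a \<in> Phi \<Longrightarrow> b \<in> Phi \<Longrightarrow> b - (b \<bullet> coroot a) *\<^sub>R a \<in> Phi"
  and proportional_root: "a \<in> Phi \<Longrightarrow> c *\<^sub>R a \<in> Phi \<Longrightarrow> c = 1 \<or> c = -1"
  using root_system unfolding root_system_def by blast+

lemma cartan_integer:
  assumes "a \<in> Phi" "b \<in> Phi"
  shows "b \<bullet> coroot a = of_int (cartan_integer b a)"
proof -
  have "b \<bullet> coroot a \<in> \<int>" using root_system assms unfolding root_system_def by blast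
  then show ?thesis by (auto simp: cartan_integer_def elim: Ints_cases)
qed

lemma root_coroot: "a \<in> Phi \<Longrightarrow> a \<bullet> coroot a = 2"
  using zero_not_root by (auto simp: coroot_def)

lemma cartan_integer_self: "a \<in> Phi \<Longrightarrow> cartan_integer a a = 2"
  by (simp add: cartan_integer_def root_coroot)

lemma uminus_root: "a \<in> Phi \<Longrightarrow> - a \<in> Phi"
  using reflection_root[of a a] by (simp add: root_coroot scaleR_2)

lemma cartan_integer_uminus:
  assumes "a \<in> Phi" "b \<in> Phi"
  shows "cartan_integer (- b) a = - cartan_integer b a"
proof -
  have "of_int (cartan_integer (- b) a) = (- of_int (cartan_integer b a) :: real)"
    using assms uminus_root by (simp add: cartan_integer[symmetric])
  then show ?thesis by linarith
qed

text \<open>\<open>relative_weight c a\<close> is the weight of the cocharacter \<open>2a\<^sup>\<or> - \<langle>c, a\<^sup>\<or>\<rangle>c\<^sup>\<or>\<close>, which kills \<open>c\<close>.\<close>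

definition relative_weight :: "'e \<Rightarrow> 'e \<Rightarrow> 'e \<Rightarrow> int" where
  "relative_weight c a d = 2 * cartan_integer d a - cartan_integer c a * cartan_integer d c"

lemma relative_weight_self: "c \<in> Phi \<Longrightarrow> relative_weight c a c = 0"
  by (simp add: relative_weight_def cartan_integer_self)

lemma relative_weight_uminus:
  "a \<in> Phi \<Longrightarrow> c \<in> Phi \<Longrightarrow> d \<in> Phi \<Longrightarrow> relative_weight c a (- d) = - relative_weight c a d"
  by (simp add: relative_weight_def cartan_integer_uminus)

text \<open>Up to the factor 2, the relative weights of \<open>d\<close> are the pairings of the
  component of \<open>d\<close> orthogonal to \<open>c\<close> with all coroots. If they vanish,
  this component is orthogonal to a spanning set, so \<open>d\<close> is proportional to
  \<open>c\<close>, and the root system is reduced.\<close>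

lemma relative_weights_zero_imp:
  assumes c: "c \<in> Phi" and d: "d \<in> Phi" and zero: "\<And>a. a \<in> Phi \<Longrightarrow> relative_weight c a d = 0"
  shows "d = c \<or> d = - c"
proof -
  define v where "v = 2 *\<^sub>R d - (d \<bullet> coroot c) *\<^sub>R c"
  have "orthogonal v a" if a: "a \<in> Phi" for a
  proof -
    have "v \<bullet> coroot a = of_int (relative_weight c a d)"
      using a c d by (simp add: v_def relative_weight_def cartan_integer inner_diff_left mult.commute)
    then have "(2 / (a \<bullet> a)) * (v \<bullet> a) = 0" using zero[OF a] by (simp add: coroot_def)
    moreover have "a \<bullet> a \<noteq> 0" using a zero_not_root by auto
    ultimately show ?thesis by (simp add: orthogonal_def)
  qed
  then have "orthogonal v v"
    using orthogonal_to_span[of v Phi v] span_roots by auto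
  then have "2 *\<^sub>R d = (d \<bullet> coroot c) *\<^sub>R c" by (simp add: orthogonal_def v_def)
  then have "(1 / 2) *\<^sub>R 2 *\<^sub>R d = (1 / 2) *\<^sub>R (d \<bullet> coroot c) *\<^sub>R c" by (rule arg_cong)
  then have "d = (d \<bullet> coroot c / 2) *\<^sub>R c" by simp
  with proportional_root[OF c, of "d \<bullet> coroot c / 2"] d show ?thesis by (metis scaleR_minus1_left
      scaleR_one)
qed

text \<open>Only consequences of the Chevalley relations that do not mention the absolute values of the
  structure constants are needed.\<close>

definition chevalley_relations :: "('e \<Rightarrow> 'a::real_algebra_1) \<Rightarrow> bool" where
  "chevalley_relations M \<longleftrightarrow>
    (\<forall>a\<in>Phi. \<exists>k. M a ^ k = 0) \<and>
    (\<forall>a\<in>Phi. \<forall>b\<in>Phi. a + b \<in> Phi \<longrightarrow> (\<exists>N::real. commutator (M a) (M b) = N *\<^sub>R M (a + b))) \<and>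
    (\<forall>a\<in>Phi. \<forall>b\<in>Phi. a + b \<noteq> 0 \<and> a + b \<notin> Phi \<longrightarrow> commutator (M a) (M b) = 0) \<and>
    (\<forall>a\<in>Phi. \<forall>b\<in>Phi. commutator (commutator (M a) (M (- a))) (M b) = (b \<bullet> coroot a) *\<^sub>R M b)"

end

section \<open>Root, torus and Weyl elements and their action on root vectors\<close>

locale chevalley_algebra = roots Phi for Phi :: "'e::euclidean_space set" +
  fixes M :: "'e \<Rightarrow> 'a::{real_normed_algebra_1,banach}"
  assumes relations: "chevalley_relations M"
begin

definition cartan_element :: "'e \<Rightarrow> 'a" where
  "cartan_element a = commutator (M a) (M (- a))"

definition unipotent :: "'e \<Rightarrow> real \<Rightarrow> 'a" where
  "unipotent a t = exp (t *\<^sub>R M a)"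

text \<open>The parameter is additive: \<open>torus a (ln s)\<close> is the element usually written
  \<open>h_a(s)\<close>, restricted to positive \<open>s\<close>.\<close>

definition torus :: "'e \<Rightarrow> real \<Rightarrow> 'a" where
  "torus a r = exp (r *\<^sub>R cartan_element a)"

text \<open>The counterpart of the matrix with rows (0, 1) and (-1, 0) in the rank one group of
  \<open>a\<close>; it acts there as the reflection in \<open>a\<close>.\<close>

definition weyl :: "'e \<Rightarrow> 'a" where
  "weyl a = unipotent a 1 * unipotent (- a) (- 1) * unipotent a 1"

definition weyl_inv :: "'e \<Rightarrow> 'a" where
  "weyl_inv a = unipotent a (- 1) * unipotent (- a) 1 * unipotent a (- 1)"

lemma nilpotent: "a \<in> Phi \<Longrightarrow> \<exists>k. M a ^ k = 0"
  using relations unfolding chevalley_relations_def by blast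

lemma commutator_cartan:
  "a \<in> Phi \<Longrightarrow> b \<in> Phi \<Longrightarrow> commutator (cartan_element a) (M b) = (b \<bullet> coroot a) *\<^sub>R M b"
  using relations unfolding chevalley_relations_def cartan_element_def by blast

lemma exp_add_scaleR: "exp (s *\<^sub>R y) * exp (t *\<^sub>R y) = exp ((s + t) *\<^sub>R y)" for y :: 'a
  by (simp add: scaleR_add_left flip: exp_add_commuting)

lemma unipotent_add: "unipotent a s * unipotent a t = unipotent a (s + t)"
  by (simp add: unipotent_def exp_add_scaleR)

lemma unipotent_0 [simp]: "unipotent a 0 = 1"
  by (simp add: unipotent_def)

lemma unipotent_inverse: "unipotent a t * unipotent a (- t) = 1" "unipotent a (- t) * unipotent a
    t = 1"
  by (simp_all add: unipotent_add)

lemma unipotent_cancel: "unipotent a t * (unipotent a (- t) * y) = y" "unipotent a (- t) *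
    (unipotent a t * y) = y"
  by (simp_all add: unipotent_inverse flip: mult.assoc)

lemma torus_add: "torus a s * torus a t = torus a (s + t)"
  by (simp add: torus_def exp_add_scaleR)

lemma torus_0 [simp]: "torus a 0 = 1"
  by (simp add: torus_def)

lemma torus_inverse: "torus a t * torus a (- t) = 1" "torus a (- t) * torus a t = 1"
  by (simp_all add: torus_add)

lemma weyl_inverse: "weyl a * weyl_inv a = 1" "weyl_inv a * weyl a = 1"
  using unipotent_cancel[of _ 1] unipotent_cancel[of _ "-1"] unipotent_inverse[of _ 1] 
  by (simp_all add: weyl_def weyl_inv_def mult.assoc)

lemma unipotent_power: "unipotent a t ^ n = unipotent a (real n * t)"
  by (induction n) (simp_all add: unipotent_add algebra_simps)

lemma power_conjugate:
  fixes u v y :: 'a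
  assumes "v * u = 1" "u * v = 1"
  shows "(u * y * v) ^ n = u * y ^ n * v"
proof (induction n)
  case (Suc n)
  have "u * y * v * (u * y ^ n * v) = u * y * (v * u) * y ^ n * v" by (simp add: mult.assoc)
  then show ?case using Suc by (simp add: assms mult.assoc)
qed (simp add: assms)

lemma unipotent_conjugate:
  assumes "v * u = 1" "u * v = 1" "u * M a * v = c *\<^sub>R M b"
  shows "u * unipotent a t * v = unipotent b (c * t)"
proof -
  have "u * unipotent a t * v = exp (u * (t *\<^sub>R M a) * v)"
    unfolding unipotent_def by (rule exp_conjugate[OF assms(1,2)])
  also have "u * (t *\<^sub>R M a) * v = t *\<^sub>R (u * M a * v)" by simp
  finally show ?thesis by (simp add: assms(3) unipotent_def mult.commute)
qed

text \<open>This turns a group equation between root elements into a linear equation between root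
  vectors: both sides are exponentials of nilpotent elements, where \<open>exp\<close> is
  injective.\<close>

lemma unipotent_inj_M:
  assumes "a \<in> Phi" "b \<in> Phi" "v * u = 1" "u * v = 1"
    and "u * unipotent a s * v = unipotent b t"
  shows "s *\<^sub>R (u * M a * v) = t *\<^sub>R M b"
proof -
  obtain k l where k: "M a ^ k = 0" and l: "M b ^ l = 0" using nilpotent assms(1,2) by blast
  have "exp (s *\<^sub>R (u * M a * v)) = exp (t *\<^sub>R M b)"
    using assms(5) exp_conjugate[OF assms(3,4), of "s *\<^sub>R M a"] by (simp add: unipotent_def)
  moreover have "(s *\<^sub>R (u * M a * v)) ^ k = 0"
    by (simp add: power_conjugate[OF assms(3,4)] k)
  moreover have "(t *\<^sub>R M b) ^ l = 0" by (simp add: l)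
  ultimately show ?thesis using exp_nilpotent_inj by blast
qed

text \<open>One equation at parameter 1 fixes the conjugate of the root vector, and with it the
  conjugates of all \<open>unipotent a s\<close>. Hence conjugation can act as multiplication on
  parameters.\<close>

lemma M_conjugate_of_unipotent:
  assumes "a \<in> Phi" "b \<in> Phi" "v * u = 1" "u * v = 1"
    and "u * unipotent a 1 * v = unipotent b t"
  shows "u * unipotent a s * v = unipotent b (t * s)"
  using unipotent_inj_M[OF assms] unipotent_conjugate[OF assms(3,4)] by simp

lemma M_commutes_of_unipotent:
  assumes "a \<in> Phi" "v * u = 1" "u * v = 1" and "u * unipotent a 1 = unipotent a 1 * u"
  shows "u * M a * v = M a"
proof -
  have "u * unipotent a 1 * v = unipotent a 1" using assms(3,4) by (simp add: mult.assoc)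
  from unipotent_inj_M[OF assms(1,1) assms(2,3) this] show ?thesis by simp
qed

lemma torus_conjugate:
  assumes "a \<in> Phi" "b \<in> Phi"
  shows "torus a r * M b * torus a (- r) = exp (r * (b \<bullet> coroot a)) *\<^sub>R M b"
proof -
  have "commutator (r *\<^sub>R cartan_element a) (M b) = (r * (b \<bullet> coroot a)) *\<^sub>R M b"
    using assms by (simp add: commutator_scaleR commutator_cartan)
  from exp_conjugate_eigenvector[OF this] show ?thesis by (simp add: torus_def)
qed

lemma torus_unipotent:
  assumes "a \<in> Phi" "b \<in> Phi"
  shows "torus a r * unipotent b t * torus a (- r) = unipotent b (exp (r * (b \<bullet> coroot a)) * t)"
  by (rule unipotent_conjugate[OF torus_inverse(2,1) torus_conjugate[OF assms]])

lemma cartan_element_uminus: "cartan_element (- a) = - cartan_element a"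
  by (simp add: cartan_element_def commutator_swap[of "M (- a)"])

lemma commutator_M_cartan: "a \<in> Phi \<Longrightarrow> commutator (M a) (cartan_element a) = - 2 *\<^sub>R M a"
  using commutator_cartan[of a a] root_coroot[of a] by (subst commutator_swap) simp

text \<open>The elements \<open>M a\<close>, \<open>cartan_element a\<close> and
  \<open>M (- a)\<close> satisfy the relations of an \<open>sl_2\<close> triple. Two brackets with
  \<open>M a\<close> kill the Cartan element and three kill \<open>M (- a)\<close>, so here and in
  the next lemma the adjoint series is a polynomial of degree at most 2.\<close>

lemma unipotent_conjugate_cartan:
  assumes "a \<in> Phi"
  shows "unipotent a t * cartan_element a * unipotent a (- t) = cartan_element a - (2 * t) *\<^sub>R M a"
proof -
  note simps = eval_nat_numeral commutator_scaleR commutator_minus_right commutator_M_cartan[OF assms]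
    commutator_self
  have "(commutator (t *\<^sub>R M a) ^^ 2) (cartan_element a) = 0" by (simp add: simps)
  from exp_conjugate_nilpotent[OF this] show ?thesis by (simp add: unipotent_def simps)
qed

lemma unipotent_conjugate_opposite_M:
  assumes "a \<in> Phi"
  shows "unipotent a t * M (- a) * unipotent a (- t) =
    M (- a) + t *\<^sub>R cartan_element a - (t * t) *\<^sub>R M a"
proof -
  note simps = eval_nat_numeral commutator_scaleR commutator_minus_right commutator_M_cartan[OF assms]
    commutator_self cartan_element_def[symmetric]
  have "(commutator (t *\<^sub>R M a) ^^ 3) (M (- a)) = 0" by (simp add: simps)
  from exp_conjugate_nilpotent[OF this] show ?thesis by (simp add: unipotent_def simps)
qed

lemma opposite_unipotent_conjugate_cartan:
  assumes "a \<in> Phi"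
  shows "unipotent (- a) t * cartan_element a * unipotent (- a) (- t) =
    cartan_element a + (2 * t) *\<^sub>R M (- a)"
  using arg_cong[OF unipotent_conjugate_cartan[OF uminus_root[OF assms], of t], of uminus]
  by (simp add: cartan_element_uminus)

lemma opposite_unipotent_conjugate_M:
  assumes "a \<in> Phi"
  shows "unipotent (- a) t * M a * unipotent (- a) (- t) =
    M a - t *\<^sub>R cartan_element a - (t * t) *\<^sub>R M (- a)"
  using unipotent_conjugate_opposite_M[OF uminus_root[OF assms], of t]
  by (simp add: cartan_element_uminus)

lemma unipotent_conjugate_self: "unipotent a t * M a * unipotent a (- t) = M a"
proof -
  have "(commutator (t *\<^sub>R M a) ^^ 1) (M a) = 0"
    by (simp add: commutator_scaleR commutator_self)
  from exp_conjugate_nilpotent[OF this] show ?thesis by (simp add: unipotent_def)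
qed

lemma weyl_conjugate_M:
  assumes "a \<in> Phi"
  shows "weyl a * M a * weyl_inv a = - M (- a)"
proof -
  have "weyl a * M a * weyl_inv a = unipotent a 1 * (unipotent (- a) (- 1) *
      (unipotent a 1 * M a * unipotent a (- 1)) * unipotent (- a) (- (- 1))) * unipotent a (- 1)"
    by (simp add: weyl_def weyl_inv_def mult.assoc)
  also have "\<dots> = unipotent a 1 * (M a + cartan_element a - M (- a)) * unipotent a (- 1)"
    unfolding unipotent_conjugate_self opposite_unipotent_conjugate_M[OF assms] by simp
  also have "\<dots> = unipotent a 1 * M a * unipotent a (- 1) + unipotent a 1 * cartan_element a *
      unipotent a (- 1)
      - unipotent a 1 * M (- a) * unipotent a (- 1)"
    by (simp add: algebra_simps)
  also have "\<dots> = - M (- a)"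
    unfolding unipotent_conjugate_self unipotent_conjugate_cartan[OF assms]
      unipotent_conjugate_opposite_M[OF assms]
    by (simp add: scaleR_2)
  finally show ?thesis .
qed

lemma weyl_conjugate_cartan:
  assumes "a \<in> Phi"
  shows "weyl a * cartan_element a * weyl_inv a = - cartan_element a"
proof -
  have "weyl a * cartan_element a * weyl_inv a = unipotent a 1 * (unipotent (- a) (- 1) *
      (unipotent a 1 * cartan_element a * unipotent a (- 1)) * unipotent (- a) (- (- 1))) *
          unipotent a (- 1)"
    by (simp add: weyl_def weyl_inv_def mult.assoc)
  also have "\<dots> = unipotent a 1 * (unipotent (- a) (- 1) * cartan_element a * unipotent (- a) (- (- 1))
      - 2 *\<^sub>R (unipotent (- a) (- 1) * M a * unipotent (- a) (- (- 1)))) * unipotent a (- 1)"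
    unfolding unipotent_conjugate_cartan[OF assms] by (simp add: algebra_simps)
  also have "\<dots> = unipotent a 1 * (- cartan_element a - 2 *\<^sub>R M a) * unipotent a (- 1)"
    unfolding opposite_unipotent_conjugate_cartan[OF assms] opposite_unipotent_conjugate_M[OF assms]
    by (simp add: algebra_simps scaleR_2)
  also have "\<dots> = - (unipotent a 1 * cartan_element a * unipotent a (- 1))
      - 2 *\<^sub>R (unipotent a 1 * M a * unipotent a (- 1))"
    by (simp add: algebra_simps)
  also have "\<dots> = - cartan_element a"
    unfolding unipotent_conjugate_self unipotent_conjugate_cartan[OF assms]
    by (simp add: algebra_simps)
  finally show ?thesis .
qed

text \<open>Conjugating \<open>w = x\<^sub>a(1) x\<^sub>-\<^sub>a(-1) x\<^sub>a(1)\<close> by \<open>exp(r h\<^sub>a)\<close> gives \<open>x\<^sub>a(s) x\<^sub>-\<^sub>a(-1/s) x\<^sub>a(s)\<close> with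
  \<open>s = exp(2r)\<close> on the one hand and \<open>exp(2r h\<^sub>a) w\<close> on the other.\<close>

lemma torus_eq_unipotents:
  assumes "a \<in> Phi" "s > 0"
  shows "torus a (ln s) =
    unipotent a s * unipotent (- a) (- (1 / s)) * unipotent a s * weyl_inv a"
proof -
  define r where "r = ln s / 2"
  have s: "exp (r * 2) = s" "exp (- (r * 2)) = 1 / s"
    using assms(2) by (simp_all add: r_def exp_minus inverse_eq_divide)
  have minus: "- a \<in> Phi" "- a \<bullet> coroot a = - 2" using assms(1) uminus_root root_coroot by simp_all
  have T: "torus a r * unipotent a 1 * torus a (- r) = unipotent a s"
    "torus a r * unipotent (- a) (- 1) * torus a (- r) = unipotent (- a) (- (1 / s))"
    using torus_unipotent[OF assms(1,1)] torus_unipotent[OF assms(1) minus(1)] root_coroot[OF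
        assms(1)] s
    by (simp_all add: minus(2))
  have "weyl a * torus a (- r) * weyl_inv a = exp (weyl a * (- r *\<^sub>R cartan_element a) * weyl_inv a)"
    unfolding torus_def by (rule exp_conjugate[OF weyl_inverse(2,1)])
  also have "weyl a * (- r *\<^sub>R cartan_element a) * weyl_inv a =
      - r *\<^sub>R (weyl a * cartan_element a * weyl_inv a)" by simp
  finally have W: "weyl a * torus a (- r) * weyl_inv a = torus a r"
    by (simp add: weyl_conjugate_cartan[OF assms(1)] torus_def)
  have "unipotent a s * unipotent (- a) (- (1 / s)) * unipotent a s =
     torus a r * unipotent a 1 * (torus a (- r) * torus a r) * unipotent (- a) (- 1) *
      (torus a (- r) * torus a r) * unipotent a 1 * torus a (- r)"
    by (simp add: T[symmetric] mult.assoc)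
  also have "\<dots> = torus a r * weyl a * torus a (- r)"
    by (simp add: torus_inverse weyl_def mult.assoc)
  finally have "unipotent a s * unipotent (- a) (- (1 / s)) * unipotent a s * weyl_inv a =
      torus a r * (weyl a * torus a (- r) * weyl_inv a)" by (simp add: mult.assoc)
  then show ?thesis unfolding W torus_add by (simp add: r_def)
qed

text \<open>The split real form of the represented Lie algebra. Taking the coroot elements of all
  roots makes it visibly stable under brackets with root vectors.\<close>

definition lie_span :: "'a set" where
  "lie_span = span (M ` Phi \<union> cartan_element ` Phi)"

lemma lie_span_decompose:
  assumes "Y \<in> lie_span"
  obtains h y where "h \<in> span (cartan_element ` Phi)" "Y = h + (\<Sum>d\<in>Phi. y d *\<^sub>R M d)"
proof -
  obtain m h where m: "m \<in> span (M ` Phi)" and h: "h \<in> span (cartan_element ` Phi)" "Y = m + h"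
    using assms unfolding lie_span_def span_Un by blast
  have "\<exists>y. m = (\<Sum>d\<in>Phi. y d *\<^sub>R M d)"
    using m
  proof (induction rule: span_induct_alt)
    case base
    show ?case by (rule exI[of _ "\<lambda>_. 0"]) simp
  next
    case (step c z m)
    then obtain d y where "d \<in> Phi" "z = M d" "m = (\<Sum>d\<in>Phi. y d *\<^sub>R M d)" by blast
    then show ?case using finite_roots
      by (intro exI[of _ "\<lambda>e. y e + (if e = d then c else 0)"])
        (simp add: scaleR_add_left sum.distrib if_distrib[of "\<lambda>c. c *\<^sub>R _"] sum.delta cong: if_cong)
  qed
  with h that show ?thesis by (metis add.commute)
qed

lemma commutator_M_span_cartan:
  assumes "c \<in> Phi" "h \<in> span (cartan_element ` Phi)"
  shows "\<exists>p. commutator (M c) h = p *\<^sub>R M c"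
  using assms(2)
proof (induction rule: span_induct_alt)
  case base
  show ?case by (rule exI[of _ 0]) (simp add: commutator_def)
next
  case (step k z h)
  then obtain a p where a: "a \<in> Phi" "z = cartan_element a" and p: "commutator (M c) h = p *\<^sub>R M
      c" by blast
  have "commutator (M c) z = - (c \<bullet> coroot a) *\<^sub>R M c"
    using commutator_cartan[OF a(1) assms(1)] a(2) by (subst commutator_swap) simp
  then have "commutator (M c) (k *\<^sub>R z + h) = (p - k * (c \<bullet> coroot a)) *\<^sub>R M c"
    by (simp add: commutator_add_right commutator_scaleR p algebra_simps)
  then show ?case ..
qed

end

section \<open>A Diophantine definition of root subgroups\<close>

text \<open>All that the definability argument uses about \<open>H\<close>. Beyond the group laws,
  elements of \<open>H\<close> are restricted only by the last two assumptions, which later follow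
  from the integral equations of the Chevalley group.\<close>

locale chevalley_points = chevalley_algebra Phi M
  for Phi :: "'e::euclidean_space set" and M :: "'e \<Rightarrow> 'a::{real_normed_algebra_1,banach}" +
  fixes H :: "'a set"
  assumes independent_M: "\<And>y d. (\<Sum>d\<in>Phi. y d *\<^sub>R M d) = 0 \<Longrightarrow> d \<in> Phi \<Longrightarrow> y d = 0"
    and H_one: "1 \<in> H"
    and H_mult: "A \<in> H \<Longrightarrow> B \<in> H \<Longrightarrow> A * B \<in> H"
    and H_inverse: "A \<in> H \<Longrightarrow> \<exists>B\<in>H. A * B = 1 \<and> B * A = 1"
    and unipotent_in_H: "a \<in> Phi \<Longrightarrow> unipotent a t \<in> H"
    and conjugate_in_lie_span:
      "A \<in> H \<Longrightarrow> B \<in> H \<Longrightarrow> A * B = 1 \<Longrightarrow> a \<in> Phi \<Longrightarrow> A * M a * B \<in> lie_span"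
    and centralizer_central:
      "A \<in> H \<Longrightarrow> (\<And>a. a \<in> Phi \<Longrightarrow> z * M a = M a * z) \<Longrightarrow> z * A = A * z"
begin

definition G :: "'a monoid" where
  "G = \<lparr>carrier = H, mult = (*), one = 1\<rparr>"

lemma G_simps [simp]: "carrier G = H" "x \<otimes>\<^bsub>G\<^esub> y = x * y" "\<one>\<^bsub>G\<^esub> = 1"
  by (simp_all add: G_def)

sublocale group G
proof (rule groupI)
  fix A assume "A \<in> carrier G"
  then show "\<exists>B\<in>carrier G. B \<otimes>\<^bsub>G\<^esub> A = \<one>\<^bsub>G\<^esub>" using H_inverse by auto
qed (auto simp: H_one H_mult mult.assoc)

abbreviation iv :: "'a \<Rightarrow> 'a" where
  "iv A \<equiv> inv\<^bsub>G\<^esub> A"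

lemma iv_closed [simp]: "A \<in> H \<Longrightarrow> iv A \<in> H"
  using inv_closed by simp

lemma iv_mult [simp]: "A \<in> H \<Longrightarrow> A * iv A = 1" "A \<in> H \<Longrightarrow> iv A * A = 1"
  using r_inv l_inv by simp_all

lemma iv_unique: "A \<in> H \<Longrightarrow> B \<in> H \<Longrightarrow> A * B = 1 \<Longrightarrow> iv A = B"
  using inv_equality[of B A] inv_comm[of A B] by simp

lemma pow_eq: "A [^]\<^bsub>G\<^esub> (n::nat) = A ^ n"
  by (induction n) (simp_all flip: power_Suc2)

lemma iv_unipotent [simp]: "a \<in> Phi \<Longrightarrow> iv (unipotent a t) = unipotent a (- t)"
  by (rule iv_unique) (simp_all add: unipotent_in_H unipotent_inverse)

lemma M_nonzero: "a \<in> Phi \<Longrightarrow> M a \<noteq> 0"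
  using independent_M[of "\<lambda>d. if d = a then 1 else 0" a] finite_roots
  by (auto simp: if_distrib[of "\<lambda>c. c *\<^sub>R _"] sum.delta cong: if_cong)

lemma unipotent_inj: "a \<in> Phi \<Longrightarrow> unipotent a s = unipotent a t \<longleftrightarrow> s = t"
  using unipotent_inj_M[of a a 1 1 s t] M_nonzero by auto

lemma weyl_in_H: "a \<in> Phi \<Longrightarrow> weyl a \<in> H" "a \<in> Phi \<Longrightarrow> weyl_inv a \<in> H"
  by (simp_all add: weyl_def weyl_inv_def H_mult unipotent_in_H uminus_root)

lemma torus_in_H: "a \<in> Phi \<Longrightarrow> torus a r \<in> H"
  using torus_eq_unipotents[of a "exp r"]
  by (simp add: H_mult unipotent_in_H weyl_in_H uminus_root)

lemma iv_torus [simp]: "a \<in> Phi \<Longrightarrow> iv (torus a r) = torus a (- r)"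
  by (rule iv_unique) (simp_all add: torus_in_H torus_inverse)

lemma conjugate_power: "A \<in> H \<Longrightarrow> (A * y * iv A) ^ n = A * y ^ n * iv A"
  by (rule power_conjugate) simp_all

text \<open>\<open>B\<close> acts on the root vectors as the torus element \<open>2\<^sup>k\<close>, expressed by equations between
  \<open>B\<close> and the root elements \<open>x\<^sub>d(1)\<close>.\<close>

definition scales :: "'a \<Rightarrow> ('e \<Rightarrow> int) \<Rightarrow> bool" where
  "scales B k \<longleftrightarrow>
    (\<forall>d\<in>Phi. (B * unipotent d 1 * iv B) ^ (2 ^ nat (- k d)) = unipotent d 1 ^ (2 ^ nat (k d)))"

text \<open>For negative \<open>k d\<close> the factor is moved to the left side as a power, so only
  natural exponents occur. Injectivity of \<open>exp\<close> turns the equation into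
  \<open>p\<close> times the conjugated root vector equal to \<open>q\<close> times the root vector,
  where \<open>q / p\<close> is 2 to the power \<open>k d\<close>.\<close>

lemma scales_iff:
  assumes "B \<in> H"
  shows "scales B k \<longleftrightarrow> (\<forall>d\<in>Phi. B * M d * iv B = (2 powr k d) *\<^sub>R M d)"
proof -
  have "(B * unipotent d 1 * iv B) ^ (2 ^ nat (- k d)) = unipotent d 1 ^ (2 ^ nat (k d)) \<longleftrightarrow>
      B * M d * iv B = (2 powr k d) *\<^sub>R M d" (is "?L \<longleftrightarrow> ?R") if d: "d \<in> Phi" for d
  proof -
    define p q :: real where "p = 2 ^ nat (- k d)" and "q = 2 ^ nat (k d)"
    have p: "p > 0" by (simp add: p_def)
    have pq: "2 powr k d * p = q"
    proof (cases "k d \<ge> 0")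
      case True
      then show ?thesis
        by (simp add: p_def q_def powr_realpow[symmetric])
    next
      case False
      then have "p = 2 powr - real_of_int (k d)"
        by (simp add: p_def powr_realpow[symmetric])
      then show ?thesis using False by (simp add: q_def powr_add[symmetric])
    qed
    have "?L \<longleftrightarrow> B * unipotent d p * iv B = unipotent d q"
      by (simp add: conjugate_power[OF assms] unipotent_power p_def q_def)
    also have "\<dots> \<longleftrightarrow> ?R"
    proof
      assume "B * unipotent d p * iv B = unipotent d q"
      from unipotent_inj_M[OF d d _ _ this] have "p *\<^sub>R (B * M d * iv B) = q *\<^sub>R M d"
        using assms by simp
      then have "p *\<^sub>R (B * M d * iv B) = p *\<^sub>R ((2 powr k d) *\<^sub>R M d)"
        by (simp add: pq[symmetric] mult.commute)
      then show ?R using p unfolding scaleR_cancel_left by simp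
    next
      assume ?R
      from unipotent_conjugate[OF _ _ this, of p] assms
      show "B * unipotent d p * iv B = unipotent d q" by (simp add: pq)
    qed
    finally show ?thesis .
  qed
  then show ?thesis unfolding scales_def by simp
qed

lemma torus_scales:
  assumes "a \<in> Phi"
  shows "scales (torus a (ln 2)) (\<lambda>d. cartan_integer d a)"
proof -
  have "exp (ln 2 * (d \<bullet> coroot a)) = 2 powr cartan_integer d a" if "d \<in> Phi" for d
    using cartan_integer[OF assms that] by (simp add: powr_def mult.commute)
  then show ?thesis
    unfolding scales_iff[OF torus_in_H[OF assms]]
    using torus_conjugate[OF assms] assms by simp
qed

lemma relative_torus_scales:
  assumes "a \<in> Phi" "c \<in> Phi"
  shows "\<exists>D\<in>H. scales D (relative_weight c a) \<and> D * M c * iv D = M c"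
proof -
  \<comment> \<open>The value at 2 of the cocharacter behind \<open>relative_weight\<close>; its
    weight on \<open>c\<close> is zero, so it fixes \<open>M c\<close>.\<close>
  define D where "D = torus a (2 * ln 2) * torus c (- (cartan_integer c a * ln 2))"
  define D' where "D' = torus c (cartan_integer c a * ln 2) * torus a (- (2 * ln 2))"
  have D: "D \<in> H" "D' \<in> H" unfolding D_def D'_def using assms by (simp_all add: H_mult torus_in_H)
  have "D * D' = torus a (2 * ln 2) * (torus c (- (cartan_integer c a * ln 2)) *
      torus c (cartan_integer c a * ln 2)) * torus a (- (2 * ln 2))"
    by (simp add: D_def D'_def mult.assoc)
  then have D': "iv D = D'" using D by (intro iv_unique) (simp_all add: torus_add)
  have act: "D * M d * iv D = (2 powr relative_weight c a d) *\<^sub>R M d" if d: "d \<in> Phi" for d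
  proof -
    have "D * M d * iv D = torus a (2 * ln 2) *
        (torus c (- (cartan_integer c a * ln 2)) * M d * torus c (- (- (cartan_integer c a * ln
            2)))) *
        torus a (- (2 * ln 2))"
      unfolding D' by (simp add: D'_def D_def mult.assoc)
    also have "\<dots> = (exp (- (cartan_integer c a * ln 2) * (d \<bullet> coroot c)) * exp (2 * ln 2 * (d \<bullet>
        coroot a))) *\<^sub>R M d"
      unfolding torus_conjugate[OF assms(2) d]
      by (simp add: torus_conjugate[OF assms(1) d, of "2 * ln 2"])
    also have "exp (- (cartan_integer c a * ln 2) * (d \<bullet> coroot c)) * exp (2 * ln 2 * (d \<bullet> coroot
        a)) =
        2 powr relative_weight c a d"
      using assms d by (simp add: powr_def relative_weight_def cartan_integer exp_add[symmetric]
          algebra_simps)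
    finally show ?thesis .
  qed
  then have "D * M c * iv D = M c" using assms by (simp add: relative_weight_self)
  with D act show ?thesis by (intro bexI[of _ D]) (auto simp: scales_iff)
qed

text \<open>A Cartan element is a bracket of two opposite root vectors, whose scaling factors are
  inverse to each other.\<close>

lemma scales_fixes_cartan:
  assumes D: "D \<in> H" "scales D k" and k: "\<And>d. d \<in> Phi \<Longrightarrow> k (- d) = - k d"
    and h: "h \<in> span (cartan_element ` Phi)"
  shows "D * h * iv D = h"
  using h
proof (induction rule: span_induct_alt)
  case (step c z h)
  then obtain b where b: "b \<in> Phi" "z = cartan_element b" by blast
  have "D * z * iv D = commutator (D * M b * iv D) (D * M (- b) * iv D)"
    unfolding b cartan_element_def using D(1) by (intro commutator_conjugate) simp
  also have "\<dots> = z"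
    using D(2) b uminus_root[OF b(1)]
    by (simp add: scales_iff[OF D(1)] commutator_scaleR k cartan_element_def flip: powr_add)
  finally show ?case using step by (simp add: algebra_simps)
qed simp

text \<open>The conjugate \<open>Y\<close> of \<open>M (- c)\<close> by \<open>A\<close> is fixed by
  all the elements \<open>D\<close>, because they commute with \<open>A\<close> and fix
  \<open>M (- c)\<close>. Comparing weights leaves in \<open>Y\<close> only a Cartan part and
  multiples of \<open>M c\<close> and \<open>M (- c)\<close>. Bracketing with \<open>M c\<close>,
  which \<open>A\<close> fixes, gives the conjugate of \<open>cartan_element c\<close> as a
  combination of itself and \<open>M c\<close>.\<close>

lemma conjugate_cartan_of_commuting:
  assumes A: "A \<in> H" and c: "c \<in> Phi" and Ac: "A * M c * iv A = M c"
    and D: "\<And>a. a \<in> Phi \<Longrightarrow> \<exists>D\<in>H. A * D = D * A \<and> scales D (relative_weight c a)"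
  shows "\<exists>p. A * cartan_element c * iv A = cartan_element c + p *\<^sub>R M c"
proof -
  have c': "- c \<in> Phi" by (rule uminus_root[OF c])
  define Y where "Y = A * M (- c) * iv A"
  have "Y \<in> lie_span" unfolding Y_def using A c' by (intro conjugate_in_lie_span) simp_all
  then obtain h y where h: "h \<in> span (cartan_element ` Phi)" and Y: "Y = h + (\<Sum>d\<in>Phi. y d *\<^sub>R M d)"
    by (rule lie_span_decompose)
  have y: "y d = 0" if d: "d \<in> Phi" "d \<noteq> c" "d \<noteq> - c" for d
  proof -
    obtain a where a: "a \<in> Phi" "relative_weight c a d \<noteq> 0"
      using relative_weights_zero_imp[OF c d(1)] d by blast
    obtain D where D: "D \<in> H" "A * D = D * A" "scales D (relative_weight c a)"
      using assms(4)[OF a(1)] by blast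
    have AD: "iv A * iv D = iv D * iv A"
      using inv_mult_group[of A D] inv_mult_group[of D A] A D by simp
    have "D * Y * iv D = (D * A) * M (- c) * (iv A * iv D)" by (simp add: Y_def mult.assoc)
    also have "\<dots> = A * (D * M (- c) * iv D) * iv A" by (simp add: D(2)[symmetric] AD mult.assoc)
    also have "D * M (- c) * iv D = M (- c)"
      using D(3) c c' a(1) by (simp add: scales_iff[OF D(1)] relative_weight_uminus
          relative_weight_self)
    finally have "D * Y * iv D = Y" by (simp add: Y_def)
    moreover have "D * Y * iv D = h + (\<Sum>d\<in>Phi. y d *\<^sub>R (D * M d * iv D))"
      unfolding Y distrib_left distrib_right sum_distrib_left sum_distrib_right
      using scales_fixes_cartan[OF D(1,3) relative_weight_uminus[OF a(1) c] h] by simp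
    moreover have "(\<Sum>d\<in>Phi. y d *\<^sub>R (D * M d * iv D)) =
        (\<Sum>d\<in>Phi. (y d * 2 powr relative_weight c a d) *\<^sub>R M d)"
      using D(3) by (intro sum.cong) (simp_all add: scales_iff[OF D(1)])
    ultimately have "(\<Sum>d\<in>Phi. (y d * 2 powr relative_weight c a d - y d) *\<^sub>R M d) = 0"
      by (simp add: Y scaleR_diff_left sum_subtractf)
    then have "y d * (2 powr relative_weight c a d - 1) = 0"
      using independent_M[OF _ d(1), of "\<lambda>d. y d * 2 powr relative_weight c a d - y d"]
      by (simp add: algebra_simps)
    then show ?thesis using a(2) by simp
  qed
  have cc: "c \<noteq> - c"
  proof
    assume "c = - c"
    then have "2 *\<^sub>R c = 0" by (metis add.right_inverse scaleR_2)
    then show False using c zero_not_root by auto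
  qed
  have "(\<Sum>d\<in>Phi. y d *\<^sub>R M d) = (\<Sum>d\<in>{c, - c}. y d *\<^sub>R M d)"
    using c c' y finite_roots by (intro sum.mono_neutral_right) auto
  then have Y': "Y = h + (y c *\<^sub>R M c + y (- c) *\<^sub>R M (- c))" using cc by (simp add: Y)
  obtain p where p: "commutator (M c) h = p *\<^sub>R M c" using commutator_M_span_cartan[OF c h] by blast
  have "A * cartan_element c * iv A = commutator (A * M c * iv A) (A * M (- c) * iv A)"
    unfolding cartan_element_def using A by (intro commutator_conjugate) simp
  also have "\<dots> = p *\<^sub>R M c + y (- c) *\<^sub>R cartan_element c"
    unfolding Ac Y_def[symmetric] Y'
    by (simp add: commutator_add_right commutator_scaleR p commutator_self cartan_element_def)
  finally have AH: "A * cartan_element c * iv A = p *\<^sub>R M c + y (- c) *\<^sub>R cartan_element c" .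
  \<comment> \<open>Conjugation preserves the eigenvalue 2 of \<open>cartan_element c\<close> on
    \<open>M c\<close>, which forces the remaining coefficient \<open>y (- c)\<close> to be
    1.\<close>
  have "commutator (A * cartan_element c * iv A) (A * M c * iv A) = A * commutator (cartan_element
      c) (M c) * iv A"
    using A by (intro commutator_conjugate[symmetric]) simp
  also have "\<dots> = 2 *\<^sub>R M c"
    using commutator_cartan[OF c c] root_coroot[OF c] Ac by simp
  finally have "(2 * y (- c)) *\<^sub>R M c = 2 *\<^sub>R M c"
    unfolding AH Ac using commutator_cartan[OF c c] root_coroot[OF c]
    by (simp add: commutator_add_left commutator_scaleR commutator_self mult.commute)
  then have "y (- c) = 1" using M_nonzero[OF c] by simp
  with AH show ?thesis by (auto simp: add.commute)
qed

text \<open>The conditions on \<open>A\<close> cannot distinguish a root element from its product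
  with an element centralizing all root vectors; the commutator with \<open>B\<close> removes that
  ambiguity.\<close>

lemma root_subgroup_characterization:
  assumes c: "c \<in> Phi"
  shows "(\<exists>t. C = unipotent c t) \<longleftrightarrow>
    (\<exists>A\<in>H. \<exists>B\<in>H. A * unipotent c 1 = unipotent c 1 * A \<and>
      (\<forall>a\<in>Phi. \<exists>D\<in>H. A * D = D * A \<and> scales D (relative_weight c a)) \<and>
      scales B (\<lambda>d. cartan_integer d c) \<and> C = B * A * iv B * iv A)" (is "?L \<longleftrightarrow> ?R")
proof
  assume ?L
  then obtain t where t: "C = unipotent c t" ..
  \<comment> \<open>The torus element \<open>B\<close> multiplies the parameter by 4, so its
    commutator with \<open>unipotent c s\<close> is \<open>unipotent c (3 * s)\<close>.\<close>
  define A where "A = unipotent c (t / 3)"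
  define B where "B = torus c (ln 2)"
  have AB: "A \<in> H" "B \<in> H" using c by (simp_all add: A_def B_def unipotent_in_H torus_in_H)
  have "\<exists>D\<in>H. A * D = D * A \<and> scales D (relative_weight c a)" if a: "a \<in> Phi" for a
  proof -
    obtain D where D: "D \<in> H" "scales D (relative_weight c a)" "D * M c * iv D = M c"
      using relative_torus_scales[OF a c] by blast
    have "D * A * iv D = A"
      using unipotent_conjugate[of "iv D" D c 1 c "t / 3"] D by (simp add: A_def)
    then have "D * A * (iv D * D) = A * D" by (metis mult.assoc)
    then show ?thesis using D by (intro bexI[of _ D]) simp_all
  qed
  moreover have "B * A * iv B * iv A = C"
    using torus_unipotent[OF c c, of "ln 2" "t / 3"] c root_coroot[OF c]
    by (simp add: A_def B_def t unipotent_add exp_double mult.commute[of _ 2])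
  ultimately show ?R
    using AB torus_scales[OF c]
    by (intro bexI[of _ A] bexI[of _ B]) (auto simp: A_def B_def unipotent_add add.commute)
next
  assume ?R
  then obtain A B where A: "A \<in> H" "A * unipotent c 1 = unipotent c 1 * A"
    and D: "\<And>a. a \<in> Phi \<Longrightarrow> \<exists>D\<in>H. A * D = D * A \<and> scales D (relative_weight c a)"
    and B: "B \<in> H" "scales B (\<lambda>d. cartan_integer d c)" and C: "C = B * A * iv B * iv A"
    by blast
  have "A * M c * iv A = M c"
    by (rule M_commutes_of_unipotent[OF c _ _ A(2)]) (simp_all add: A(1))
  from conjugate_cartan_of_commuting[OF A(1) c this D]
  obtain p where p: "A * cartan_element c * iv A = cartan_element c + p *\<^sub>R M c" by blast
  define T where "T = torus c (ln 2)"
  have T: "T \<in> H" "iv T = torus c (- ln 2)" using c by (simp_all add: T_def torus_in_H)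
  \<comment> \<open>The scaling equations determine \<open>B\<close> only up to a factor
    \<open>z\<close> that commutes with all root vectors; \<open>centralizer_central\<close> lets it
    pass through \<open>A\<close>.\<close>
  define z where "z = iv T * B"
  have z: "z \<in> H" "B = T * z" using T(1) B(1) by (simp_all add: z_def H_mult flip: mult.assoc)
  have "z * M d = M d * z" if d: "d \<in> Phi" for d
  proof -
    have "B * M d * iv B = T * M d * iv T"
      using B torus_scales[OF c] d by (simp add: scales_iff T_def torus_in_H[OF c] del: iv_torus)
    then have "iv T * (B * M d * iv B) * B = iv T * (T * M d * iv T) * B" by simp
    moreover have "iv T * (B * M d * iv B) * B = iv T * B * M d * (iv B * B)"
      "iv T * (T * M d * iv T) * B = (iv T * T) * M d * (iv T * B)" by (simp_all add: mult.assoc)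
    ultimately show ?thesis using B(1) T(1) by (simp add: z_def)
  qed
  then have zA: "z * A = A * z" by (rule centralizer_central[OF A(1)])
  have "iv B = iv z * iv T" using inv_mult_group[of T z] z T(1) by simp
  then have "B * A * iv B = T * (z * A) * iv z * iv T" by (simp add: z(2) mult.assoc)
  also have "\<dots> = T * A * (z * iv z) * iv T" by (simp add: zA mult.assoc)
  finally have "C = T * (A * iv T * iv A)" using z by (simp add: C mult.assoc)
  also have "A * iv T * iv A = exp (A * (- ln 2 *\<^sub>R cartan_element c) * iv A)"
    unfolding T(2) unfolding torus_def using A(1) by (intro exp_conjugate) simp_all
  also have "A * (- ln 2 *\<^sub>R cartan_element c) * iv A = - ln 2 *\<^sub>R (A * cartan_element c * iv A)"
      by simp
  \<comment> \<open>On \<open>cartan_element c\<close> the action of \<open>A\<close> is that of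
    \<open>unipotent c (- p / 2)\<close>, so the commutator can be computed as if \<open>A\<close>
    were this root element.\<close>
  also have "A * cartan_element c * iv A = unipotent c (- p / 2) * cartan_element c * unipotent c
      (- (- p / 2))"
    unfolding unipotent_conjugate_cartan[OF c] p by simp
  also have "- ln 2 *\<^sub>R (unipotent c (- p / 2) * cartan_element c * unipotent c (- (- p / 2))) =
      unipotent c (- p / 2) * (- ln 2 *\<^sub>R cartan_element c) * unipotent c (- (- p / 2))" by simp
  also have "exp \<dots> = unipotent c (- p / 2) * torus c (- ln 2) * unipotent c (- (- p / 2))"
    unfolding torus_def by (rule exp_conjugate[symmetric, OF unipotent_inverse(2,1)])
  finally have "C = T * unipotent c (- p / 2) * torus c (- ln 2) * unipotent c (p / 2)"
    by (simp add: mult.assoc)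
  also have "T * unipotent c (- p / 2) * torus c (- ln 2) = unipotent c (exp (ln 2 * (c \<bullet> coroot
      c)) * (- p / 2))"
    unfolding T_def by (rule torus_unipotent[OF c c])
  finally show ?L by (auto simp: unipotent_add)
qed

end

section \<open>The field structure on a root subgroup\<close>

locale chevalley_coefficients = chevalley_points Phi M H
  for Phi :: "'e::euclidean_space set" and M :: "'e \<Rightarrow> 'a::{real_normed_algebra_1,banach}"
    and H :: "'a set" +
  fixes cs :: "'a list"
  assumes cs_in_H: "set cs \<subseteq> H"
    and unipotent_coeff: "a \<in> Phi \<Longrightarrow> unipotent a 1 \<in> set cs"
begin

sublocale group_with_coefficients G cs
  by unfold_locales (simp add: cs_in_H)

lemma term_mult: "group_term T \<Longrightarrow> group_term U \<Longrightarrow> group_term (\<lambda>\<sigma>. T \<sigma> * U \<sigma>)"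
  and term_one: "group_term (\<lambda>\<sigma>. 1)"
  using group_term_mult[of T U] group_term_one by simp_all

lemma term_power: "group_term T \<Longrightarrow> group_term (\<lambda>\<sigma>. T \<sigma> ^ n)"
  using group_term_pow[of T n] by (simp add: pow_eq)

lemma term_unipotent: "a \<in> Phi \<Longrightarrow> group_term (\<lambda>\<sigma>. unipotent a 1)"
  by (rule group_term_coeff[OF unipotent_coeff])

lemma diophantine_ex_H:
  "diophantine (\<lambda>\<sigma>. R (\<sigma> 0) (\<lambda>i. \<sigma> (Suc i))) \<Longrightarrow> diophantine (\<lambda>\<sigma>. \<exists>b\<in>H. R b \<sigma>)"
  using diophantine_ex by simp

lemmas terms = group_term_var group_term_inv term_mult term_one term_power term_unipotent

lemma diophantine_scales: "group_term T \<Longrightarrow> diophantine (\<lambda>\<sigma>. scales (T \<sigma>) k)"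
  unfolding scales_def by (intro diophantine_ball finite_roots diophantine_eq terms)

lemma diophantine_unipotent:
  assumes "c \<in> Phi" "group_term T"
  shows "diophantine (\<lambda>\<sigma>. \<exists>t. T \<sigma> = unipotent c t)"
proof -
  have "diophantine (\<lambda>\<sigma>. \<exists>t. \<sigma> 0 = unipotent c t)"
    unfolding root_subgroup_characterization[OF assms(1)]
    by (intro diophantine_ex_H diophantine_conj diophantine_ball finite_roots diophantine_eq
        diophantine_scales terms assms(1))
  from diophantine_subst1[OF this assms(2)] show ?thesis .
qed

section \<open>Multiplication and powers of parameters\<close>

definition product_relation :: "'e \<Rightarrow> 'a \<Rightarrow> 'a \<Rightarrow> 'a \<Rightarrow> bool" where
  "product_relation c A B C \<longleftrightarrow>
    (\<exists>s t. A = unipotent c s \<and> B = unipotent c t \<and> C = unipotent c (s * t))"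

lemma product_relation_unipotent:
  "u = s * t \<Longrightarrow> product_relation c (unipotent c s) (unipotent c t) (unipotent c u)"
  unfolding product_relation_def by blast

text \<open>An element that conjugates \<open>x\<^sub>c(1)\<close> to \<open>x\<^sub>c(u)\<close> multiplies the parameter by \<open>u\<close>; the torus
  provides such an element for every \<open>u > 0\<close>.\<close>

lemma product_relation_iff:
  assumes c: "c \<in> Phi"
  shows "product_relation c A B C \<longleftrightarrow> (\<exists>t. B = unipotent c t) \<and>
    (\<exists>D\<in>H. \<exists>E\<in>H. (\<exists>u. D * unipotent c 1 * iv D = unipotent c u) \<and>
      (\<exists>v. E * unipotent c 1 * iv E = unipotent c v) \<and>
      A = (D * unipotent c 1 * iv D) * iv (E * unipotent c 1 * iv E) \<and>
      C = (D * B * iv D) * iv (E * B * iv E))" (is "_ \<longleftrightarrow> ?R")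
proof
  assume "product_relation c A B C"
  then obtain s t where st: "A = unipotent c s" "B = unipotent c t" "C = unipotent c (s * t)"
    unfolding product_relation_def by blast
  have tor: "torus c (ln u / 2) * unipotent c y * iv (torus c (ln u / 2)) = unipotent c (u * y)"
    if "u > 0" for u y
    using torus_unipotent[OF c c, of "ln u / 2" y] root_coroot[OF c] that c by simp
  \<comment> \<open>The torus realizes only positive multipliers, so \<open>s\<close> is written as
    a difference of two positive numbers.\<close>
  define u v where "u = \<bar>s\<bar> + 1" and "v = \<bar>s\<bar> + 1 - s"
  have uv: "u > 0" "v > 0" "s = u - v" by (simp_all add: u_def v_def)
  define D where "D = torus c (ln u / 2)"
  define E where "E = torus c (ln v / 2)"
  have DE: "D \<in> H" "E \<in> H" "D * unipotent c y * iv D = unipotent c (u * y)"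
    "E * unipotent c y * iv E = unipotent c (v * y)" for y
    unfolding D_def E_def using c uv tor torus_in_H by blast+
  have "A = (D * unipotent c 1 * iv D) * iv (E * unipotent c 1 * iv E)"
    "C = (D * B * iv D) * iv (E * B * iv E)"
    unfolding st DE using c by (simp_all add: unipotent_add uv(3) left_diff_distrib)
  then show ?R using DE st(2) by blast
next
  assume ?R
  then obtain t D E u v where B: "B = unipotent c t" and D: "D \<in> H" "D * unipotent c 1 * iv D =
      unipotent c u"
    and E: "E \<in> H" "E * unipotent c 1 * iv E = unipotent c v"
    and A: "A = unipotent c u * iv (unipotent c v)" and C: "C = (D * B * iv D) * iv (E * B * iv E)"
    by auto
  have "D * B * iv D = unipotent c (u * t)" "E * B * iv E = unipotent c (v * t)"
    unfolding B using M_conjugate_of_unipotent[OF c c] D E by simp_all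
  then show "product_relation c A B C"
    unfolding product_relation_def using c
    by (intro exI[of _ "u - v"] exI[of _ t]) (simp add: A B C unipotent_add left_diff_distrib)
qed

lemma diophantine_product:
  assumes "c \<in> Phi" "group_term T" "group_term U" "group_term V"
  shows "diophantine (\<lambda>\<sigma>. product_relation c (T \<sigma>) (U \<sigma>) (V \<sigma>))"
proof -
  have "diophantine (\<lambda>\<sigma>. product_relation c (\<sigma> 0) (\<sigma> 1) (\<sigma> 2))"
    unfolding product_relation_iff[OF assms(1)]
    by (intro diophantine_ex_H diophantine_conj diophantine_eq diophantine_unipotent terms assms(1))
  from diophantine_subst3[OF this assms(2-)] show ?thesis .
qed

definition power_relation :: "'e \<Rightarrow> nat \<Rightarrow> 'a \<Rightarrow> 'a \<Rightarrow> bool" where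
  "power_relation c n A B \<longleftrightarrow> (\<exists>t. A = unipotent c t \<and> B = unipotent c (t ^ n))"

lemma diophantine_power:
  assumes c: "c \<in> Phi" and "group_term T" "group_term U"
  shows "diophantine (\<lambda>\<sigma>. power_relation c n (T \<sigma>) (U \<sigma>))"
proof -
  have "diophantine (\<lambda>\<sigma>. power_relation c n (\<sigma> 0) (\<sigma> 1))"
  proof (induction n)
    case 0
    have "power_relation c 0 A B \<longleftrightarrow> (\<exists>t. A = unipotent c t) \<and> B = unipotent c 1" for A B
      by (auto simp: power_relation_def)
    then show ?case
      by (simp only:) (intro diophantine_conj diophantine_unipotent diophantine_eq terms c)
  next
    case (Suc n)
    have *: "power_relation c (Suc n) A B \<longleftrightarrow>
        (\<exists>C\<in>H. power_relation c n A C \<and> product_relation c A C B)" for A B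
      using unipotent_in_H[OF c] unipotent_inj[OF c]
      by (auto simp: power_relation_def product_relation_def)
    show ?case
      unfolding * by (intro diophantine_ex_H diophantine_conj diophantine_product terms c
        diophantine_subst2[OF Suc])
  qed
  from diophantine_subst2[OF this assms(2-)] show ?thesis .
qed

section \<open>Identifying the parameters of different root subgroups\<close>

definition linked :: "'e \<Rightarrow> 'e \<Rightarrow> bool" where
  "linked c d \<longleftrightarrow> diophantine (\<lambda>\<sigma>. \<exists>t. \<sigma> 0 = unipotent c t \<and> \<sigma> 1 = unipotent d t)"

lemma diophantine_linked:
  assumes "linked c d" "group_term T" "group_term U"
  shows "diophantine (\<lambda>\<sigma>. \<exists>t. T \<sigma> = unipotent c t \<and> U \<sigma> = unipotent d t)"
  using diophantine_subst2[OF assms(1)[unfolded linked_def] assms(2,3)] .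

lemma linked_refl:
  assumes "c \<in> Phi" shows "linked c c"
proof -
  have *: "(\<exists>t. A = unipotent c t \<and> B = unipotent c t) \<longleftrightarrow> (\<exists>t. A = unipotent c t) \<and> A = B" for A B
    by auto
  show ?thesis
    unfolding linked_def * by (intro diophantine_conj diophantine_unipotent diophantine_eq terms
        assms)
qed

lemma linked_trans:
  assumes "d \<in> Phi" "linked c d" "linked d e" shows "linked c e"
proof -
  have *: "(\<exists>t. A = unipotent c t \<and> B = unipotent e t) \<longleftrightarrow>
      (\<exists>C\<in>H. (\<exists>t. A = unipotent c t \<and> C = unipotent d t) \<and> (\<exists>t. C = unipotent d t \<and> B = unipotent
          e t))"
    for A B
    using unipotent_in_H[OF assms(1)] unipotent_inj[OF assms(1)] by auto
  show ?thesis
    unfolding linked_def *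
    by (intro diophantine_ex_H diophantine_conj diophantine_linked assms(2,3) terms)
qed

text \<open>For \<open>S = x_c(s)\<close> and \<open>P = x_c(1/s)\<close> this is the formula of
  \<open>torus_eq_unipotents\<close>. The factor for the root \<open>- c\<close> is produced by a
  Weyl conjugation, so both inputs lie in the root subgroup of \<open>c\<close>.\<close>

definition torus_word :: "'e \<Rightarrow> 'a \<Rightarrow> 'a \<Rightarrow> 'a" where
  "torus_word c S P = S * (weyl c * P * weyl_inv c) * S * weyl_inv c"

lemma term_weyl:
  assumes "c \<in> Phi"
  shows "group_term (\<lambda>\<sigma>. weyl c)" "group_term (\<lambda>\<sigma>. weyl_inv c)"
proof -
  have "weyl c = unipotent c 1 * iv (unipotent (- c) 1) * unipotent c 1"
    "weyl_inv c = iv (unipotent c 1) * unipotent (- c) 1 * iv (unipotent c 1)"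
    using assms uminus_root by (simp_all add: weyl_def weyl_inv_def)
  then show "group_term (\<lambda>\<sigma>. weyl c)" "group_term (\<lambda>\<sigma>. weyl_inv c)"
    by (simp_all only:) (intro terms assms uminus_root)+
qed

lemma torus_word_eq:
  assumes "c \<in> Phi" "s > 0"
  shows "torus_word c (unipotent c s) (unipotent c (1 / s)) = torus c (ln s)"
proof -
  have "weyl c * M c * weyl_inv c = (- 1) *\<^sub>R M (- c)" using weyl_conjugate_M[OF assms(1)] by simp
  from unipotent_conjugate[OF weyl_inverse(2,1) this] show ?thesis
    by (simp add: torus_word_def torus_eq_unipotents[OF assms])
qed

text \<open>The torus element with parameter \<open>s > 0\<close>, built from \<open>x\<^sub>c(s)\<close>, conjugates \<open>x\<^sub>d(1)\<close> to
  \<open>x\<^sub>d(s\<^sup>m)\<close> with \<open>m = \<langle>d, c\<^sup>\<or>\<rangle> \<noteq> 0\<close>, and positive reals are determined by their \<open>m\<close>-th powers.\<close>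

lemma linked_positive:
  assumes c: "c \<in> Phi" and d: "d \<in> Phi" and m: "cartan_integer d c \<noteq> 0"
  shows "diophantine (\<lambda>\<sigma>. \<exists>s>0. \<sigma> 0 = unipotent c s \<and> \<sigma> 1 = unipotent d s)"
proof -
  define n where "n = nat \<bar>cartan_integer d c\<bar>"
  \<comment> \<open>If the pairing is negative, the inverse torus element is taken, so that the
    exponent is the positive number \<open>n\<close>.\<close>
  define h where "h S P = (if cartan_integer d c > 0 then torus_word c S P else iv (torus_word c S
      P))"
    for S P
  have n: "n > 0" using m by (simp add: n_def)
  have h_conj: "h (unipotent c s) (unipotent c (1 / s)) * unipotent d 1 *
      iv (h (unipotent c s) (unipotent c (1 / s))) = unipotent d (s ^ n)" if s: "s > 0" for s
  proof -
    have "h (unipotent c s) (unipotent c (1 / s)) = torus c (sgn (cartan_integer d c) * ln s)"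
      using m c by (auto simp: h_def torus_word_eq[OF c s] sgn_if)
    moreover have "exp (sgn (cartan_integer d c) * ln s * (d \<bullet> coroot c)) = s ^ n"
    proof -
      have "of_int (sgn (cartan_integer d c)) * (d \<bullet> coroot c) = real n"
        using m by (simp add: cartan_integer[OF c d] n_def sgn_if)
      then have eq: "sgn (cartan_integer d c) * ln s * (d \<bullet> coroot c) = real n * ln s"
        by (metis mult.assoc mult.commute)
      show ?thesis unfolding eq using s by (simp add: exp_of_nat_mult)
    qed
    ultimately show ?thesis
      using torus_unipotent[OF c d, of "sgn (cartan_integer d c) * ln s" 1] c by simp
  qed
  \<comment> \<open>\<open>Q\<close> makes the parameter of \<open>S\<close> a square, and
    \<open>P\<close> makes it invertible, hence positive. \<open>R\<close> makes the parameter of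
    \<open>D\<close> a nonnegative number, which is then determined by its \<open>n\<close>-th
    power.\<close>
  have iff: "(\<exists>s>0. S = unipotent c s \<and> D = unipotent d s) \<longleftrightarrow>
      (\<exists>Q\<in>H. \<exists>P\<in>H. \<exists>R\<in>H. product_relation c Q Q S \<and> product_relation c S P (unipotent c 1) \<and>
        product_relation d R R D \<and> power_relation d n D (h S P * unipotent d 1 * iv (h S P)))"
    (is "?L \<longleftrightarrow> ?R") for S D
  proof
    assume ?L
    then obtain s where s: "s > 0" "S = unipotent c s" "D = unipotent d s" by blast
    have "product_relation c (unipotent c (sqrt s)) (unipotent c (sqrt s)) S"
      "product_relation d (unipotent d (sqrt s)) (unipotent d (sqrt s)) D"
      unfolding s(2,3) using s(1) by (intro product_relation_unipotent; simp)+
    moreover have "product_relation c S (unipotent c (1 / s)) (unipotent c 1)"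
      unfolding s(2) using s(1) by (intro product_relation_unipotent) simp
    moreover have "power_relation d n D (h S (unipotent c (1 / s)) * unipotent d 1 *
        iv (h S (unipotent c (1 / s))))"
      unfolding power_relation_def s(2) h_conj[OF s(1)] using s(3) by blast
    ultimately show ?R using unipotent_in_H c d by blast
  next
    assume ?R
    then obtain Q P R where PR: "product_relation c Q Q S" "product_relation c S P (unipotent c 1)"
      "product_relation d R R D" "power_relation d n D (h S P * unipotent d 1 * iv (h S P))"
      by blast
    obtain q where q: "S = unipotent c (q * q)"
      using PR(1) unipotent_inj[OF c] unfolding product_relation_def by metis
    obtain p where p: "P = unipotent c p" "q * q * p = 1"
      using PR(2) q unipotent_inj[OF c] unfolding product_relation_def by metis
    obtain r where r: "D = unipotent d (r * r)"
      using PR(3) unipotent_inj[OF d] unfolding product_relation_def by metis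
    have pos: "q * q > 0" using p(2) by (metis mult_zero_left not_real_square_gt_zero zero_neq_one)
    then have "p = 1 / (q * q)" using p(2) pos
      by (metis less_irrefl mult.commute nonzero_eq_divide_eq)
    then have "power_relation d n D (unipotent d ((q * q) ^ n))"
      using PR(4) h_conj[OF pos] by (simp add: p(1) q)
    then have "(r * r) ^ n = (q * q) ^ n"
      using unipotent_inj[OF d] unfolding power_relation_def r by metis
    then have "r * r = q * q" using n pos by (simp add: power_eq_iff_eq_base)
    with q r pos show ?L by auto
  qed
  have h_term: "group_term (\<lambda>\<sigma>. h (T \<sigma>) (U \<sigma>))" if "group_term T" "group_term U" for T U
  proof -
    have "group_term (\<lambda>\<sigma>. torus_word c (T \<sigma>) (U \<sigma>))"
      unfolding torus_word_def by (intro terms term_weyl[OF c] that)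
    from this group_term_inv[OF this] show ?thesis
      unfolding h_def by (cases "cartan_integer d c > 0") simp_all
  qed
  show ?thesis
    unfolding iff
    by (intro diophantine_ex_H diophantine_conj diophantine_product diophantine_power c d terms
        h_term)
qed

text \<open>Differences of positive parameters, formed simultaneously for both roots, extend the
  identification from positive numbers to all reals.\<close>

lemma linked_if_not_orthogonal:
  assumes c: "c \<in> Phi" and d: "d \<in> Phi" and "c \<bullet> d \<noteq> 0"
  shows "linked c d"
proof -
  have "c \<bullet> c \<noteq> 0" using c zero_not_root by auto
  then have "d \<bullet> coroot c \<noteq> 0" using assms(3) by (simp add: coroot_def inner_commute)
  then have m: "cartan_integer d c \<noteq> 0" using cartan_integer[OF c d] by auto
  have iff: "(\<exists>t. A = unipotent c t \<and> B = unipotent d t) \<longleftrightarrow>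
      (\<exists>S\<in>H. \<exists>U\<in>H. \<exists>D\<in>H. \<exists>E\<in>H. (\<exists>s>0. S = unipotent c s \<and> D = unipotent d s) \<and>
        (\<exists>s>0. U = unipotent c s \<and> E = unipotent d s) \<and> A = S * iv U \<and> B = D * iv E)"
    (is "?L \<longleftrightarrow> ?R") for A B
  proof
    assume ?L
    then obtain t where t: "A = unipotent c t" "B = unipotent d t" by blast
    define u v where "u = \<bar>t\<bar> + 1" and "v = \<bar>t\<bar> + 1 - t"
    have "u > 0" "v > 0" "t = u - v" by (simp_all add: u_def v_def)
    then show ?R
      using t c d unipotent_in_H
      by (intro bexI[of _ "unipotent c u"] bexI[of _ "unipotent c v"] bexI[of _ "unipotent d u"]
          bexI[of _ "unipotent d v"]) (auto simp: unipotent_add)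
  next
    assume ?R
    then obtain s u where "A = unipotent c s * iv (unipotent c u)" "B = unipotent d s * iv
        (unipotent d u)"
      by blast
    then show ?L using c d by (auto simp: unipotent_add)
  qed
  show ?thesis
    unfolding linked_def iff
    by (intro diophantine_ex_H diophantine_conj diophantine_eq terms
        diophantine_subst2[OF linked_positive[OF c d m]])
qed

text \<open>By transitivity the roots linked to \<open>c\<close> are orthogonal to all others, so an
  unlinked root would decompose the root system.\<close>

lemma linked_if_indecomposable:
  assumes "indecomposable Phi" "c \<in> Phi" "d \<in> Phi"
  shows "linked c d"
proof (rule ccontr)
  assume "\<not> linked c d"
  define A where "A = {e \<in> Phi. linked c e}"
  have "c \<in> A" "d \<in> Phi - A" using assms \<open>\<not> linked c d\<close> by (auto simp: A_def linked_refl)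
  moreover have "a \<bullet> b = 0" if "a \<in> A" "b \<in> Phi - A" for a b
    using that linked_trans[of a c b] linked_if_not_orthogonal[of a b] by (auto simp: A_def)
  moreover have "A \<subseteq> Phi" by (auto simp: A_def)
  ultimately show False
    using assms(1) unfolding indecomposable_def by (metis Diff_disjoint Un_Diff_cancel empty_iff
        sup.absorb2)
qed

end

section \<open>Matrix entries\<close>

context chevalley_coefficients
begin

text \<open>\<open>definable r Q f\<close>: the graph of the real function \<open>f\<close> on the relation \<open>Q\<close> is Diophantine, where
  the real number \<open>t\<close> is represented by \<open>x\<^sub>r(t)\<close>. Variable \<open>0\<close> is the value, the arguments follow.\<close>

definition definable :: "'e \<Rightarrow> ((nat \<Rightarrow> 'a) \<Rightarrow> bool) \<Rightarrow> ((nat \<Rightarrow> 'a) \<Rightarrow> real) \<Rightarrow> bool" where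
  "definable r Q f \<longleftrightarrow>
    diophantine (\<lambda>\<sigma>. Q (\<lambda>i. \<sigma> (Suc i)) \<and> \<sigma> 0 = unipotent r (f (\<lambda>i. \<sigma> (Suc i))))"

lemma definable_subst:
  assumes "definable r Q f" "group_term T" "\<And>i. group_term (U i)"
  shows "diophantine (\<lambda>\<sigma>. Q (\<lambda>i. U i \<sigma>) \<and> T \<sigma> = unipotent r (f (\<lambda>i. U i \<sigma>)))"
  using diophantine_subst[OF assms(1)[unfolded definable_def], of "case_nat T U"] assms(2,3)
  by (simp split: nat.split)

lemma definable_rename:
  "definable r Q f \<Longrightarrow> definable r (\<lambda>\<sigma>. Q (\<lambda>i. \<sigma> (\<pi> i))) (\<lambda>\<sigma>. f (\<lambda>i. \<sigma> (\<pi> i)))"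
  unfolding definable_def[of r "\<lambda>\<sigma>. Q (\<lambda>i. \<sigma> (\<pi> i))"] by (intro definable_subst terms)

lemma definable_restrict:
  assumes "definable r Q f" "diophantine P"
  shows "definable r (\<lambda>\<sigma>. Q \<sigma> \<and> P \<sigma>) f"
proof -
  have "diophantine (\<lambda>\<sigma>. P (\<lambda>i. \<sigma> (Suc i)))"
    by (rule diophantine_subst[OF assms(2)]) (rule terms)
  from diophantine_conj[OF this assms(1)[unfolded definable_def]] show ?thesis
    unfolding definable_def by (rule diophantine_cong) auto
qed

lemma definable_const:
  assumes "diophantine Q" "group_term (\<lambda>\<sigma>. unipotent r c)"
  shows "definable r Q (\<lambda>\<sigma>. c)"
  unfolding definable_def
  by (intro diophantine_conj diophantine_eq diophantine_subst[OF assms(1)] terms assms(2))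

lemma definable_add:
  assumes r: "r \<in> Phi" and "definable r Q f" "definable r Q g"
  shows "definable r Q (\<lambda>\<sigma>. f \<sigma> + g \<sigma>)"
proof -
  have iff: "Q \<sigma> \<and> A = unipotent r (f \<sigma> + g \<sigma>) \<longleftrightarrow>
      (\<exists>B\<in>H. \<exists>C\<in>H. (Q \<sigma> \<and> B = unipotent r (f \<sigma>)) \<and> (Q \<sigma> \<and> C = unipotent r (g \<sigma>)) \<and> A = B * C)"
    for A \<sigma> using unipotent_in_H[OF r] by (auto simp: unipotent_add)
  show ?thesis
    unfolding definable_def iff
    by (intro diophantine_ex_H diophantine_conj diophantine_eq definable_subst assms(2,3) terms)
qed

lemma definable_uminus:
  assumes r: "r \<in> Phi" and "definable r Q f"
  shows "definable r Q (\<lambda>\<sigma>. - f \<sigma>)"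
proof -
  have iff: "Q \<sigma> \<and> A = unipotent r (- f \<sigma>) \<longleftrightarrow>
      (\<exists>B\<in>H. (Q \<sigma> \<and> B = unipotent r (f \<sigma>)) \<and> A = iv B)"
    for A \<sigma> using unipotent_in_H[OF r] r by auto
  show ?thesis
    unfolding definable_def iff
    by (intro diophantine_ex_H diophantine_conj diophantine_eq definable_subst assms(2) terms)
qed

lemma definable_mult:
  assumes r: "r \<in> Phi" and "definable r Q f" "definable r Q g"
  shows "definable r Q (\<lambda>\<sigma>. f \<sigma> * g \<sigma>)"
proof -
  have iff: "Q \<sigma> \<and> A = unipotent r (f \<sigma> * g \<sigma>) \<longleftrightarrow>
      (\<exists>B\<in>H. \<exists>C\<in>H. (Q \<sigma> \<and> B = unipotent r (f \<sigma>)) \<and> (Q \<sigma> \<and> C = unipotent r (g \<sigma>)) \<and>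
        product_relation r B C A)"
    for A \<sigma> using unipotent_in_H[OF r] unipotent_inj[OF r] by (auto simp: product_relation_def)
  show ?thesis
    unfolding definable_def iff
    by (intro diophantine_ex_H diophantine_conj diophantine_product definable_subst assms terms)
qed

lemma definable_of_nat:
  assumes "r \<in> Phi" "diophantine Q"
  shows "definable r Q (\<lambda>\<sigma>. real n)"
proof (induction n)
  case 0
  show ?case using definable_const[OF assms(2), of r 0] term_one by simp
next
  case (Suc n)
  then show ?case
    using definable_add[OF assms(1) definable_const[OF assms(2) term_unipotent[OF assms(1)]] Suc]
    by simp
qed

lemma definable_Ints:
  assumes "r \<in> Phi" "diophantine Q" "c \<in> \<int>"
  shows "definable r Q (\<lambda>\<sigma>. c)"
proof -
  obtain k :: int where k: "c = of_int k" using assms(3) by (rule Ints_cases)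
  show ?thesis
  proof (cases "k \<ge> 0")
    case True
    then show ?thesis using definable_of_nat[OF assms(1,2), of "nat k"] by (simp add: k)
  next
    case False
    then show ?thesis
      using definable_uminus[OF assms(1) definable_of_nat[OF assms(1,2), of "nat (- k)"]] by (simp
          add: k)
  qed
qed

lemma definable_sum:
  assumes "r \<in> Phi" "diophantine Q" "finite S" "\<And>s. s \<in> S \<Longrightarrow> definable r Q (f s)"
  shows "definable r Q (\<lambda>\<sigma>. \<Sum>s\<in>S. f s \<sigma>)"
  using assms(3,4)
proof (induction S rule: finite_induct)
  case empty
  show ?case using definable_Ints[OF assms(1,2), of 0] by simp
next
  case (insert s S)
  then show ?case using definable_add[OF assms(1), of Q "f s" "\<lambda>\<sigma>. \<Sum>s\<in>S. f s \<sigma>"] by simp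
qed

lemma definable_power:
  assumes "r \<in> Phi" "diophantine Q" "definable r Q f"
  shows "definable r Q (\<lambda>\<sigma>. f \<sigma> ^ n)"
proof (induction n)
  case 0
  show ?case using definable_Ints[OF assms(1,2), of 1] by simp
next
  case (Suc n)
  from definable_mult[OF assms(1,3) Suc] show ?case by simp
qed

text \<open>Fixing the list of roots bounds the number of factors and leaves only the parameters
  existential, which makes the condition Diophantine.\<close>

fun root_product :: "'e list \<Rightarrow> 'a \<Rightarrow> bool" where
  "root_product [] A \<longleftrightarrow> A = 1"
| "root_product (b # L) A \<longleftrightarrow>
    (\<exists>B\<in>H. \<exists>C\<in>H. A = B * C \<and> (\<exists>t. B = unipotent b t) \<and> root_product L C)"

lemma diophantine_root_product:
  "set L \<subseteq> Phi \<Longrightarrow> group_term T \<Longrightarrow> diophantine (\<lambda>\<sigma>. root_product L (T \<sigma>))"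
proof (induction L arbitrary: T)
  case Nil
  then show ?case by (simp add: diophantine_eq terms)
next
  case (Cons b L)
  have "diophantine (\<lambda>\<sigma>. root_product (b # L) (\<sigma> 0))"
    unfolding root_product.simps using Cons.prems(1)
    by (intro diophantine_ex_H diophantine_conj diophantine_eq diophantine_unipotent terms
        Cons.IH) auto
  from diophantine_subst1[OF this Cons.prems(2)] show ?case .
qed

lemma root_product_unipotent: "b \<in> Phi \<Longrightarrow> root_product [b] (unipotent b t)"
  using H_one unipotent_in_H by force

lemma root_product_mult:
  "root_product L A \<Longrightarrow> root_product L' B \<Longrightarrow> B \<in> H \<Longrightarrow> root_product (L @ L') (A * B)"
proof (induction L arbitrary: A)
  case (Cons b L)
  then obtain C D where CD: "C \<in> H" "D \<in> H" "A = C * D" "\<exists>t. C = unipotent b t" "root_product L D"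
    by auto
  have "root_product (L @ L') (D * B)" by (rule Cons.IH[OF CD(5) Cons.prems(2,3)])
  moreover have "A * B = C * (D * B)" "D * B \<in> H" using CD(2,3) Cons.prems(3) by (simp_all add:
      mult.assoc H_mult)
  ultimately show ?case using CD(1,4) by (simp only: append_Cons root_product.simps) blast
qed simp

end

section \<open>Definability of matrix entries and comparison with rationals\<close>

locale integral_chevalley_coefficients = chevalley_coefficients Phi M H cs
  for Phi :: "'e::euclidean_space set" and M :: "'e \<Rightarrow> (real, 'n::finite) sqmat" and H cs +
  assumes integral: "a \<in> Phi \<Longrightarrow> entry i j (M a ^ k) / fact k \<in> \<int>"
    and indecomposable: "indecomposable Phi"
begin

text \<open>Linking carries the parameter of \<open>b\<close> to the root \<open>r\<close>. The
  entry is a polynomial in this parameter, by nilpotency, and its coefficients are entries of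
  divided powers, hence integers.\<close>

lemma definable_entry_unipotent:
  assumes r: "r \<in> Phi" and b: "b \<in> Phi"
  shows "definable r (\<lambda>\<sigma>. \<exists>t. \<sigma> 0 = unipotent b t) (\<lambda>\<sigma>. entry i j (\<sigma> 0))"
proof -
  let ?Q = "\<lambda>\<sigma>. \<exists>t. \<sigma> 0 = unipotent b t"
  obtain K where K: "M b ^ K = 0" using nilpotent[OF b] by blast
  define f where "f A = (THE t. A = unipotent b t)" for A
  have f: "f (unipotent b t) = t" for t using unipotent_inj[OF b] by (simp add: f_def)
  have Q: "diophantine ?Q" by (intro diophantine_unipotent b terms)
  have "definable r ?Q (\<lambda>\<sigma>. f (\<sigma> 0))"
  proof -
    have "diophantine (\<lambda>\<sigma>. \<exists>t. \<sigma> (Suc 0) = unipotent b t \<and> \<sigma> 0 = unipotent r t)"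
      by (intro diophantine_linked linked_if_indecomposable indecomposable r b terms)
    then show ?thesis
      unfolding definable_def by (rule diophantine_cong) (auto simp: f)
  qed
  then have *: "definable r ?Q (\<lambda>\<sigma>. \<Sum>k<K. f (\<sigma> 0) ^ k * (entry i j (M b ^ k) / fact k))"
    by (intro definable_sum definable_mult definable_power definable_Ints r Q integral[OF b]) simp_all
  have "entry i j (unipotent b t) = (\<Sum>k<K. t ^ k * (entry i j (M b ^ k) / fact k))" for t
  proof -
    have "unipotent b t = (\<Sum>k<K. (t *\<^sub>R M b) ^ k /\<^sub>R fact k)"
      unfolding unipotent_def by (rule exp_nilpotent) (simp add: K)
    then show ?thesis by (simp add: entry_sum field_simps)
  qed
  then have eq: "entry i j A = (\<Sum>k<K. f A ^ k * (entry i j (M b ^ k) / fact k))"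
    if "\<exists>t. A = unipotent b t" for A using that f by auto
  show ?thesis
    using *[unfolded definable_def] unfolding definable_def
    by (rule diophantine_cong) (simp add: eq cong: conj_cong)
qed

lemma definable_entry_root_product:
  assumes r: "r \<in> Phi" and "set L \<subseteq> Phi"
  shows "definable r (\<lambda>\<sigma>. root_product L (\<sigma> 0)) (\<lambda>\<sigma>. entry i j (\<sigma> 0))"
  using assms(2)
proof (induction L arbitrary: i j)
  case Nil
  have "diophantine (\<lambda>\<sigma>. root_product [] (\<sigma> 0))"
    by (intro diophantine_root_product terms) simp
  from definable_Ints[OF r this, of "if i = j then 1 else 0"]
  have "definable r (\<lambda>\<sigma>. root_product [] (\<sigma> 0)) (\<lambda>\<sigma>. if i = j then 1 else 0)" by simp
  then show ?case
    unfolding definable_def by (rule diophantine_cong) (auto simp: entry_one)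
next
  case (Cons b L)
  then have b: "b \<in> Phi" and L: "set L \<subseteq> Phi" by auto
  let ?Q = "\<lambda>\<sigma>. (\<exists>t. \<sigma> 0 = unipotent b t) \<and> root_product L (\<sigma> 1)"
  have B: "definable r ?Q (\<lambda>\<sigma>. entry i k (\<sigma> 0))" for k
    by (intro definable_restrict definable_entry_unipotent diophantine_root_product r b L terms)
  have C: "definable r ?Q (\<lambda>\<sigma>. entry k j (\<sigma> 1))" for k
  proof -
    have "definable r (\<lambda>\<sigma>. root_product L (\<sigma> 1)) (\<lambda>\<sigma>. entry k j (\<sigma> 1))"
      using definable_rename[OF Cons.IH[OF L, of k j], of "\<lambda>i. i + 1"] by simp
    from definable_restrict[OF this diophantine_unipotent[OF b group_term_var[of 0]]]
    show ?thesis by (simp add: conj_commute)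
  qed
  have Q: "diophantine ?Q"
    by (intro diophantine_conj diophantine_unipotent diophantine_root_product b L terms)
  have sum: "definable r ?Q (\<lambda>\<sigma>. \<Sum>k\<in>UNIV. entry i k (\<sigma> 0) * entry k j (\<sigma> 1))"
    by (intro definable_sum definable_mult r Q B C) simp
  have iff: "root_product (b # L) A \<and> Y = unipotent r (entry i j A) \<longleftrightarrow>
      (\<exists>B\<in>H. \<exists>C\<in>H. A = B * C \<and> ((\<exists>t. B = unipotent b t) \<and> root_product L C) \<and>
        Y = unipotent r (\<Sum>k\<in>UNIV. entry i k B * entry k j C))" for A Y
    unfolding entry_mult[symmetric] root_product.simps by blast
  \<comment> \<open>After the two quantifiers of \<open>iff\<close>, variable 0 is \<open>C\<close>,
    variable 1 is \<open>B\<close> and variable 2 is \<open>Y\<close>; the relation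
    \<open>?Q\<close> expects \<open>B\<close> before \<open>C\<close>.\<close>
  have "group_term (\<lambda>\<sigma>. if k = 0 then \<sigma> 1 else \<sigma> 0)" for k :: nat
    by (cases "k = 0") (simp_all add: group_term_var)
  from definable_subst[OF sum group_term_var[of 2], of "\<lambda>k \<sigma>. if k = 0 then \<sigma> 1 else \<sigma> 0", OF this]
  have graph: "diophantine (\<lambda>\<sigma>. ((\<exists>t. \<sigma> (Suc 0) = unipotent b t) \<and> root_product L (\<sigma> 0)) \<and>
      \<sigma> (Suc (Suc 0)) = unipotent r (\<Sum>k\<in>UNIV. entry i k (\<sigma> (Suc 0)) * entry k j (\<sigma> 0)))"
    by (simp add: numeral_2_eq_2)
  show ?case
    unfolding definable_def iff
    by (rule graph diophantine_ex_H diophantine_conj diophantine_eq terms)+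
qed

text \<open>For a fixed entry only one word of the system depends on \<open>N\<close> and
  \<open>m\<close>, so composing the decider with the coding function answers all
  comparisons.\<close>

lemma comparisons_computable:
  assumes r: "r \<in> Phi" and g: "g \<in> set cs" "set L \<subseteq> Phi" "root_product L g"
    and decider: "\<And>S. system_wf (length cs) S \<Longrightarrow>
      rec_eval p [system_code S] (if system_solvable G cs S then 1 else 0)"
  shows "computable_fun 2 (\<lambda>xs. if real (xs ! 1) \<le> real (xs ! 0) * \<bar>entry i j g\<bar> then 1 else 0)"
proof -
  define a where "a = entry i j g"
  have "diophantine (\<lambda>\<sigma>. root_product L g \<and> \<sigma> 0 = unipotent r (entry i j g))"
    using definable_subst[OF definable_entry_root_product[OF r g(2), of i j], of "\<lambda>\<sigma>. \<sigma> 0" "\<lambda>i \<sigma>. g"]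
    by (simp add: group_term_var group_term_coeff[OF g(1)])
  then have entry: "diophantine (\<lambda>\<sigma>. \<sigma> 0 = unipotent r a)" by (simp add: g(3) a_def)
  have inverse: "diophantine (\<lambda>\<sigma>. iv (\<sigma> 0) = unipotent r a)"
    by (rule diophantine_subst1[where P = "\<lambda>A. A = unipotent r a", OF entry]) (intro terms)
  have "iv A = unipotent r a \<longleftrightarrow> A = unipotent r (- a)" if "A \<in> H" for A
    using that r by (metis G_simps(1) inv_inv iv_unipotent minus_minus)
  then have "diophantine (\<lambda>\<sigma>. \<sigma> 0 = unipotent r (- a))"
    by (intro diophantine_cong[OF inverse]) simp
  \<comment> \<open>The sign of the fixed number \<open>a\<close> decides once and for all which of
    the two equations defines the absolute value.\<close>
  with entry have abs: "diophantine (\<lambda>\<sigma>. \<sigma> 0 = unipotent r \<bar>a\<bar>)"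
    by (simp add: abs_if)
  have sq: "diophantine (\<lambda>\<sigma>. \<exists>A\<in>H. product_relation r A A (\<sigma> 1))"
    by (intro diophantine_ex_H diophantine_product r terms)
  obtain l where l: "l < length cs" "cs ! l = unipotent r 1"
    using unipotent_coeff[OF r] by (auto simp: in_set_conv_nth)
  obtain S where S: "system_wf (length cs) S"
    "\<And>w. wf_word w \<Longrightarrow> system_solvable G cs (argument_word w # S) \<longleftrightarrow>
      (\<exists>\<sigma>. env \<sigma> \<and> (\<sigma> 0 = unipotent r \<bar>a\<bar> \<and> (\<exists>A\<in>H. product_relation r A A (\<sigma> 1))) \<and>
        word_val G cs \<sigma> w = \<one>\<^bsub>G\<^esub>)"
    using diophantine_solvable[OF diophantine_conj[OF abs sq]] by blast
  \<comment> \<open>Variable 0 carries the parameter \<open>\<bar>a\<bar>\<close> and variable 1 a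
    square; the word is trivial exactly when \<open>N * \<bar>a\<bar> - m\<close> is that
    square.\<close>
  define w where "w N m = replicate N (Var 0) @ replicate m (CoeffInv l) @ [VarInv 1]" for N m
  have wf_w: "wf_word (w N m)" for N m using l(1) by (auto simp: w_def)
  have argument_w: "argument_word (w N m) = replicate N (Var 0) @ replicate m (CoeffInv l) @
      [VarInv 2]" for N m
    by (simp add: argument_word_def subst_word_def w_def inv_word_def map_replicate_const
        concat_replicate_single)
  have word: "word_val G cs \<sigma> (w N m) = \<one>\<^bsub>G\<^esub> \<longleftrightarrow> real N * \<bar>a\<bar> - real m = v"
    if \<sigma>: "env \<sigma>" "\<sigma> 0 = unipotent r \<bar>a\<bar>" "\<sigma> 1 = unipotent r v" for \<sigma> N m v
  proof -
    have "word_val G cs \<sigma> (replicate m (CoeffInv l) @ [VarInv 1]) = unipotent r (- real m - v)" for m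
      by (induction m) (use r l \<sigma> in \<open>auto simp: unipotent_add algebra_simps\<close>)
    then have "word_val G cs \<sigma> (w N m) = unipotent r (real N * \<bar>a\<bar> - real m - v)"
      unfolding w_def by (induction N) (use r \<sigma> in \<open>auto simp: unipotent_add algebra_simps\<close>)
    then show ?thesis using unipotent_inj[OF r, of _ 0] by auto
  qed
  have solvable: "system_solvable G cs (argument_word (w N m) # S) \<longleftrightarrow> real m \<le> real N * \<bar>a\<bar>" for N m
  proof -
    have "real m \<le> real N * \<bar>a\<bar>" if "system_solvable G cs (argument_word (w N m) # S)"
    proof -
      obtain \<sigma> A where \<sigma>: "env \<sigma>" "\<sigma> 0 = unipotent r \<bar>a\<bar>" "product_relation r A A (\<sigma> 1)"
        "word_val G cs \<sigma> (w N m) = \<one>\<^bsub>G\<^esub>"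
        using \<open>system_solvable G cs (argument_word (w N m) # S)\<close> S(2)[OF wf_w] by auto
      then obtain v where "\<sigma> 1 = unipotent r (v * v)"
        using unipotent_inj[OF r] unfolding product_relation_def by metis
      from word[OF \<sigma>(1,2) this] \<sigma>(4) have "real N * \<bar>a\<bar> - real m = v * v" by blast
      then show ?thesis using zero_le_square[of v] by linarith
    qed
    moreover have "system_solvable G cs (argument_word (w N m) # S)" if le: "real m \<le> real N * \<bar>a\<bar>"
    proof -
      define v where "v = sqrt (real N * \<bar>a\<bar> - real m)"
      have v: "v * v = real N * \<bar>a\<bar> - real m" using le by (simp add: v_def)
      define \<sigma> where "\<sigma> i = (if i = 0 then unipotent r \<bar>a\<bar> else unipotent r (v * v))" for i :: nat
      have "env \<sigma>" "\<sigma> 0 = unipotent r \<bar>a\<bar>" "\<sigma> 1 = unipotent r (v * v)"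
        using unipotent_in_H[OF r] by (simp_all add: \<sigma>_def)
      moreover have "product_relation r (unipotent r v) (unipotent r v) (unipotent r (v * v))"
        by (rule product_relation_unipotent) simp
      ultimately have "env \<sigma> \<and> (\<sigma> 0 = unipotent r \<bar>a\<bar> \<and> (\<exists>A\<in>H. product_relation r A A (\<sigma> 1))) \<and>
          word_val G cs \<sigma> (w N m) = \<one>\<^bsub>G\<^esub>"
        using word[of \<sigma> "v * v" N m] v unipotent_in_H[OF r] by auto
      then show ?thesis using S(2)[OF wf_w] by blast
    qed
    ultimately show ?thesis by blast
  qed
  have wf: "system_wf (length cs) (argument_word (w N m) # S)" for N m
    using S(1) wf_argument_word[OF wf_w] by (simp add: system_wf_def)
  obtain q where q: "\<And>xs. length xs = 2 \<Longrightarrow> rec_eval q xs (system_code (argument_word (w (xs ! 0)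
      (xs ! 1)) # S))"
    using computable_fun_system_code unfolding computable_fun_def argument_w by blast
  show ?thesis
    unfolding a_def[symmetric]
  proof (rule computable_funI[where r = "RComp p [q]"], rule rec_eval.comp)
    fix xs :: "nat list" assume xs: "length xs = 2"
    show "list_all2 (\<lambda>g y. rec_eval g xs y) [q] [system_code (argument_word (w (xs ! 0) (xs ! 1))
        # S)]"
      using q[OF xs] by simp
    show "rec_eval p [system_code (argument_word (w (xs ! 0) (xs ! 1)) # S)] (if real (xs ! 1) \<le>
        real (xs ! 0) * \<bar>a\<bar> then 1 else 0)"
      using decider[OF wf, of "xs ! 0" "xs ! 1"] by (simp only: solvable)
  qed
qed

end

section \<open>Integral linear equations and polynomials in matrix entries\<close>

definition integral_vector :: "'v::euclidean_space \<Rightarrow> bool" where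
  "integral_vector v \<longleftrightarrow> (\<forall>b\<in>Basis. v \<bullet> b \<in> \<int>)"

lemma integral_vector_inner: "integral_vector v \<Longrightarrow> integral_vector w \<Longrightarrow> v \<bullet> w \<in> \<int>"
  by (subst euclidean_inner) (auto simp: integral_vector_def intro: Ints_sum)

lemma integral_vector_Basis: "b \<in> Basis \<Longrightarrow> integral_vector b"
  by (auto simp: integral_vector_def inner_Basis)

lemma integral_vector_combination:
  "c \<in> \<int> \<Longrightarrow> d \<in> \<int> \<Longrightarrow> integral_vector v \<Longrightarrow> integral_vector w \<Longrightarrow> integral_vector (c *\<^sub>R v - d *\<^sub>R w)"
  by (simp add: integral_vector_def inner_diff_left)

text \<open>In the induction step an integral \<open>f\<close> that annihilates \<open>S\<close> but not \<open>w\<close> serves to eliminate \<open>w\<close>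
  from \<open>y\<close> without leaving the integers.\<close>

lemma in_span_if_integral_annihilator_finite:
  assumes "finite S" "\<forall>s\<in>S. integral_vector s"
    and "\<And>f. integral_vector f \<Longrightarrow> (\<And>s. s \<in> S \<Longrightarrow> f \<bullet> s = 0) \<Longrightarrow> f \<bullet> y = 0"
  shows "y \<in> span S"
  using assms
proof (induction S arbitrary: y rule: finite_induct)
  case empty
  have "y \<bullet> b = 0 \<bullet> b" if "b \<in> Basis" for b
    using empty(2)[OF integral_vector_Basis[OF that]] by (simp add: inner_commute)
  then have "y = 0" by (rule euclidean_eqI)
  then show ?case by simp
next
  case (insert w S)
  show ?case
  proof (cases "w \<in> span S")
    case True
    have "f \<bullet> w = 0" if "\<And>s. s \<in> S \<Longrightarrow> f \<bullet> s = 0" for f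
      using orthogonal_to_span[OF True, of f] that by (simp add: orthogonal_def)
    then have "y \<in> span S" using insert.prems by (intro insert.IH) auto
    then show ?thesis by (rule span_mono[THEN subsetD, rotated]) auto
  next
    case False
    then obtain f where f: "integral_vector f" "\<And>s. s \<in> S \<Longrightarrow> f \<bullet> s = 0" "f \<bullet> w \<noteq> 0"
      using insert.IH[of w] insert.prems(1) by auto
    have fw: "f \<bullet> w \<in> \<int>" using integral_vector_inner f(1) insert.prems(1) by auto
    have "(f \<bullet> w) *\<^sub>R y - (f \<bullet> y) *\<^sub>R w \<in> span S"
    proof (rule insert.IH)
      fix e assume e: "integral_vector e" "\<And>s. s \<in> S \<Longrightarrow> e \<bullet> s = 0"
      have "((f \<bullet> w) *\<^sub>R e - (e \<bullet> w) *\<^sub>R f) \<bullet> y = 0"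
      proof (rule insert.prems(2))
        show "integral_vector ((f \<bullet> w) *\<^sub>R e - (e \<bullet> w) *\<^sub>R f)"
          using fw e(1) f(1) insert.prems(1)
          by (intro integral_vector_combination integral_vector_inner) auto
      qed (use e(2) f(2) in \<open>auto simp: inner_diff_left\<close>)
      then show "e \<bullet> ((f \<bullet> w) *\<^sub>R y - (f \<bullet> y) *\<^sub>R w) = 0"
        by (simp add: inner_diff_left inner_diff_right mult.commute)
    qed (use insert.prems(1) in auto)
    then have 1: "(f \<bullet> w) *\<^sub>R y - (f \<bullet> y) *\<^sub>R w \<in> span (insert w S)"
      by (rule span_mono[THEN subsetD, rotated]) auto
    have "w \<in> span (insert w S)" by (rule span_base) simp
    then have "((f \<bullet> w) *\<^sub>R y - (f \<bullet> y) *\<^sub>R w) + (f \<bullet> y) *\<^sub>R w \<in> span (insert w S)"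
      using 1 by (intro span_add span_scale)
    then have "(f \<bullet> w) *\<^sub>R y \<in> span (insert w S)" by simp
    from span_scale[OF this, of "1 / (f \<bullet> w)"] show ?thesis using f(3) by simp
  qed
qed

text \<open>A maximal independent subset is finite and has the same span. This covers
  \<open>root_monomials\<close>, which may be infinite.\<close>

lemma in_span_if_integral_annihilator:
  assumes "\<And>s. s \<in> S \<Longrightarrow> integral_vector s"
    and "\<And>f. integral_vector f \<Longrightarrow> (\<And>s. s \<in> S \<Longrightarrow> f \<bullet> s = 0) \<Longrightarrow> f \<bullet> y = 0"
  shows "y \<in> span S"
proof -
  obtain B where B: "B \<subseteq> S" "independent B" "S \<subseteq> span B"
    using maximal_independent_subset[of S] by blast
  have "f \<bullet> s = 0" if "\<And>b. b \<in> B \<Longrightarrow> f \<bullet> b = 0" "s \<in> S" for f s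
    using orthogonal_to_span[of s B f] that B(3) by (auto simp: orthogonal_def)
  then have "y \<in> span B"
    using B assms independent_imp_finite[OF B(2)]
    by (intro in_span_if_integral_annihilator_finite) auto
  then show ?thesis using span_mono[OF B(1)] by auto
qed

lemma integral_vector_matrix_iff:
  "integral_vector (F :: real ^ 'n ^ 'm) \<longleftrightarrow> (\<forall>i j. F $ i $ j \<in> \<int>)"
proof -
  have "F \<bullet> axis i (axis j 1) = F $ i $ j" for i j by (simp add: inner_axis)
  then show ?thesis by (force simp: integral_vector_def Basis_vec_def)
qed

section \<open>Integer polynomials in matrix entries\<close>

definition monomial_value :: "('n \<times> 'n \<Rightarrow>\<^sub>0 nat) \<Rightarrow> 'k::comm_ring_1 ^ 'n ^ 'n \<Rightarrow> 'k" where
  "monomial_value m A = (\<Prod>(i, j)\<in>UNIV. (A $ i $ j) ^ Poly_Mapping.lookup m (i, j))"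

lemma eval_entry_poly_superset:
  assumes "finite S" "Poly_Mapping.keys p \<subseteq> S"
  shows "eval_entry_poly p A = (\<Sum>m\<in>S. of_int (Poly_Mapping.lookup p m) * monomial_value m A)"
  unfolding eval_entry_poly_def monomial_value_def
  using assms by (intro sum.mono_neutral_left) (auto simp: in_keys_iff)

lemma eval_entry_poly_add: "eval_entry_poly (p + q) A = eval_entry_poly p A + eval_entry_poly q A"
proof -
  let ?S = "Poly_Mapping.keys p \<union> Poly_Mapping.keys q"
  have "eval_entry_poly (p + q) A = (\<Sum>m\<in>?S. of_int (Poly_Mapping.lookup (p + q) m) *
      monomial_value m A)"
    by (rule eval_entry_poly_superset) (auto simp: in_keys_iff lookup_add)
  moreover have "eval_entry_poly p A = (\<Sum>m\<in>?S. of_int (Poly_Mapping.lookup p m) * monomial_value m A)"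
    "eval_entry_poly q A = (\<Sum>m\<in>?S. of_int (Poly_Mapping.lookup q m) * monomial_value m A)"
    by (rule eval_entry_poly_superset; auto)+
  ultimately show ?thesis by (simp add: lookup_add distrib_right sum.distrib)
qed

lemma eval_entry_poly_single: "eval_entry_poly (Poly_Mapping.single m c) A = of_int c *
    monomial_value m A"
  by (subst eval_entry_poly_superset[of "{m}"]) (auto simp: keys_single lookup_single)

lemma monomial_value_add: "monomial_value (m + m') A = monomial_value m A * monomial_value m' A"
  by (simp add: monomial_value_def lookup_add power_add split_def prod.distrib)

lemma monomial_value_single: "monomial_value (Poly_Mapping.single (i, j) 1) A = A $ i $ j"
proof -
  have "monomial_value (Poly_Mapping.single (i, j) 1) A = (\<Prod>q\<in>UNIV. if q = (i, j) then A $ i $ j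
      else 1)"
    unfolding monomial_value_def
    by (rule prod.cong) (auto simp: lookup_single when_def split: if_splits)
  then show ?thesis by (simp add: prod.delta)
qed

text \<open>Speaking of the function instead of the formal polynomial lets equations of the
  Chevalley group be produced by closure rules.\<close>

definition integral_polynomial :: "(complex ^ 'n ^ 'n \<Rightarrow> complex) \<Rightarrow> bool" where
  "integral_polynomial f \<longleftrightarrow> (\<exists>p. \<forall>B. eval_entry_poly p B = f B)"

lemma integral_polynomial_single: "integral_polynomial (\<lambda>B. of_int c * monomial_value m B)"
  unfolding integral_polynomial_def using eval_entry_poly_single by blast

lemma integral_polynomial_add:
  "integral_polynomial f \<Longrightarrow> integral_polynomial g \<Longrightarrow> integral_polynomial (\<lambda>B. f B + g B)"
  unfolding integral_polynomial_def by (metis eval_entry_poly_add)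

lemma integral_polynomial_Ints:
  assumes "c \<in> \<int>" shows "integral_polynomial (\<lambda>B. c)"
proof -
  obtain k where "c = of_int k" using assms by (rule Ints_cases)
  then show ?thesis using integral_polynomial_single[of k 0] by (simp add: monomial_value_def)
qed

lemma integral_polynomial_entry: "integral_polynomial (\<lambda>B. B $ i $ j)"
  using integral_polynomial_single[of 1 "Poly_Mapping.single (i, j) 1"]
  by (simp add: monomial_value_single del: One_nat_def)

lemma integral_polynomial_sum:
  "(\<And>s. s \<in> S \<Longrightarrow> integral_polynomial (f s)) \<Longrightarrow> integral_polynomial (\<lambda>B. \<Sum>s\<in>S. f s B)"
proof (induction S rule: infinite_finite_induct)
  case (insert s S)
  then show ?case using integral_polynomial_add[of "f s" "\<lambda>B. \<Sum>s\<in>S. f s B"] by simp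
qed (simp_all add: integral_polynomial_Ints)

lemma integral_polynomial_mult:
  assumes "integral_polynomial f" "integral_polynomial g"
  shows "integral_polynomial (\<lambda>B. f B * g B)"
proof -
  obtain p q where pq: "f = eval_entry_poly p" "g = eval_entry_poly q"
    using assms unfolding integral_polynomial_def by (metis ext)
  have "f B * g B = (\<Sum>m\<in>Poly_Mapping.keys p. \<Sum>m'\<in>Poly_Mapping.keys q.
      of_int (Poly_Mapping.lookup p m * Poly_Mapping.lookup q m') * monomial_value (m + m') B)" for B
    unfolding pq eval_entry_poly_superset[OF finite_keys order_refl] sum_product monomial_value_add
    by (intro sum.cong refl) (simp add: algebra_simps)
  then show ?thesis by (simp only:) (intro integral_polynomial_sum integral_polynomial_single)
qed

lemma integral_polynomial_prod:
  "(\<And>s. s \<in> S \<Longrightarrow> integral_polynomial (f s)) \<Longrightarrow> integral_polynomial (\<lambda>B. \<Prod>s\<in>S. f s B)"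
proof (induction S rule: infinite_finite_induct)
  case (insert s S)
  then show ?case using integral_polynomial_mult[of "f s" "\<lambda>B. \<Prod>s\<in>S. f s B"] by simp
qed (simp_all add: integral_polynomial_Ints)

lemma integral_polynomial_power:
  "integral_polynomial f \<Longrightarrow> integral_polynomial (\<lambda>B. f B ^ n)"
  by (induction n) (simp_all add: integral_polynomial_Ints integral_polynomial_mult)

lemma integral_polynomial_det:
  assumes "\<And>i j. integral_polynomial (\<lambda>B. F B $ i $ j)"
  shows "integral_polynomial (\<lambda>B. det (F B))"
  unfolding det_def
  by (intro integral_polynomial_sum integral_polynomial_mult integral_polynomial_prod
      integral_polynomial_Ints assms) simp

lemma integral_polynomial_compose:
  assumes "\<And>i j. integral_polynomial (\<lambda>B. F B $ i $ j)"
  shows "integral_polynomial (\<lambda>B. eval_entry_poly p (F B))"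
  unfolding eval_entry_poly_def split_def
  by (intro integral_polynomial_sum integral_polynomial_mult integral_polynomial_prod
      integral_polynomial_power integral_polynomial_Ints assms) simp

text \<open>Cramer's rule without the division: in determinant 1 this is the inverse, and its
  entries are integer polynomials in those of \<open>A\<close>.\<close>

definition adjugate :: "'k::field ^ 'n ^ 'n \<Rightarrow> 'k ^ 'n ^ 'n" where
  "adjugate A = (\<chi> k j. det (\<chi> i l. if l = k then (if i = j then 1 else 0) else A $ i $ l))"

lemma adjugate_inverse:
  assumes "det A = 1"
  shows "A ** adjugate A = mat 1" "adjugate A ** A = mat 1"
proof -
  have "(A ** adjugate A) $ i $ j = mat 1 $ i $ j" for i j
  proof -
    have "(\<chi> k. adjugate A $ k $ j) =
        (\<chi> k. det (\<chi> i l. if l = k then axis j 1 $ i else A $ i $ l) / det A)"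
      by (simp add: adjugate_def assms axis_def vec_eq_iff eq_commute cong: if_cong)
    then have "A *v (\<chi> k. adjugate A $ k $ j) = axis j 1"
      using cramer[of A] assms by simp
    then have "(A *v (\<chi> k. adjugate A $ k $ j)) $ i = axis j 1 $ i" by simp
    then show ?thesis
      by (simp add: matrix_vector_mult_def matrix_matrix_mult_def mat_def axis_def eq_commute)
  qed
  then show 1: "A ** adjugate A = mat 1" by (simp add: vec_eq_iff)
  then show "adjugate A ** A = mat 1" by (simp add: matrix_left_right_inverse)
qed

lemma det_adjugate: "det A = 1 \<Longrightarrow> det (adjugate A) = 1"
  using det_mul[of A "adjugate A"] by (simp add: adjugate_inverse)

lemma integral_polynomial_adjugate: "integral_polynomial (\<lambda>B. adjugate B $ i $ j)"
proof -
  have "integral_polynomial (\<lambda>B. if l = i then (if k = j then 1 else 0) else B $ k $ l)" for k l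
    by (cases "l = i"; cases "k = j") (simp_all add: integral_polynomial_Ints
        integral_polynomial_entry)
  then show ?thesis by (simp add: adjugate_def integral_polynomial_det)
qed

section \<open>Extension of scalars to the complex numbers\<close>

definition complexify :: "real ^ 'n ^ 'n \<Rightarrow> complex ^ 'n ^ 'n" where
  "complexify A = (\<chi> i j. of_real (A $ i $ j))"

lemma complexify_nth [simp]: "complexify A $ i $ j = of_real (A $ i $ j)"
  by (simp add: complexify_def)

lemma complexify_eq_iff [simp]: "complexify A = complexify B \<longleftrightarrow> A = B"
  by (simp add: vec_eq_iff)

lemma det_complexify: "det (complexify A) = of_real (det A)"
  by (simp add: det_def)

lemma adjugate_complexify: "adjugate (complexify A) = complexify (adjugate A)"
proof -
  have "(\<chi> i l. if l = k then (if i = j then 1 else 0) else complexify A $ i $ l) =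
      complexify (\<chi> i l. if l = k then (if i = j then 1 else 0) else A $ i $ l)" for k j
    by (simp add: vec_eq_iff)
  then have "adjugate (complexify A) $ k $ j = of_real (adjugate A $ k $ j)" for k j
    unfolding adjugate_def by (simp only: vec_lambda_beta det_complexify)
  then show ?thesis by (simp add: vec_eq_iff)
qed

lemma eval_entry_poly_complexify: "eval_entry_poly p (complexify A) = of_real (eval_entry_poly p A)"
  by (simp add: eval_entry_poly_def split_def)

lemma group_SL: "group (SL_group :: ('k::field ^ 'n ^ 'n) monoid)"
proof (rule groupI)
  fix A :: "'k ^ 'n ^ 'n" assume "A \<in> carrier SL_group"
  then show "\<exists>B\<in>carrier SL_group. B \<otimes>\<^bsub>SL_group\<^esub> A = \<one>\<^bsub>SL_group\<^esub>"
    by (intro bexI[of _ "adjugate A"]) (simp_all add: SL_group_def adjugate_inverse det_adjugate)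
qed (auto simp: SL_group_def det_mul matrix_mul_assoc)

section \<open>Complexification\<close>

definition cx :: "(real, 'n::finite) sqmat \<Rightarrow> (complex, 'n) sqmat" where
  "cx A = sq (complexify (mat_of A))"

lemma entry_cx [simp]: "entry i j (cx A) = of_real (entry i j A)"
  by (simp add: cx_def entry_def)

lemma cx_simps [simp]:
  "cx 0 = 0" "cx 1 = 1" "cx (A + B) = cx A + cx B" "cx (A - B) = cx A - cx B"
  "cx (c *\<^sub>R A) = c *\<^sub>R cx A" "cx (A * B) = cx A * cx B"
  by (rule sqmat_eqI; simp add: entry_one entry_mult scaleR_conv_of_real[where 'a = complex])+

lemma cx_power: "cx (A ^ n) = cx A ^ n"
  by (induction n) simp_all

lemma cx_sum: "cx (sum f S) = (\<Sum>s\<in>S. cx (f s))"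
  by (induction S rule: infinite_finite_induct) simp_all

lemma cx_commutator: "cx (commutator A B) = commutator (cx A) (cx B)"
  by (simp add: commutator_def)

lemma cx_eq_iff [simp]: "cx A = cx B \<longleftrightarrow> A = B"
  by (simp add: cx_def mat_of_inject)

text \<open>The algebra \<open>sqmat\<close> carries only real scalar multiplication, so complex
  scalars enter as central matrices.\<close>

definition scalar :: "complex \<Rightarrow> (complex, 'n::finite) sqmat" where
  "scalar t = sq (mat t)"

lemma entry_scalar: "entry i j (scalar t) = (if i = j then t else 0)"
  by (simp add: scalar_def mat_def)

lemma entry_scalar_mult [simp]: "entry i j (scalar t * A) = t * entry i j A"
  and entry_mult_scalar [simp]: "entry i j (A * scalar t) = t * entry i j A"
proof -
  have *: "(if i = k then t else 0) * y = (if k = i then t * y else 0)"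
    "y * (if k = j then t else 0) = (if k = j then t * y else 0)" for k :: 'a and y
    by auto
  have "entry i j (scalar t * A) = (\<Sum>k\<in>UNIV. (if i = k then t else 0) * entry k j A)"
    "entry i j (A * scalar t) = (\<Sum>k\<in>UNIV. entry i k A * (if k = j then t else 0))"
    by (simp_all add: entry_mult entry_scalar)
  then show "entry i j (scalar t * A) = t * entry i j A" "entry i j (A * scalar t) = t * entry i j A"
    unfolding * by simp_all
qed

lemma scalar_commute: "A * scalar t = scalar t * A"
  by (rule sqmat_eqI) simp

lemma scalar_of_real: "scalar (of_real c) * A = c *\<^sub>R A"
  by (rule sqmat_eqI) (simp add: scaleR_conv_of_real[where 'a = complex])

lemma commutator_scalar: "commutator (scalar t * A) B = scalar t * commutator A B"
  and commutator_scalar_right: "commutator A (scalar t * B) = scalar t * commutator A B"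
proof -
  have "B * (scalar t * A) = scalar t * (B * A)" for A B :: "(complex, 'a) sqmat"
    by (metis mult.assoc scalar_commute)
  then show "commutator (scalar t * A) B = scalar t * commutator A B"
    "commutator A (scalar t * B) = scalar t * commutator A B"
    by (simp_all add: commutator_def mult.assoc right_diff_distrib)
qed

lemma scalar_power: "(scalar t * A) ^ k = scalar (t ^ k) * A ^ k"
proof (induction k)
  case (Suc k)
  have "scalar t * A * (scalar (t ^ k) * A ^ k) = scalar t * (A * scalar (t ^ k)) * A ^ k"
    by (simp only: mult.assoc)
  also have "\<dots> = scalar t * scalar (t ^ k) * (A * A ^ k)"
    by (simp only: scalar_commute[of A] mult.assoc)
  also have "scalar t * scalar (t ^ k) = scalar (t ^ Suc k)"
    by (rule sqmat_eqI) (simp add: entry_scalar)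
  finally show ?case by (simp add: Suc)
qed (simp add: scalar_def flip: one_sqmat_def)

text \<open>The complex linear extension of the inner product with the real matrix
  \<open>F\<close>.\<close>

definition pairing :: "real ^ 'n ^ 'n \<Rightarrow> (complex, 'n::finite) sqmat \<Rightarrow> complex" where
  "pairing F Y = (\<Sum>i\<in>UNIV. \<Sum>j\<in>UNIV. of_real (F $ i $ j) * entry i j Y)"

lemma pairing_simps [simp]:
  "pairing F 0 = 0" "pairing F (Y + Z) = pairing F Y + pairing F Z"
  "pairing F (Y - Z) = pairing F Y - pairing F Z" "pairing F (scalar t * Y) = t * pairing F Y"
  "pairing F (c *\<^sub>R Y) = c *\<^sub>R pairing F Y"
  by (simp_all add: pairing_def sum.distrib sum_subtractf distrib_left right_diff_distrib
      sum_distrib_left scaleR_sum_right mult.left_commute)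

lemma pairing_diff_left: "pairing (F - F') Y = pairing F Y - pairing F' Y"
  by (simp add: pairing_def sum_subtractf left_diff_distrib)

lemma pairing_sum: "pairing F (sum f S) = (\<Sum>s\<in>S. pairing F (f s))"
  by (induction S rule: infinite_finite_induct) simp_all

lemma pairing_cx: "pairing F (cx A) = of_real (F \<bullet> mat_of A)"
  by (simp add: pairing_def inner_vec_def) (simp add: entry_def)

lemma pairing_mult_left: "pairing F (cx A * Y) = pairing (transpose (mat_of A) ** F) Y"
proof -
  have "pairing F (cx A * Y) = (\<Sum>i\<in>UNIV. \<Sum>j\<in>UNIV. \<Sum>k\<in>UNIV.
      of_real (F $ i $ j) * (of_real (entry i k A) * entry k j Y))"
    by (simp add: pairing_def entry_mult sum_distrib_left)
  also have "\<dots> = (\<Sum>j\<in>UNIV. \<Sum>i\<in>UNIV. \<Sum>k\<in>UNIV.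
      of_real (F $ i $ j) * (of_real (entry i k A) * entry k j Y))"
    by (rule sum.swap)
  also have "\<dots> = (\<Sum>j\<in>UNIV. \<Sum>k\<in>UNIV. \<Sum>i\<in>UNIV.
      of_real (F $ i $ j) * (of_real (entry i k A) * entry k j Y))"
    by (intro sum.cong refl sum.swap)
  also have "\<dots> = (\<Sum>k\<in>UNIV. \<Sum>j\<in>UNIV. \<Sum>i\<in>UNIV.
      of_real (F $ i $ j) * (of_real (entry i k A) * entry k j Y))"
    by (rule sum.swap)
  also have "\<dots> = pairing (transpose (mat_of A) ** F) Y"
    by (simp add: pairing_def matrix_matrix_mult_def transpose_def entry_def sum_distrib_right
        sum_distrib_left
        mult.assoc mult.commute mult.left_commute)
  finally show ?thesis .
qed

lemma pairing_mult_right: "pairing F (Y * cx A) = pairing (F ** transpose (mat_of A)) Y"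
proof -
  have "pairing F (Y * cx A) = (\<Sum>i\<in>UNIV. \<Sum>j\<in>UNIV. \<Sum>k\<in>UNIV.
      of_real (F $ i $ j) * (entry i k Y * of_real (entry k j A)))"
    by (simp add: pairing_def entry_mult sum_distrib_left)
  also have "\<dots> = (\<Sum>i\<in>UNIV. \<Sum>k\<in>UNIV. \<Sum>j\<in>UNIV.
      of_real (F $ i $ j) * (entry i k Y * of_real (entry k j A)))"
    by (intro sum.cong refl sum.swap)
  also have "\<dots> = pairing (F ** transpose (mat_of A)) Y"
    by (simp add: pairing_def matrix_matrix_mult_def transpose_def entry_def sum_distrib_right
        sum_distrib_left
        mult.assoc mult.commute mult.left_commute)
  finally show ?thesis .
qed

lemma inner_mult_left:
  fixes A W :: "(real, 'n::finite) sqmat"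
  shows "F \<bullet> mat_of (A * W) = (transpose (mat_of A) ** F) \<bullet> mat_of W"
proof -
  have "complex_of_real (F \<bullet> mat_of (A * W)) = of_real ((transpose (mat_of A) ** F) \<bullet> mat_of W)"
    unfolding pairing_cx[symmetric] cx_simps(6) pairing_mult_left ..
  then show ?thesis by (simp only: of_real_eq_iff)
qed

lemma inner_mult_right:
  fixes A W :: "(real, 'n::finite) sqmat"
  shows "F \<bullet> mat_of (W * A) = (F ** transpose (mat_of A)) \<bullet> mat_of W"
proof -
  have "complex_of_real (F \<bullet> mat_of (W * A)) = of_real ((F ** transpose (mat_of A)) \<bullet> mat_of W)"
    unfolding pairing_cx[symmetric] cx_simps(6) pairing_mult_right ..
  then show ?thesis by (simp only: of_real_eq_iff)
qed

lemma linear_sq: "linear (sq :: real ^ 'n ^ 'n \<Rightarrow> (real, 'n::finite) sqmat)"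
  by (rule linearI) (simp_all add: mat_of_inject_iff scaleR_sqmat_def)

definition integral_matrix :: "(real, 'n::finite) sqmat \<Rightarrow> bool" where
  "integral_matrix A \<longleftrightarrow> (\<forall>i j. entry i j A \<in> \<int>)"

lemma integral_matrix_vector: "integral_matrix A \<longleftrightarrow> integral_vector (mat_of A)"
  by (simp add: integral_matrix_def integral_vector_matrix_iff entry_def)

lemma integral_matrix_one: "integral_matrix 1"
  by (simp add: integral_matrix_def entry_one)

lemma integral_matrix_mult: "integral_matrix A \<Longrightarrow> integral_matrix B \<Longrightarrow> integral_matrix (A * B)"
  by (simp add: integral_matrix_def entry_mult Ints_sum)

lemma integral_matrix_commutator:
  "integral_matrix A \<Longrightarrow> integral_matrix B \<Longrightarrow> integral_matrix (commutator A B)"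
  using integral_matrix_mult[of A B] integral_matrix_mult[of B A]
  by (simp add: integral_matrix_def commutator_def)

text \<open>This describes the complex span of the real integral matrices \<open>S\<close> by the integral
  linear equations that they satisfy.\<close>

definition annihilated :: "(real, 'n::finite) sqmat set \<Rightarrow> (complex, 'n) sqmat \<Rightarrow> bool" where
  "annihilated S Y \<longleftrightarrow>
    (\<forall>F. integral_vector F \<longrightarrow> (\<forall>W\<in>S. F \<bullet> mat_of W = 0) \<longrightarrow> pairing F Y = 0)"

lemma inner_span_zero:
  assumes "\<forall>W\<in>S. F \<bullet> mat_of W = 0" "W \<in> span S"
  shows "F \<bullet> mat_of W = 0"
  using assms(2) by (induction rule: span_induct_alt) (use assms(1) in \<open>simp_all add:
      scaleR_sqmat_def inner_add_right\<close>)

lemma annihilated_cx: "W \<in> span S \<Longrightarrow> annihilated S (cx W)"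
  unfolding annihilated_def by (auto simp: pairing_cx inner_span_zero)

lemma annihilated_scalar: "annihilated S Y \<Longrightarrow> annihilated S (scalar t * Y)"
  and annihilated_scaleR: "annihilated S Y \<Longrightarrow> annihilated S (c *\<^sub>R Y)"
  by (simp_all add: annihilated_def)

lemma annihilated_sum: "(\<And>k. k \<in> K \<Longrightarrow> annihilated S (f k)) \<Longrightarrow> annihilated S (sum f K)"
  by (simp add: annihilated_def pairing_sum)

text \<open>Composing an integral form that kills \<open>S\<close> with left multiplication by
  \<open>A\<close> gives another such form, whose matrix is obtained from \<open>F\<close> by the
  transpose of \<open>A\<close>. The next lemma does the same for brackets.\<close>

lemma annihilated_mult_left:
  assumes A: "integral_matrix A" and S: "\<And>W. W \<in> S \<Longrightarrow> A * W \<in> span S" and Y: "annihilated S Y"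
  shows "annihilated S (cx A * Y)"
  unfolding annihilated_def pairing_mult_left
proof (intro allI impI)
  fix F :: "real ^ 'a ^ 'a" assume F: "integral_vector F" "\<forall>W\<in>S. F \<bullet> mat_of W = 0"
  have "integral_vector (transpose (mat_of A) ** F)"
    using A F(1) by (simp add: integral_vector_matrix_iff integral_matrix_vector
        matrix_matrix_mult_def
        transpose_def Ints_sum)
  moreover have "\<forall>W\<in>S. (transpose (mat_of A) ** F) \<bullet> mat_of W = 0"
    using inner_span_zero[OF F(2) S] by (simp only: inner_mult_left[symmetric]) simp
  ultimately show "pairing (transpose (mat_of A) ** F) Y = 0" using Y by (simp add: annihilated_def)
qed

lemma annihilated_commutator:
  assumes A: "integral_matrix A" and S: "\<And>W. W \<in> S \<Longrightarrow> commutator A W \<in> span S"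
    and Y: "annihilated S Y"
  shows "annihilated S (commutator (cx A) Y)"
  unfolding annihilated_def
proof (intro allI impI)
  fix F :: "real ^ 'a ^ 'a" assume F: "integral_vector F" "\<forall>W\<in>S. F \<bullet> mat_of W = 0"
  let ?F = "transpose (mat_of A) ** F - F ** transpose (mat_of A)"
  have "integral_vector ?F"
    using A F(1) by (simp add: integral_vector_matrix_iff integral_matrix_vector
        matrix_matrix_mult_def
        transpose_def Ints_sum)
  moreover have "?F \<bullet> mat_of W = F \<bullet> mat_of (commutator A W)" for W
    by (simp add: inner_diff_left inner_diff_right commutator_def del: mat_of_simps(6)
        flip: inner_mult_left inner_mult_right)
  then have "\<forall>W\<in>S. ?F \<bullet> mat_of W = 0" using inner_span_zero[OF F(2) S] by simp
  ultimately have "pairing ?F Y = 0" using Y by (simp add: annihilated_def)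
  then show "pairing F (commutator (cx A) Y) = 0"
    by (simp add: commutator_def pairing_mult_left pairing_mult_right pairing_diff_left)
qed

lemma in_span_if_annihilated:
  assumes "\<And>W. W \<in> S \<Longrightarrow> integral_matrix W" "annihilated S (cx Y)"
  shows "Y \<in> span S"
proof -
  have "mat_of Y \<in> span (mat_of ` S)"
    using assms by (intro in_span_if_integral_annihilator)
      (auto simp: integral_matrix_vector annihilated_def pairing_cx)
  then have "sq (mat_of Y) \<in> sq ` span (mat_of ` S)" by (rule imageI)
  also have "\<dots> = span (sq ` mat_of ` S)" by (rule linear_span_image[OF linear_sq, symmetric])
  also have "sq ` mat_of ` S = S" by (simp add: image_image)
  finally show ?thesis by simp
qed

text \<open>Expanding the iterated bracket gives terms with \<open>m\<close> factors
  \<open>x\<close> distributed on the two sides of \<open>y\<close>, so one side has at least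
  \<open>K\<close> of them. The outer powers \<open>p\<close> and \<open>q\<close> in the proof keep
  track of this distribution.\<close>

lemma commutator_funpow_nilpotent:
  fixes x y :: "'a::ring_1"
  assumes "x ^ K = 0" "2 * K \<le> m"
  shows "(commutator x ^^ m) y = 0"
proof -
  have "x ^ p * (commutator x ^^ m) y * x ^ q = 0" if "2 * K \<le> p + q + m" for p q m
    using that
  proof (induction m arbitrary: p q)
    case 0
    have "x ^ n = 0" if "K \<le> n" for n
      using assms(1) that by (metis le_add_diff_inverse mult_zero_left power_add)
    moreover have "K \<le> p \<or> K \<le> q" using 0 by auto
    ultimately show ?case by auto
  next
    case (Suc m)
    have "x ^ p * (commutator x ^^ Suc m) y * x ^ q =
        x ^ Suc p * (commutator x ^^ m) y * x ^ q - x ^ p * (commutator x ^^ m) y * x ^ Suc q"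
      by (simp add: commutator_def power_commutes mult.assoc right_diff_distrib left_diff_distrib
          flip: power_Suc2) (metis mult.assoc power_commutes)
    also have "\<dots> = 0" using Suc.IH[of "Suc p" q] Suc.IH[of p "Suc q"] Suc.prems by simp
    finally show ?case .
  qed
  from this[of 0 0 m] show ?thesis using assms(2) by simp
qed

section \<open>The integral form of the representation\<close>

context chevalley_algebra
begin

lemma commutator_in_lie_span:
  assumes a: "a \<in> Phi" and W: "W \<in> M ` Phi \<union> cartan_element ` Phi"
  shows "commutator (M a) W \<in> lie_span"
  using W
proof
  assume "W \<in> M ` Phi"
  then obtain b where b: "b \<in> Phi" "W = M b" by blast
  consider "a + b \<in> Phi" | "a + b = 0" | "a + b \<noteq> 0" "a + b \<notin> Phi" by blast
  then show ?thesis
  proof cases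
    case 1
    then obtain N :: real where "commutator (M a) W = N *\<^sub>R M (a + b)"
      using relations a b unfolding chevalley_relations_def by blast
    with 1 show ?thesis by (simp add: lie_span_def span_base span_scale)
  next
    case 2
    then have "b = - a" by (simp add: eq_neg_iff_add_eq_0 add.commute)
    then have "commutator (M a) W = cartan_element a" by (simp add: b cartan_element_def)
    with a show ?thesis by (simp add: lie_span_def span_base)
  next
    case 3
    then have "commutator (M a) W = 0"
      using relations a b unfolding chevalley_relations_def by blast
    then show ?thesis by (simp add: lie_span_def span_zero)
  qed
next
  assume "W \<in> cartan_element ` Phi"
  then have "W \<in> span (cartan_element ` Phi)" by (rule span_base)
  from commutator_M_span_cartan[OF a this] show ?thesis
    using a by (auto simp: lie_span_def span_base span_scale)
qed

end

locale chevalley_representation = complex_lie_algebra smul bracket + roots Phi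
  for smul :: "complex \<Rightarrow> 'l::ab_group_add \<Rightarrow> 'l" and bracket :: "'l \<Rightarrow> 'l \<Rightarrow> 'l"
    and Phi :: "'e::euclidean_space set" +
  fixes Delta :: "'e set" and h x :: "'e \<Rightarrow> 'l" and rep :: "'l \<Rightarrow> complex ^ 'n ^ 'n"
  assumes basis: "chevalley_basis smul bracket Phi Delta h x"
    and faithful: "faithful_rep smul bracket rep"
    and integral_coords: "integral_coordinates rep Phi x"
begin

definition \<rho> :: "'l \<Rightarrow> (complex, 'n) sqmat" where
  "\<rho> u = sq (rep u)"

lemma \<rho>_add: "\<rho> (u + v) = \<rho> u + \<rho> v"
  using faithful by (simp add: faithful_rep_def \<rho>_def plus_sqmat_def)

lemma \<rho>_smul: "\<rho> (smul c u) = scalar c * \<rho> u"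
  using faithful by (intro sqmat_eqI) (simp add: faithful_rep_def \<rho>_def)

lemma \<rho>_of_real: "\<rho> (smul (of_real c) u) = c *\<^sub>R \<rho> u"
  by (simp only: \<rho>_smul scalar_of_real)

lemma \<rho>_bracket: "\<rho> (bracket u v) = commutator (\<rho> u) (\<rho> v)"
  using faithful by (simp add: faithful_rep_def \<rho>_def commutator_def times_sqmat_def minus_sqmat_def)

lemma \<rho>_eq_iff: "\<rho> u = \<rho> v \<longleftrightarrow> u = v"
  using faithful by (simp add: faithful_rep_def \<rho>_def inj_eq)

lemma \<rho>_0: "\<rho> 0 = 0"
  using \<rho>_add[of 0 0] by simp

lemma \<rho>_sum: "\<rho> (sum f S) = (\<Sum>s\<in>S. \<rho> (f s))"
  by (induction S rule: infinite_finite_induct) (simp_all add: \<rho>_0 \<rho>_add)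

section \<open>The real root vectors and their relations\<close>

definition M :: "'e \<Rightarrow> (real, 'n) sqmat" where
  "M a = sq (\<chi> i j. of_int \<lfloor>Re (rep (x a) $ i $ j)\<rfloor>)"

lemma divided_powers_integral:
  "a \<in> Phi \<Longrightarrow> entry i j (\<rho> (x a) ^ k) / fact k \<in> \<int>"
  using integral_coords by (simp add: integral_coordinates_def matpow_eq \<rho>_def entry_def)

lemma cx_M:
  assumes "a \<in> Phi"
  shows "cx (M a) = \<rho> (x a)"
proof (rule sqmat_eqI)
  fix i j
  have "rep (x a) $ i $ j \<in> \<int>"
    using divided_powers_integral[OF assms, of i j 1] by (simp add: \<rho>_def)
  then show "entry i j (cx (M a)) = entry i j (\<rho> (x a))"
    by (auto simp: M_def \<rho>_def elim!: Ints_cases)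
qed

lemma M_divided_powers_integral:
  assumes "a \<in> Phi"
  shows "entry i j (M a ^ k) / fact k \<in> \<int>"
proof -
  have "complex_of_real (entry i j (M a ^ k) / fact k) \<in> \<int>"
    using divided_powers_integral[OF assms, of i j k] by (simp add: cx_M[OF assms, symmetric]
        flip: cx_power)
  then obtain m where "complex_of_real (entry i j (M a ^ k) / fact k) = of_real (of_int m)"
    by (auto elim!: Ints_cases)
  then show ?thesis by (simp only: of_real_eq_iff) simp
qed

text \<open>Since \<open>X\<^sup>k/k!\<close> is integral for all \<open>k\<close> and tends to \<open>0\<close>, it eventually vanishes.\<close>

lemma M_nilpotent:
  assumes "a \<in> Phi"
  shows "\<exists>k. M a ^ k = 0"
proof -
  have "(\<lambda>k. norm (M a) ^ k /\<^sub>R fact k) \<longlonglongrightarrow> 0"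
    by (rule summable_LIMSEQ_zero[OF summable_exp_generic])
  then have "eventually (\<lambda>k. norm (M a) ^ k /\<^sub>R fact k < 1) sequentially"
    by (rule order_tendstoD) simp
  then obtain k where k: "norm (M a) ^ k / fact k < 1"
    by (auto simp: eventually_sequentially divide_inverse mult.commute)
  have "entry i j (M a ^ k) = 0" for i j
  proof -
    have "norm (entry i j (M a ^ k)) \<le> norm (M a) ^ k"
      by (rule order_trans[OF norm_entry_le_norm norm_power_ineq])
    then have "\<bar>entry i j (M a ^ k) / fact k\<bar> \<le> norm (M a) ^ k / fact k"
      by (simp add: divide_right_mono)
    then have "\<bar>entry i j (M a ^ k) / fact k\<bar> < 1" using k by linarith
    with M_divided_powers_integral[OF assms, of i j k] have "entry i j (M a ^ k) / fact k = 0"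
      by (metis Ints_nonzero_abs_less1)
    then show ?thesis by simp
  qed
  then show ?thesis by (intro exI[of _ k] sqmat_eqI) simp
qed

lemma bracket_sum_left: "bracket (sum f S) v = (\<Sum>s\<in>S. bracket (f s) v)"
proof (induction S rule: infinite_finite_induct)
  case (insert s S)
  then show ?case by (simp add: bracket_add_left)
qed (use bracket_scale_left[of 0 0 v] in simp_all)

lemma bracket_cartan:
  assumes "a \<in> Phi" "b \<in> Phi"
  shows "bracket (bracket (x a) (x (- a))) (x b) = smul (of_real (b \<bullet> coroot a)) (x b)"
proof -
  obtain c :: "'e \<Rightarrow> int" where c: "coroot a = (\<Sum>d\<in>Delta. of_int (c d) *\<^sub>R coroot d)"
    "bracket (x a) (x (- a)) = (\<Sum>d\<in>Delta. smul (of_int (c d)) (h d))"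
    using basis assms(1) unfolding chevalley_basis_def by blast
  have hd: "bracket (h d) (x b) = smul (of_real (b \<bullet> coroot d)) (x b)" if "d \<in> Delta" for d
    using basis that assms(2) unfolding chevalley_basis_def by blast
  have "bracket (bracket (x a) (x (- a))) (x b) =
      (\<Sum>d\<in>Delta. smul (of_int (c d) * of_real (b \<bullet> coroot d)) (x b))"
    unfolding c(2) bracket_sum_left by (intro sum.cong refl) (simp add: bracket_scale_left hd)
  also have "\<dots> = smul (\<Sum>d\<in>Delta. of_int (c d) * of_real (b \<bullet> coroot d)) (x b)"
    by (rule scale_sum_left[symmetric])
  also have "(\<Sum>d\<in>Delta. of_int (c d) * complex_of_real (b \<bullet> coroot d)) = of_real (b \<bullet> coroot a)"
    unfolding c(1) by (simp add: inner_sum_right)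
  finally show ?thesis .
qed

lemma bracket_roots:
  assumes "a \<in> Phi" "b \<in> Phi" "a + b \<in> Phi"
  shows "\<exists>N::real. bracket (x a) (x b) = smul (of_real N) (x (a + b))"
proof -
  let ?r = "GREATEST r::nat. b - of_nat r *\<^sub>R a \<in> Phi"
  have "bracket (x a) (x b) = smul (of_nat (?r + 1)) (x (a + b)) \<or>
      bracket (x a) (x b) = smul (- of_nat (?r + 1)) (x (a + b))"
    using basis assms unfolding chevalley_basis_def Let_def by blast
  then show ?thesis
    by (metis of_real_minus of_real_of_nat_eq)
qed

text \<open>Each relation is checked after \<open>cx\<close>, where \<open>M a\<close> becomes the
  represented \<open>x a\<close>, and descends because \<open>cx\<close> is injective.\<close>

lemma chevalley_relations_M: "chevalley_relations M"
proof -
  have 1: "\<exists>N::real. commutator (M a) (M b) = N *\<^sub>R M (a + b)"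
    if "a \<in> Phi" "b \<in> Phi" "a + b \<in> Phi" for a b
  proof -
    obtain N :: real where "bracket (x a) (x b) = smul (of_real N) (x (a + b))"
      using bracket_roots \<open>a \<in> Phi\<close> \<open>b \<in> Phi\<close> \<open>a + b \<in> Phi\<close> by blast
    then have "cx (commutator (M a) (M b)) = cx (N *\<^sub>R M (a + b))"
      using \<rho>_bracket[of "x a" "x b"] that by (simp add: cx_commutator cx_M \<rho>_of_real)
    then show ?thesis unfolding cx_eq_iff by blast
  qed
  have 2: "commutator (M a) (M b) = 0"
    if "a \<in> Phi" "b \<in> Phi" "a + b \<noteq> 0" "a + b \<notin> Phi" for a b
  proof -
    have "bracket (x a) (x b) = 0"
      using basis \<open>a \<in> Phi\<close> \<open>b \<in> Phi\<close> \<open>a + b \<noteq> 0\<close> \<open>a + b \<notin> Phi\<close>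
      unfolding chevalley_basis_def by blast
    then have "cx (commutator (M a) (M b)) = cx 0"
      using \<rho>_bracket[of "x a" "x b"] that by (simp add: cx_commutator cx_M \<rho>_0)
    then show ?thesis by (simp only: cx_eq_iff)
  qed
  have 3: "commutator (commutator (M a) (M (- a))) (M b) = (b \<bullet> coroot a) *\<^sub>R M b"
    if "a \<in> Phi" "b \<in> Phi" for a b
  proof -
    have "cx (commutator (commutator (M a) (M (- a))) (M b)) = cx ((b \<bullet> coroot a) *\<^sub>R M b)"
      using bracket_cartan[OF that, THEN arg_cong, of \<rho>] that uminus_root[OF that(1)]
      by (simp add: cx_commutator cx_M \<rho>_of_real \<rho>_bracket)
    then show ?thesis by (simp only: cx_eq_iff)
  qed
  show ?thesis unfolding chevalley_relations_def using 1 2 3 M_nilpotent by blast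
qed

sublocale chevalley_algebra Phi M
  by unfold_locales (rule chevalley_relations_M)

lemma independent_root_vectors:
  assumes "(\<Sum>d\<in>Phi. y d *\<^sub>R M d) = 0" "d \<in> Phi"
  shows "y d = 0"
proof -
  have "inj_on (case_sum h x) (Delta <+> Phi)"
    and indep: "independent (case_sum h x ` (Delta <+> Phi))"
    using basis unfolding chevalley_basis_def by blast+
  have inj: "inj_on x Phi"
  proof (rule inj_onI)
    fix a b assume "a \<in> Phi" "b \<in> Phi" "x a = x b"
    then have "Inr a = (Inr b :: 'e + 'e)"
      using inj_onD[OF \<open>inj_on (case_sum h x) (Delta <+> Phi)\<close>, of "Inr a" "Inr b"] by auto
    then show "a = b" by simp
  qed
  have "cx (\<Sum>d\<in>Phi. y d *\<^sub>R M d) = \<rho> (\<Sum>d\<in>Phi. smul (of_real (y d)) (x d))"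
    by (simp add: cx_sum \<rho>_sum \<rho>_of_real cx_M)
  then have "\<rho> (\<Sum>d\<in>Phi. smul (of_real (y d)) (x d)) = \<rho> 0" by (simp add: assms(1) \<rho>_0)
  then have "(\<Sum>d\<in>Phi. smul (of_real (y d)) (x d)) = 0" by (simp only: \<rho>_eq_iff)
  \<comment> \<open>Independence is stated for a set of vectors, so the sum over roots is reindexed
    along the injective \<open>x\<close>.\<close>
  then have "(\<Sum>v\<in>x ` Phi. smul (of_real (y (inv_into Phi x v))) v) = 0"
    by (simp add: sum.reindex[OF inj] inv_into_f_f[OF inj])
  then have "complex_of_real (y (inv_into Phi x (x d))) = 0"
    using assms(2) finite_roots by (intro independentD[OF indep, of "x ` Phi"]) force+
  then show ?thesis by (simp add: inv_into_f_f[OF inj assms(2)])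
qed

lemma integral_matrix_M: "a \<in> Phi \<Longrightarrow> integral_matrix (M a)"
  unfolding integral_matrix_def using M_divided_powers_integral[of a _ _ 1] by simp

lemma root_unipotent_real: "root_unipotent rep x a t = mat_of (unipotent a t)"
proof -
  have "sq (\<chi> i j. t * of_int \<lfloor>Re (rep (x a) $ i $ j)\<rfloor>) = t *\<^sub>R M a"
    by (rule sqmat_eqI) (simp add: M_def)
  then show ?thesis by (simp add: root_unipotent_def mat_exp_eq unipotent_def)
qed

section \<open>The complex elementary group\<close>

definition complex_unipotent :: "'e \<Rightarrow> complex \<Rightarrow> (complex, 'n) sqmat" where
  "complex_unipotent a t = exp (scalar t * cx (M a))"

lemma root_unipotent_complex: "root_unipotent rep x a t = mat_of (complex_unipotent a t)"
proof -
  have "sq (\<chi> i j. t * of_int \<lfloor>Re (rep (x a) $ i $ j)\<rfloor>) = scalar t * cx (M a)"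
    by (rule sqmat_eqI) (simp add: M_def)
  then show ?thesis by (simp add: root_unipotent_def mat_exp_eq complex_unipotent_def)
qed

lemma scalar_uminus: "scalar (- t) * A = - (scalar t * A)"
  by (rule sqmat_eqI) simp

lemma complex_unipotent_inverse:
  "complex_unipotent a t * complex_unipotent a (- t) = 1"
  "complex_unipotent a (- t) * complex_unipotent a t = 1"
  using exp_minus_inverse[of "scalar t * cx (M a)"] exp_minus_inverse[of "- (scalar t * cx (M a))"]
  by (simp_all add: complex_unipotent_def scalar_uminus)

lemma det_mat_of_mult: "det (mat_of (A * B)) = det (mat_of A) * det (mat_of B)"
  by (simp add: det_mul)

text \<open>A torus element conjugates \<open>x\<^sub>a(t)\<close> to \<open>x\<^sub>a(2t) = x\<^sub>a(t)\<^sup>2\<close>, so the determinant is idempotent.\<close>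

lemma det_complex_unipotent:
  assumes "a \<in> Phi"
  shows "det (mat_of (complex_unipotent a t)) = 1"
proof -
  let ?X = "scalar t * cx (M a)" and ?H = "(ln 2 / 2) *\<^sub>R cx (cartan_element a)"
  let ?d = "\<lambda>A. det (mat_of A)"
  have "commutator (cx (cartan_element a)) (cx (M a)) = 2 *\<^sub>R cx (M a)"
    using commutator_cartan[OF assms assms] root_coroot[OF assms] by (metis cx_commutator cx_simps(5))
  then have "commutator ?H ?X = ln 2 *\<^sub>R ?X"
    by (simp add: commutator_scaleR commutator_scalar_right)
  then have "exp ?H * ?X * exp (- ?H) = 2 *\<^sub>R ?X"
    using exp_conjugate_eigenvector[of ?H ?X "ln 2"] by simp
  moreover have H: "exp (- ?H) * exp ?H = 1" "exp ?H * exp (- ?H) = 1"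
    using exp_minus_inverse[of ?H] exp_minus_inverse[of "- ?H"] by simp_all
  ultimately have "exp ?H * exp ?X * exp (- ?H) = exp (?X + ?X)"
    using exp_conjugate[OF H, of ?X] by (simp add: scaleR_2)
  also have "\<dots> = exp ?X * exp ?X" by (rule exp_add_commuting) simp
  finally have "?d (exp ?H) * ?d (exp ?X) * ?d (exp (- ?H)) = ?d (exp ?X) * ?d (exp ?X)"
    by (simp only: det_mat_of_mult[symmetric])
  moreover have "?d (exp ?H) * ?d (exp (- ?H)) = 1"
    using H(2) by (simp add: det_mat_of_mult[symmetric] del: mat_of_simps(6))
  moreover have "d = d * d" if "u * d * v = d * d" "u * v = 1" for d u v :: complex
    using that by algebra
  ultimately have "?d (exp ?X) = ?d (exp ?X) * ?d (exp ?X)" by blast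
  moreover have "?d (exp ?X) * ?d (complex_unipotent a (- t)) = 1"
    using complex_unipotent_inverse(1)[of a t]
    by (simp add: det_mat_of_mult[symmetric] complex_unipotent_def del: mat_of_simps(6))
  then have "?d (exp ?X) \<noteq> 0" by auto
  ultimately show ?thesis by (simp add: complex_unipotent_def)
qed

abbreviation lie_generators :: "(real, 'n) sqmat set" where
  "lie_generators \<equiv> M ` Phi \<union> cartan_element ` Phi"

lemma integral_lie_generators: "W \<in> lie_generators \<Longrightarrow> integral_matrix W"
  using integral_matrix_M uminus_root
  by (auto simp: cartan_element_def intro!: integral_matrix_commutator)

lemma commutator_lie_generators:
  "a \<in> Phi \<Longrightarrow> W \<in> lie_generators \<Longrightarrow> commutator (M a) W \<in> Real_Vector_Spaces.span lie_generators"
  using commutator_in_lie_span by (simp add: lie_span_def)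

text \<open>Their span is the associative unital algebra generated by the root vectors. It will be
  seen to contain the real points, and whatever commutes with the root vectors commutes with
  it.\<close>

inductive_set root_monomials :: "(real, 'n) sqmat set" where
  one: "1 \<in> root_monomials"
| mult: "a \<in> Phi \<Longrightarrow> Y \<in> root_monomials \<Longrightarrow> M a * Y \<in> root_monomials"

lemma integral_root_monomials: "W \<in> root_monomials \<Longrightarrow> integral_matrix W"
  by (induction rule: root_monomials.induct)
    (auto intro: integral_matrix_one integral_matrix_mult integral_matrix_M)

text \<open>By nilpotency, conjugation is a finite sum of iterated brackets with a multiple of
  \<open>M a\<close>, each of which preserves the integral equations. For
  \<open>root_monomials\<close> the exponential series of left multiplication plays the same
  part.\<close>

lemma annihilated_unipotent_conjugate:
  assumes a: "a \<in> Phi" and Y: "annihilated lie_generators Y"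
  shows "annihilated lie_generators (complex_unipotent a t * Y * complex_unipotent a (- t))"
proof -
  let ?X = "scalar t * cx (M a)"
  obtain K where "M a ^ K = 0" using nilpotent[OF a] by blast
  then have "?X ^ K = 0" by (simp add: scalar_power flip: cx_power)
  then have "(commutator ?X ^^ (2 * K)) Y = 0" by (rule commutator_funpow_nilpotent) simp
  from exp_conjugate_nilpotent[OF this]
  have "complex_unipotent a t * Y * complex_unipotent a (- t) =
      (\<Sum>k<2 * K. (commutator ?X ^^ k) Y /\<^sub>R fact k)"
    by (simp add: complex_unipotent_def scalar_uminus)
  moreover have "annihilated lie_generators ((commutator ?X ^^ k) Y)" for k
  proof (induction k)
    case (Suc k)
    then show ?case
      using commutator_lie_generators[OF a]
      by (auto simp: commutator_scalar intro!: annihilated_scalar annihilated_commutator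
          integral_matrix_M[OF a])
  qed (simp add: Y)
  ultimately show ?thesis by (simp add: annihilated_sum annihilated_scaleR)
qed

lemma annihilated_unipotent_mult:
  assumes a: "a \<in> Phi" and Y: "annihilated root_monomials Y"
  shows "annihilated root_monomials (complex_unipotent a t * Y)"
proof -
  let ?X = "scalar t * cx (M a)"
  obtain K where "M a ^ K = 0" using nilpotent[OF a] by blast
  then have "?X ^ K = 0" by (simp add: scalar_power flip: cx_power)
  from exp_nilpotent[OF this]
  have "complex_unipotent a t * Y = (\<Sum>k<K. (?X ^ k * Y) /\<^sub>R fact k)"
    by (simp add: complex_unipotent_def sum_distrib_right)
  moreover have "annihilated root_monomials (?X ^ k * Y)" for k
  proof (induction k)
    case (Suc k)
    have "annihilated root_monomials (cx (M a) * (?X ^ k * Y))"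
      using a by (intro annihilated_mult_left Suc integral_matrix_M) (auto intro:
          real_vector.span_base root_monomials.mult)
    from annihilated_scalar[OF this, of t] show ?case by (simp add: mult.assoc)
  qed (simp add: Y)
  ultimately show ?thesis by (simp add: annihilated_sum annihilated_scaleR)
qed

lemma sq_adjugate:
  assumes "det B = 1" "B ** C = mat 1"
  shows "adjugate B = C"
  by (metis adjugate_inverse(2) assms matrix_mul_assoc matrix_mul_lid matrix_mul_rid)

text \<open>The determinant is carried through the induction because \<open>adjugate\<close> is the
  inverse only in determinant 1; quantifying over all \<open>Y\<close> lets the stability statements
  compose along products.\<close>

lemma elementary_group_complex:
  assumes "B \<in> elementary_group rep Phi x"
  shows "det B = 1 \<and>
    (\<forall>Y. annihilated lie_generators Y \<longrightarrow> annihilated lie_generators (sq B * Y * sq (adjugate B))) \<and>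
    (\<forall>Y. annihilated root_monomials Y \<longrightarrow> annihilated root_monomials (sq B * Y))" (is "?P B")
proof -
  have adj: "adjugate (mat_of (complex_unipotent a t)) = mat_of (complex_unipotent a (- t))"
    if "a \<in> Phi" for a t
    using det_complex_unipotent[OF that] complex_unipotent_inverse(1)[of a t]
    by (intro sq_adjugate) (simp_all flip: mat_of_simps(6))
  have gen: "?P (mat_of (complex_unipotent a t))" if "a \<in> Phi" for a t
    using that by (simp add: det_complex_unipotent adj annihilated_unipotent_conjugate
        annihilated_unipotent_mult)
  have inverse: "inv\<^bsub>SL_group\<^esub> (mat_of (complex_unipotent a t)) = mat_of (complex_unipotent a (- t))"
    if "a \<in> Phi" for a t
    using that complex_unipotent_inverse(2)[of a t]
    by (intro group.inv_equality[OF group_SL])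
      (simp_all add: SL_group_def det_complex_unipotent flip: mat_of_simps(6))
  show ?thesis
    using assms unfolding elementary_group_def
  proof (induction rule: generate.induct)
    case one
    have "adjugate (mat 1 :: complex ^ 'n ^ 'n) = mat 1" by (intro sq_adjugate) simp_all
    then show ?case by (simp add: SL_group_def flip: one_sqmat_def)
  next
    case (incl B)
    then show ?case using gen by (auto simp: root_unipotent_complex)
  next
    case (inv B)
    then show ?case using gen inverse by (auto simp: root_unipotent_complex)
  next
    case (eng B C)
    have adj_mult: "adjugate (B ** C) = adjugate C ** adjugate B"
    proof (rule sq_adjugate)
      have "B ** C ** (adjugate C ** adjugate B) = B ** (C ** adjugate C) ** adjugate B"
        by (simp add: matrix_mul_assoc)
      then show "B ** C ** (adjugate C ** adjugate B) = mat 1"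
        using eng.IH by (simp add: adjugate_inverse)
    qed (use eng.IH in \<open>simp add: det_mul\<close>)
    have "sq (B ** C) * Y * sq (adjugate (B ** C)) = sq B * (sq C * Y * sq (adjugate C)) * sq
        (adjugate B)"
      "sq (B ** C) * Y = sq B * (sq C * Y)" for Y
      by (simp_all only: adj_mult sq_mult mult.assoc)
    then have "?P (B ** C)" using eng.IH by (simp only: det_mul) simp
    then show ?case by (simp add: SL_group_def)
  qed
qed

end

section \<open>Real points of the Chevalley group\<close>

context chevalley_representation
begin

abbreviation real_points :: "(real ^ 'n ^ 'n) monoid" where
  "real_points \<equiv> chevalley_group rep Phi x"

lemma real_points_simps [simp]:
  "A \<otimes>\<^bsub>real_points\<^esub> B = A ** B" "\<one>\<^bsub>real_points\<^esub> = mat 1"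
  by (simp_all add: chevalley_group_def SL_group_def)

lemma det_real_points: "A \<in> carrier real_points \<Longrightarrow> det A = 1"
  by (simp add: chevalley_group_def SL_group_def)

text \<open>The bridge from the complex elementary group to real points: an integer polynomial that
  vanishes on the former is one of the defining equations of the latter.\<close>

lemma polynomial_vanishes_on_real_points:
  assumes "A \<in> carrier real_points" "integral_polynomial f"
    and "\<And>B. B \<in> elementary_group rep Phi x \<Longrightarrow> f B = 0"
  shows "f (complexify A) = 0"
proof -
  obtain p where p: "\<And>B. eval_entry_poly p B = f B"
    using assms(2) unfolding integral_polynomial_def by blast
  then have "p \<in> chevalley_equations rep Phi x"
    using assms(3) by (simp add: chevalley_equations_def)
  then have "eval_entry_poly p A = 0" using assms(1) by (simp add: chevalley_group_def)
  then show ?thesis using p[of "complexify A"] by (simp add: eval_entry_poly_complexify)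
qed

lemma adjugate_elementary_group:
  assumes "(B :: complex ^ 'n ^ 'n) \<in> elementary_group rep Phi x"
  shows "adjugate B \<in> elementary_group rep Phi x"
proof -
  have "{root_unipotent rep x a t |a t. a \<in> Phi} \<subseteq> carrier (SL_group :: (complex ^ 'n ^ 'n) monoid)"
    by (auto simp: SL_group_def root_unipotent_complex det_complex_unipotent)
  from group.generate_m_inv_closed[OF group_SL this] assms
  have "inv\<^bsub>SL_group\<^esub> B \<in> elementary_group rep Phi x" unfolding elementary_group_def by blast
  moreover have "det B = 1" using elementary_group_complex[OF assms] by blast
  then have "inv\<^bsub>SL_group\<^esub> B = adjugate B"
    by (intro group.inv_equality[OF group_SL]) (simp_all add: SL_group_def adjugate_inverse
        det_adjugate)
  ultimately show ?thesis by simp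
qed

text \<open>Composing a defining equation with \<open>adjugate\<close> gives an integer polynomial
  that also vanishes on the complex elementary group, which is closed under inverses.\<close>

lemma adjugate_real_points:
  assumes "A \<in> carrier real_points"
  shows "adjugate A \<in> carrier real_points"
proof -
  have "eval_entry_poly p (adjugate A) = 0" if p: "p \<in> chevalley_equations rep Phi x" for p
  proof -
    have "eval_entry_poly p (adjugate (complexify A)) = 0"
      by (rule polynomial_vanishes_on_real_points[OF assms])
        (use p adjugate_elementary_group in \<open>auto simp: chevalley_equations_def
          intro: integral_polynomial_compose integral_polynomial_adjugate\<close>)
    then show ?thesis by (simp add: adjugate_complexify eval_entry_poly_complexify)
  qed
  then show ?thesis
    using det_real_points[OF assms] by (simp add: chevalley_group_def SL_group_def det_adjugate)
qed

lemma real_points_inverse: "A \<in> carrier real_points \<Longrightarrow> inv\<^bsub>real_points\<^esub> A = adjugate A"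
  unfolding m_inv_def
  by (rule the_equality)
    (auto simp: adjugate_real_points adjugate_inverse det_real_points sq_adjugate)

lemma sq_complexify: "sq (complexify A) = cx (sq A)"
  by (simp add: cx_def)

lemma integral_polynomial_pairing:
  assumes "integral_vector F" "\<And>i j. integral_polynomial (\<lambda>B. entry i j (Z B))"
  shows "integral_polynomial (\<lambda>B. pairing F (Z B))"
proof -
  have "complex_of_real (F $ i $ j) \<in> \<int>" for i j
    using assms(1) by (auto simp: integral_vector_matrix_iff elim!: Ints_cases)
  then show ?thesis
    unfolding pairing_def
    by (intro integral_polynomial_sum integral_polynomial_mult integral_polynomial_Ints assms(2))
qed

text \<open>For an integral form \<open>F\<close> that kills \<open>lie_generators\<close>,
  evaluating it on the conjugate of \<open>M a\<close> by \<open>B\<close> is an integer polynomial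
  in \<open>B\<close> that vanishes on the complex elementary group, hence at \<open>A\<close>.
  These forms cut out \<open>lie_span\<close>.\<close>

lemma conjugate_real_points:
  assumes A: "A \<in> carrier real_points" and a: "a \<in> Phi"
  shows "sq A * M a * sq (adjugate A) \<in> lie_span"
  unfolding lie_span_def
proof (rule in_span_if_annihilated)
  show "annihilated lie_generators (cx (sq A * M a * sq (adjugate A)))"
    unfolding annihilated_def
  proof (intro allI impI)
    fix F :: "real ^ 'n ^ 'n"
    assume F: "integral_vector F" "\<forall>W\<in>lie_generators. F \<bullet> mat_of W = 0"
    have "pairing F (sq (complexify A) * cx (M a) * sq (adjugate (complexify A))) = 0"
    proof (rule polynomial_vanishes_on_real_points[OF A])
      have M: "complex_of_real (entry k l (M a)) \<in> \<int>" for k l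
        using integral_matrix_M[OF a] by (auto simp: integral_matrix_def elim!: Ints_cases)
      show "integral_polynomial (\<lambda>B. pairing F (sq B * cx (M a) * sq (adjugate B)))"
        by (rule integral_polynomial_pairing[OF F(1)], simp only: entry_mult entry_sq entry_cx)
          (intro integral_polynomial_sum integral_polynomial_mult integral_polynomial_entry
            integral_polynomial_adjugate integral_polynomial_Ints M)
    next
      fix B :: "complex ^ 'n ^ 'n" assume B: "B \<in> elementary_group rep Phi x"
      have "annihilated lie_generators (cx (M a))"
        using a by (intro annihilated_cx real_vector.span_base) blast
      then show "pairing F (sq B * cx (M a) * sq (adjugate B)) = 0"
        using elementary_group_complex[OF B] F unfolding annihilated_def by blast
    qed
    then show "pairing F (cx (sq A * M a * sq (adjugate A))) = 0"
      by (simp only: adjugate_complexify sq_complexify cx_simps)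
  qed
qed (rule integral_lie_generators)

text \<open>Integral forms vanishing on \<open>root_monomials\<close> also vanish at
  \<open>A\<close>, so \<open>A\<close> lies in the associative algebra generated by the root
  vectors, with which \<open>z\<close> commutes.\<close>

lemma centralizer_commutes_with_real_points:
  assumes A: "A \<in> carrier real_points" and z: "\<And>a. a \<in> Phi \<Longrightarrow> z * M a = M a * z"
  shows "z * sq A = sq A * z"
proof -
  have "sq A \<in> Real_Vector_Spaces.span root_monomials"
  proof (rule in_span_if_annihilated)
    show "annihilated root_monomials (cx (sq A))"
      unfolding annihilated_def
    proof (intro allI impI)
      fix F :: "real ^ 'n ^ 'n"
      assume F: "integral_vector F" "\<forall>W\<in>root_monomials. F \<bullet> mat_of W = 0"
      have "pairing F (sq (complexify A)) = 0"
      proof (rule polynomial_vanishes_on_real_points[OF A])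
        show "integral_polynomial (\<lambda>B. pairing F (sq B))"
          by (rule integral_polynomial_pairing[OF F(1)]) (simp add: integral_polynomial_entry)
      next
        fix B :: "complex ^ 'n ^ 'n" assume B: "B \<in> elementary_group rep Phi x"
        have "annihilated root_monomials (cx 1)"
          by (intro annihilated_cx real_vector.span_base root_monomials.one)
        then have "annihilated root_monomials (sq B * cx 1)" using elementary_group_complex[OF B]
            by blast
        then show "pairing F (sq B) = 0" using F by (simp add: annihilated_def)
      qed
      then show "pairing F (cx (sq A)) = 0" by (simp only: sq_complexify)
    qed
  qed (rule integral_root_monomials)
  moreover have "z * W = W * z" if "W \<in> root_monomials" for W
    using that
  proof induction
    case (mult a Y)
    have "z * (M a * Y) = M a * (z * Y)" using z[OF mult(1)] by (metis mult.assoc)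
    then show ?case by (simp add: mult.IH mult.assoc)
  qed simp
  ultimately show ?thesis
    by (induction rule: real_vector.span_induct_alt) (simp_all add: algebra_simps)
qed

end

locale large_chevalley_subgroup = chevalley_representation smul bracket Phi Delta h x rep
  for smul :: "complex \<Rightarrow> 'l::ab_group_add \<Rightarrow> 'l" and bracket Phi Delta
    and h x :: "'e::euclidean_space \<Rightarrow> 'l" and rep :: "'l \<Rightarrow> complex ^ 'n ^ 'n" +
  fixes H :: "(real ^ 'n ^ 'n) set"
  assumes large: "large_subgroup rep Phi x H"
begin

lemma H_subgroup: "subgroup H real_points"
  using large by (simp add: large_subgroup_def)

lemma H_real_points: "A \<in> H \<Longrightarrow> A \<in> carrier real_points"
  using subgroup.subset[OF H_subgroup] by blast

lemma adjugate_in_H: "A \<in> H \<Longrightarrow> adjugate A \<in> H"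
  using subgroup.m_inv_closed[OF H_subgroup] real_points_inverse[OF H_real_points] by metis

lemma H_adjugate_inverse: "A \<in> H \<Longrightarrow> sq A * sq (adjugate A) = 1" "A \<in> H \<Longrightarrow> sq (adjugate A) * sq A = 1"
  using adjugate_inverse[OF det_real_points[OF H_real_points]]
  by (simp_all add: one_sqmat_def flip: sq_mult)

lemma elementary_in_H: "elementary_group rep Phi x \<subseteq> H"
  using large by (simp add: large_subgroup_def)

sublocale chevalley_points Phi M "sq ` H"
proof unfold_locales
  show "y d = 0" if "(\<Sum>d\<in>Phi. y d *\<^sub>R M d) = 0" "d \<in> Phi" for y d
    using independent_root_vectors that .
  show "1 \<in> sq ` H"
    using subgroup.one_closed[OF H_subgroup] by (auto simp: one_sqmat_def)
  show "A * B \<in> sq ` H" if "A \<in> sq ` H" "B \<in> sq ` H" for A B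
    using that subgroup.m_closed[OF H_subgroup] by (auto simp flip: sq_mult)
  show "\<exists>B\<in>sq ` H. A * B = 1 \<and> B * A = 1" if "A \<in> sq ` H" for A
    using that H_adjugate_inverse adjugate_in_H by blast
  show "unipotent a t \<in> sq ` H" if "a \<in> Phi" for a t
  proof -
    have "root_unipotent rep x a t \<in> H"
      using elementary_in_H that unfolding elementary_group_def by (auto intro: generate.incl)
    then show ?thesis unfolding root_unipotent_real by (metis imageI sq_mat_of)
  qed
  show "A * M a * B \<in> lie_span" if "A \<in> sq ` H" "B \<in> sq ` H" "A * B = 1" "a \<in> Phi" for A B a
  proof -
    obtain C where C: "C \<in> H" "A = sq C" using \<open>A \<in> sq ` H\<close> by blast
    have "B = sq (adjugate C) * sq C * B" by (simp add: H_adjugate_inverse(2)[OF C(1)])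
    also have "\<dots> = sq (adjugate C) * (A * B)" by (simp add: C(2) mult.assoc)
    finally have "B = sq (adjugate C)" by (simp add: that(3))
    then show ?thesis using conjugate_real_points[OF H_real_points[OF C(1)] that(4)] C(2) by simp
  qed
  show "z * A = A * z" if "A \<in> sq ` H" "\<And>a. a \<in> Phi \<Longrightarrow> z * M a = M a * z" for A z
    using that centralizer_commutes_with_real_points[OF H_real_points] by blast
qed

section \<open>Transfer of equations from matrices to \<open>sqmat\<close>\<close>

abbreviation matrix_group :: "(real ^ 'n ^ 'n) monoid" where
  "matrix_group \<equiv> real_points\<lparr>carrier := H\<rparr>"

text \<open>Inverses are definite descriptions relative to each carrier; both are identified with
  \<open>adjugate\<close>.\<close>

lemma inv_matrix_group: "A \<in> H \<Longrightarrow> sq (inv\<^bsub>matrix_group\<^esub> A) = iv (sq A)"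
proof -
  assume A: "A \<in> H"
  have "inv\<^bsub>matrix_group\<^esub> A = adjugate A"
    unfolding m_inv_def
    by (rule the_equality)
      (use A H_real_points in \<open>auto simp: adjugate_in_H adjugate_inverse det_real_points sq_adjugate\<close>)
  moreover have "iv (sq A) = sq (adjugate A)"
    using A adjugate_in_H H_adjugate_inverse by (intro iv_unique) auto
  ultimately show ?thesis by simp
qed

lemma word_val_matrix_group:
  assumes "\<And>i. \<sigma> i \<in> H" "set cs \<subseteq> H" "word_wf (length cs) w"
  shows "sq (word_val matrix_group cs \<sigma> w) = word_val G (map sq cs) (\<lambda>i. sq (\<sigma> i)) w"
  using assms(3)
proof (induction w)
  case Nil
  show ?case by (simp add: word_val_def one_sqmat_def)
next
  case (Cons l w)
  have "cs ! i \<in> H" if "i < length cs" for i using assms(2) that by auto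
  then have "sq (letter_val matrix_group cs \<sigma> l) = letter_val G (map sq cs) (\<lambda>i. sq (\<sigma> i)) l"
    using Cons.prems assms(1) by (cases l) (auto simp: inv_matrix_group)
  with Cons show ?case by (simp add: word_val_def sq_mult)
qed

lemma system_solvable_matrix_group:
  assumes "set cs \<subseteq> H" "system_wf (length cs) S"
  shows "system_solvable matrix_group cs S \<longleftrightarrow> system_solvable G (map sq cs) S"
proof
  assume "system_solvable matrix_group cs S"
  then obtain \<sigma> where \<sigma>: "\<forall>i. \<sigma> i \<in> H" "\<forall>w\<in>set S. word_val matrix_group cs \<sigma> w = mat 1"
    unfolding system_solvable_def by auto
  have "word_val G (map sq cs) (\<lambda>i. sq (\<sigma> i)) w = 1" if "w \<in> set S" for w
    using word_val_matrix_group[of \<sigma> cs w] \<sigma> that assms by (simp add: system_wf_def one_sqmat_def)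
  with \<sigma>(1) show "system_solvable G (map sq cs) S"
    unfolding system_solvable_def by (intro exI[of _ "\<lambda>i. sq (\<sigma> i)"]) simp
next
  assume "system_solvable G (map sq cs) S"
  then obtain \<sigma> where \<sigma>: "\<forall>i. \<sigma> i \<in> sq ` H" "\<forall>w\<in>set S. word_val G (map sq cs) \<sigma> w = 1"
    unfolding system_solvable_def by auto
  have *: "mat_of (\<sigma> i) \<in> H" for i using \<sigma>(1) by (metis image_iff mat_of_sq)
  have "word_val matrix_group cs (\<lambda>i. mat_of (\<sigma> i)) w = mat 1" if "w \<in> set S" for w
    using word_val_matrix_group[of "\<lambda>i. mat_of (\<sigma> i)" cs w] \<sigma>(2) * that assms
    by (simp add: system_wf_def one_sqmat_def)
  with * show "system_solvable matrix_group cs S"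
    unfolding system_solvable_def by (intro exI[of _ "\<lambda>i. mat_of (\<sigma> i)"]) simp
qed

text \<open>A list of roots along which \<open>g\<close> factors, and the signs of its entries, are
  chosen without any algorithm; they enter only as fixed data of the programs that compute the
  entries.\<close>

theorem undecidable:
  assumes indecomposable: "indecomposable Phi"
    and g: "g \<in> elementary_group rep Phi x" "\<not> computable_matrix g"
  shows "\<not> diophantine_decidable matrix_group ({root_unipotent rep x a 1 |a. a \<in> Phi} \<union> {g})"
proof
  assume "diophantine_decidable matrix_group ({root_unipotent rep x a 1 |a. a \<in> Phi} \<union> {g})"
  then obtain cs p where cs: "set cs = {root_unipotent rep x a 1 |a. a \<in> Phi} \<union> {g}"
    and p: "\<And>S. system_wf (length cs) S \<Longrightarrow>
      rec_eval p [system_code S] (if system_solvable matrix_group cs S then 1 else 0)"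
    unfolding diophantine_decidable_def by blast
  have generators: "root_unipotent rep x a t \<in> elementary_group rep Phi x" if "a \<in> Phi" for a t
    using that unfolding elementary_group_def by (auto intro: generate.incl)
  have cs_H: "set cs \<subseteq> H" using elementary_in_H generators g(1) by (auto simp: cs)
  interpret I: integral_chevalley_coefficients Phi M "sq ` H" "map sq cs"
  proof unfold_locales
    show "set (map sq cs) \<subseteq> sq ` H" using cs_H by auto
    show "unipotent a 1 \<in> set (map sq cs)" if "a \<in> Phi" for a
    proof -
      have "sq (root_unipotent rep x a 1) \<in> sq ` set cs" using that by (intro imageI) (auto simp: cs)
      then show ?thesis by (simp add: root_unipotent_real)
    qed
  qed (use indecomposable M_divided_powers_integral in blast)+
  have "\<exists>L. set L \<subseteq> Phi \<and> I.root_product L (sq g)"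
    using g(1) unfolding elementary_group_def
  proof induction
    case one
    show ?case by (rule exI[of _ "[]"]) (simp add: SL_group_def one_sqmat_def)
  next
    case (incl A)
    then obtain a t where a: "a \<in> Phi" "A = mat_of (unipotent a t)" by (auto simp:
        root_unipotent_real)
    then have "I.root_product [a] (sq A)" using I.root_product_unipotent[OF a(1), of t] by simp
    with a(1) show ?case by (intro exI[of _ "[a]"]) simp
  next
    case (inv A)
    then obtain a t where a: "a \<in> Phi" "A = mat_of (unipotent a t)" by (auto simp:
        root_unipotent_real)
    have "mat_of (unipotent a s) \<in> carrier SL_group" for s
      using generators[OF a(1), of s] elementary_in_H det_real_points[OF H_real_points]
      by (auto simp: root_unipotent_real SL_group_def)
    then have "inv\<^bsub>SL_group\<^esub> A = mat_of (unipotent a (- t))"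
      using unipotent_inverse(2)[of a t] unfolding a(2)
      by (intro group.inv_equality[OF group_SL]) (simp_all add: SL_group_def flip: mat_of_simps(6))
    then have "I.root_product [a] (sq (inv\<^bsub>SL_group\<^esub> A))"
      using I.root_product_unipotent[OF a(1), of "- t"] by simp
    with a(1) show ?case by (intro exI[of _ "[a]"]) simp
  next
    case (eng A B)
    then obtain L L' where "set L \<subseteq> Phi" "I.root_product L (sq A)" "set L' \<subseteq> Phi" "I.root_product
        L' (sq B)"
      by blast
    moreover have "sq B \<in> sq ` H" using eng.hyps elementary_in_H unfolding elementary_group_def by
        blast
    ultimately show ?case
      using I.root_product_mult[of L "sq A" L' "sq B"]
      by (intro exI[of _ "L @ L'"]) (simp add: SL_group_def sq_mult)
  qed
  then obtain L where L: "set L \<subseteq> Phi" "I.root_product L (sq g)" by blast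
  obtain r where r: "r \<in> Phi" using indecomposable unfolding indecomposable_def by blast
  have "computable_real (g $ i $ j)" for i j
  proof (rule computable_real_if_comparisons_computable)
    have "sq g \<in> set (map sq cs)" by (simp add: cs)
    moreover have "rec_eval p [system_code S] (if system_solvable G (map sq cs) S then 1 else 0)"
      if "system_wf (length (map sq cs)) S" for S
      using p[of S] system_solvable_matrix_group[OF cs_H, of S] that by simp
    ultimately show "computable_fun 2 (\<lambda>xs. if real (xs ! 1) \<le> real (xs ! 0) * \<bar>g $ i $ j\<bar> then 1
        else 0)"
      using I.comparisons_computable[OF r _ L, of p i j] by simp
  qed
  with g(2) show False by (simp add: computable_matrix_def)
qed

end

theorem mainTheorem10:
  fixes Phi Delta :: "'e::euclidean_space set"
    and smul :: "complex \<Rightarrow> 'l::ab_group_add \<Rightarrow> 'l"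
    and bracket :: "'l \<Rightarrow> 'l \<Rightarrow> 'l"
    and h x :: "'e \<Rightarrow> 'l"
    and rep :: "'l \<Rightarrow> complex^'n^'n"
    and g :: "real^'n^'n"
    and H :: "(real^'n^'n) set"
  assumes "root_system Phi" and "indecomposable Phi" and "dim Phi > 1"
    and "root_base Phi Delta"
    and "semisimple_lie_algebra smul bracket"
    and "chevalley_basis smul bracket Phi Delta h x"
    and "faithful_rep smul bracket rep"
    and "integral_coordinates rep Phi x"
    and "g \<in> elementary_group rep Phi x"
    and "\<not> computable_matrix g"
    and "large_subgroup rep Phi x H"
  shows "\<not> diophantine_decidable ((chevalley_group rep Phi x)\<lparr>carrier := H\<rparr>)
           ({root_unipotent rep x a 1 |a. a \<in> Phi} \<union> {g})"
proof -
  interpret complex_lie_algebra smul bracket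
    using assms(5) by (simp add: semisimple_lie_algebra_def)
  interpret large_chevalley_subgroup smul bracket Phi Delta h x rep H
    by unfold_locales (use assms in simp_all)
  show ?thesis by (rule undecidable) (use assms in simp_all)
qed

end
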